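(* Let $D\subset\mathbb{R}^2$ be a planar domain with area $|D|$, contained in a disc of radius $R$. Then its mean resistance satisfies $$\frac{\mathcal{R}(D)}{R}\ \ge\ \frac{\pi}{54}\left(\frac{|D|}{R^2}\right)^3.$$
   Context: A domain is a bounded, finitely connected open set $D\subset\mathbb{R}^d$ with piecewise smooth boundary; $|D|$ is its volume (area if $d=2$). Consider billiard motion in $\mathbb{R}^d\setminus D$ (unit speed, straight lines, specular reflection off $\partial D$). For $R>0$ with $D$ contained in the ball bounded by $S^{d-1}_R=\{|x|=R\}$, and for $\xi\in S^{d-1}_R$, $v\in S^{d-1}$ with $\langle v,\xi\rangle<0$, let $v^+_D(v,\xi)$ be the velocity with which the billiard trajectory starting at $\xi$ with velocity $v$ finally leaves the ball (defined for almost every $(v,\xi)$). Let $\Sigma^-_R=\{(v,\xi)\in S^{d-1}\times S^{d-1}_R:\langle v,\xi\rangle\le0\}$ with measure $d\mu(v,\xi)=|\langle v,\xi/R\rangle|\,dv\,d\xi$ (standard surface measures). The mean resistance of $D$ is $$\mathcal{R}(D)=\int_{\Sigma^-_R}\big(1-\langle v,v^+_D(v,\xi)\rangle\big)\,d\mu(v,\xi),$$ which is independent of the choice (radius and position) of the ball containing $D$. *)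

theory Defs
  imports "HOL-Analysis.Analysis"
begin

type_synonym pt = "real^2"

definition unit_vec :: "real \<Rightarrow> pt" where
  "unit_vec a = vector [cos a, sin a]"

definition piecewise_smooth_boundary :: "pt set \<Rightarrow> bool" where
  "piecewise_smooth_boundary D \<longleftrightarrow>
     (\<exists>\<Gamma>. finite \<Gamma> \<and>
        (\<forall>\<gamma>\<in>\<Gamma>. arc \<gamma> \<and> \<gamma> C1_differentiable_on {0..1} \<and>
                 (\<forall>t\<in>{0..1}. vector_derivative \<gamma> (at t) \<noteq> 0)) \<and>
        frontier D = (\<Union>\<gamma>\<in>\<Gamma>. path_image \<gamma>))"

definition planar_domain :: "pt set \<Rightarrow> bool" where
  "planar_domain D \<longleftrightarrow> open D \<and> bounded D \<and> finite (components D) \<and>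
     piecewise_smooth_boundary D"

definition boundary_tangent :: "pt set \<Rightarrow> pt \<Rightarrow> pt \<Rightarrow> bool" where
  "boundary_tangent D p \<tau> \<longleftrightarrow> \<tau> \<noteq> 0 \<and>
     (\<exists>\<gamma> e. e > 0 \<and> \<gamma> C1_differentiable_on {-1..1} \<and> inj_on \<gamma> {-1..1} \<and>
        \<gamma> 0 = p \<and> vector_derivative \<gamma> (at 0) = \<tau> \<and>
        frontier D \<inter> ball p e = \<gamma> ` {-1..1} \<inter> ball p e)"

definition reflect_tangent :: "pt \<Rightarrow> pt \<Rightarrow> pt" where
  "reflect_tangent \<tau> u = (2 * (u \<bullet> \<tau>) / (\<tau> \<bullet> \<tau>)) *\<^sub>R \<tau> - u"

definition billiard_exit :: "pt set \<Rightarrow> pt \<Rightarrow> pt \<Rightarrow> pt \<Rightarrow> bool" where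
  "billiard_exit D \<xi> v w \<longleftrightarrow>
     (\<exists>(n::nat) (x::nat \<Rightarrow> pt) (u::nat \<Rightarrow> pt).
        x 0 = \<xi> \<and> u 0 = v \<and> u n = w \<and>
        (\<forall>i<n. (\<exists>t>0. x (Suc i) = x i + t *\<^sub>R u i) \<and>
               open_segment (x i) (x (Suc i)) \<inter> closure D = {} \<and>
               x (Suc i) \<in> frontier D \<and>
               (\<exists>\<tau>. boundary_tangent D (x (Suc i)) \<tau> \<and> u (Suc i) = reflect_tangent \<tau> (u i))) \<and>
        (\<forall>s>0. x n + s *\<^sub>R u n \<notin> closure D))"

text \<open>Final velocity v^+_D(v, xi) (only used where it is uniquely defined).\<close>
definition v_plus :: "pt set \<Rightarrow> pt \<Rightarrow> pt \<Rightarrow> pt" where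
  "v_plus D v \<xi> = (THE w. billiard_exit D \<xi> v w)"

text \<open>Integrand with respect to d phi d theta, where v = unit_vec phi and
  xi = c + R unit_vec theta; dv d xi = R d phi d theta and the weight is
  abs <v, (xi - c)/R>.  On the (null) set where v^+ is undefined it is set to 0.\<close>
definition resistance_integrand :: "pt set \<Rightarrow> pt \<Rightarrow> real \<Rightarrow> real \<Rightarrow> real \<Rightarrow> real" where
  "resistance_integrand D c R \<phi> \<theta> =
     (let v = unit_vec \<phi>; e = unit_vec \<theta>; \<xi> = c + R *\<^sub>R e in
      if v \<bullet> e \<le> 0 \<and> (\<exists>!w. billiard_exit D \<xi> v w)
      then (1 - v \<bullet> v_plus D v \<xi>) * \<bar>v \<bullet> e\<bar> * R else 0)"

definition resistance_wrt :: "pt set \<Rightarrow> pt \<Rightarrow> real \<Rightarrow> real" where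
  "resistance_wrt D c R =
     enn2real (\<integral>\<^sup>+ p. indicator ({0..2*pi} \<times> {0..2*pi}) p *
                       ennreal (resistance_integrand D c R (fst p) (snd p)) \<partial>lborel)"

text \<open>Mean resistance R(D): computed with some ball containing the closure of D
  (the value is independent of this choice).\<close>
definition mean_resistance :: "pt set \<Rightarrow> real" where
  "mean_resistance D =
     (let cR = (SOME cR. snd cR > 0 \<and> closure D \<subseteq> ball (fst cR) (snd cR))
      in resistance_wrt D (fst cR) (snd cR))"

end

theory Submission
  imports Defs
begin

text \<open>Let C be the closure of D, |D| its area, and work with oriented lines, parametrised by direction v and
  offset p, instead of points on a circle. The free flight and the reflection law preserve the measure
  |n . v| ds dv on the boundary phase space, so the collision map, applied to the incoming lines together
  with all outgoing boundary states, does not increase the measure (an inequality is enough). Summed over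
  the collisions of a trajectory this has two consequences. Since the boundary measure is finite, almost
  every trajectory has finitely many collisions. Since the free segments starting at distinct states do
  not overlap, the lengths of all trajectories inside a reference box integrate to at most the phase volume
  of the box minus 2 pi |D|. On the other hand the length of a trajectory with initial and final velocities
  v and w is at least that of the straight line minus R |v - w|. Hence the integral of R |v - w| is at
  least 2 pi |D|, and |v - w| squared is twice the integrand 1 - v . w of the resistance, so Cauchy-Schwarz
  gives the bound pi/2 |D|^2 / R^3, which is stronger than the cubic one because |D| <= 4 R^2.\<close>

section \<open>Areas swept by rays\<close>

text \<open>The assumption on the boundary is weak: the arcs may overlap, meet infinitely often or
  form cracks inside the closure of D, whereas a collision in \<open>billiard_exit\<close> asks for
  a single embedded C1 curve through the point of impact. This shapes the argument. Collisions are
  studied in an abstract locale that asks for regularity only at boundary points reached from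
  outside the closure and off a countable set \<open>N0\<close>; regularity there is extracted from
  the finiteness of \<open>components D\<close>. The exceptional states form a null set of the
  boundary phase space, and the transfer inequality turns null sets of boundary states into null
  sets of incoming lines. Only areas of planar sweeps are ever computed: with the direction fixed,
  the change of variables is two-dimensional, and the directions enter through Fubini.\<close>

definition cr :: "pt \<Rightarrow> pt \<Rightarrow> real" where
  "cr a b = a$1 * b$2 - a$2 * b$1"

definition rot :: "pt \<Rightarrow> pt" where
  "rot v = vector [- v$2, v$1]"

lemma vector2_eq_iff: "(a::pt) = b \<longleftrightarrow> a$1 = b$1 \<and> a$2 = b$2"
  by (simp add: vec_eq_iff forall_2)

lemma inner2: "(a::pt) \<bullet> b = a$1 * b$1 + a$2 * b$2"
  by (simp add: inner_vec_def sum_2)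

lemma rot_nth [simp]: "rot v $ 1 = - v$2" "rot v $ 2 = v$1"
  by (simp_all add: rot_def vector_2)

lemma continuous_on_vector2 [continuous_intros]:
  assumes "continuous_on S f" "continuous_on S g"
  shows "continuous_on S (\<lambda>x. vector [f x, g x] :: pt)"
proof -
  have eq: "(\<lambda>x. vector [f x, g x] :: pt) = (\<lambda>x. f x *\<^sub>R axis 1 1 + g x *\<^sub>R axis 2 1)"
    by (auto simp: vector2_eq_iff vector_2 axis_def)
  show ?thesis by (subst eq) (intro continuous_intros assms)
qed

lemma continuous_on_rot [continuous_intros]: "continuous_on S f \<Longrightarrow> continuous_on S (\<lambda>x. rot (f x))"
  unfolding rot_def by (intro continuous_intros) (auto intro!: continuous_intros)

lemma continuous_on_cr [continuous_intros]:
  "continuous_on S f \<Longrightarrow> continuous_on S g \<Longrightarrow> continuous_on S (\<lambda>x. cr (f x) (g x))"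
  unfolding cr_def by (intro continuous_intros)

lemma measurable_vec_nth [measurable]: "(\<lambda>x::real^'n. x $ i) \<in> borel_measurable borel"
  by (intro borel_measurable_continuous_onI continuous_intros)

lemma measurable_rot [measurable]: "rot \<in> borel_measurable borel"
  using continuous_on_rot[OF continuous_on_id] by (intro borel_measurable_continuous_onI) simp

lemma measurable_cr [measurable]:
  assumes [measurable]: "f \<in> borel_measurable M" "g \<in> borel_measurable M"
  shows "(\<lambda>x. cr (f x) (g x)) \<in> borel_measurable M"
  unfolding cr_def by measurable

lemma measurable_vector2 [measurable]:
  assumes [measurable]: "f \<in> borel_measurable M" "g \<in> borel_measurable M"
  shows "(\<lambda>x. vector [f x, g x] :: pt) \<in> borel_measurable M"
proof -
  have "(\<lambda>x. vector [f x, g x] :: pt) = (\<lambda>x. f x *\<^sub>R axis 1 1 + g x *\<^sub>R axis 2 1)"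
    by (auto simp: vector2_eq_iff vector_2 axis_def)
  then show ?thesis by simp
qed

lemma abs_cr_le: "\<bar>cr a b\<bar> \<le> norm a * norm b"
proof -
  have "cr a b = rot a \<bullet> b" by (simp add: cr_def inner2)
  moreover have "norm (rot a) = norm a" by (simp add: norm_eq_sqrt_inner inner2)
  ultimately show ?thesis using Cauchy_Schwarz_ineq2[of "rot a" b] by simp
qed

text \<open>Boxes of the plane are products of intervals. This lets the area of a sweep be iterated,
  with time as the inner variable.\<close>

lemma lborel_vec2: "(lborel :: pt measure) = distr (lborel \<Otimes>\<^sub>M lborel) borel (\<lambda>(x,y). vector [x,y])"
proof (rule lborel_eqI)
  fix l u :: pt assume le: "\<And>b. b \<in> Basis \<Longrightarrow> l \<bullet> b \<le> u \<bullet> b"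
  have le': "l$1 \<le> u$1" "l$2 \<le> u$2"
    using le[of "axis 1 1"] le[of "axis 2 1"] by (auto simp: axis_in_Basis_iff inner_axis)
  have "(\<lambda>(x,y). vector [x,y]::pt) -` box l u = {l$1<..<u$1} \<times> {l$2<..<u$2}"
    by (auto simp: mem_box_cart forall_2 vector_2)
  moreover have "(\<Prod>b\<in>Basis. (u - l) \<bullet> b) = (u$1 - l$1) * (u$2 - l$2)"
  proof -
    have "(Basis::pt set) = {axis 1 1, axis 2 1}" by (auto simp: Basis_vec_def UNIV_2)
    moreover have "axis 1 (1::real) \<noteq> (axis 2 1 :: pt)" by (simp add: axis_eq_axis)
    moreover have "(u - l) \<bullet> axis 1 1 = u$1 - l$1" "(u - l) \<bullet> axis 2 1 = u$2 - l$2"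
      by (simp_all add: inner_axis)
    ultimately show ?thesis by (metis (no_types, lifting) prod.insert prod.empty finite.intros empty_iff insert_iff mult.right_neutral)
  qed
  ultimately show "emeasure (distr (lborel \<Otimes>\<^sub>M lborel) borel (\<lambda>(x,y). vector [x,y]::pt)) (box l u) = (\<Prod>b\<in>Basis. (u - l) \<bullet> b)"
    using le' by (simp add: emeasure_distr split_beta lborel.emeasure_pair_measure_Times ennreal_mult)
qed simp

lemma nn_integral_vec2:
  assumes [measurable]: "f \<in> borel_measurable borel"
  shows "(\<integral>\<^sup>+z. f z \<partial>(lborel::pt measure)) = (\<integral>\<^sup>+x. \<integral>\<^sup>+y. f (vector [x,y]) \<partial>lborel \<partial>lborel)"
  by (subst lborel_vec2, subst nn_integral_distr, simp, simp, subst lborel.nn_integral_fst[symmetric])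
     (simp_all add: split_beta)

text \<open>A curve over a Borel set B moves with constant velocity v during a time interval
  depending on the parameter. Derivatives are taken within B because B will be an interval with
  already covered pieces cut out; the bounds L and M make the Jacobian integrable.\<close>

locale swept_region =
  fixes B :: "real set" and g g' :: "real \<Rightarrow> pt" and a b :: "real \<Rightarrow> real" and v :: pt and L M :: real
  assumes B[measurable]: "B \<in> sets borel" and bB: "\<And>s. s \<in> B \<Longrightarrow> \<bar>s\<bar> \<le> L"
    and der: "\<And>s. s \<in> B \<Longrightarrow> (g has_vector_derivative g' s) (at s within B)"
    and g'[measurable]: "g' \<in> borel_measurable borel" and bg': "\<And>s. s \<in> B \<Longrightarrow> norm (g' s) \<le> M"
    and a[measurable]: "a \<in> borel_measurable borel" and b[measurable]: "b \<in> borel_measurable borel"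
    and ba: "\<And>s. s \<in> B \<Longrightarrow> -L \<le> a s" and bb: "\<And>s. s \<in> B \<Longrightarrow> b s \<le> L"
begin

definition "swept_dom = {z::pt. z$1 \<in> B \<and> a (z$1) < z$2 \<and> z$2 < b (z$1)}"
definition "swept_map = (\<lambda>z::pt. g (z$1) + z$2 *\<^sub>R v)"

lemma swept_image: "swept_map ` swept_dom = {g s + t *\<^sub>R v | s t. s \<in> B \<and> a s < t \<and> t < b s}"
proof (intro set_eqI iffI)
  fix y assume "y \<in> {g s + t *\<^sub>R v | s t. s \<in> B \<and> a s < t \<and> t < b s}"
  then obtain s t where "s \<in> B" "a s < t" "t < b s" and y: "y = g s + t *\<^sub>R v" by blast
  then have "(vector [s,t] :: pt) \<in> swept_dom" by (simp add: swept_dom_def vector_2)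
  then show "y \<in> swept_map ` swept_dom"
    by (intro image_eqI[where x="vector [s,t]"]) (auto simp: y swept_map_def vector_2)
qed (auto simp: swept_dom_def swept_map_def)

lemma swept_dom_borel: "swept_dom \<in> sets borel"
  unfolding swept_dom_def by measurable

text \<open>The map (s,t) to g s + t v has Jacobian determinant \<open>cr (g' s) v\<close>, constant
  in t, so the inner integral only contributes the length of the time interval. The inequality holds
  without injectivity, and both versions are used later.\<close>

lemma swept_aux:
  shows swept_lmeas: "swept_map ` swept_dom \<in> lmeasurable"
  and swept_le: "emeasure lebesgue (swept_map ` swept_dom) \<le>
     (\<integral>\<^sup>+s. indicator B s * ennreal \<bar>cr (g' s) v\<bar> * ennreal (b s - a s) \<partial>lborel)"
  and swept_eq: "inj_on swept_map swept_dom \<Longrightarrow> emeasure lebesgue (swept_map ` swept_dom) =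
     (\<integral>\<^sup>+s. indicator B s * ennreal \<bar>cr (g' s) v\<bar> * ennreal (b s - a s) \<partial>lborel)"
proof -
  define f' where "f' = (\<lambda>z::pt. \<lambda>h::pt. h$1 *\<^sub>R g' (z$1) + h$2 *\<^sub>R v)"
  have derF: "(swept_map has_derivative f' z) (at z within swept_dom)" if "z \<in> swept_dom" for z
  proof -
    have 1: "((\<lambda>z::pt. z$1) has_derivative (\<lambda>h. h$1)) (at z within swept_dom)"
      by (intro bounded_linear.has_derivative[OF bounded_linear_vec_nth] has_derivative_ident)
    have "(g has_derivative (\<lambda>h. h *\<^sub>R g' (z$1))) (at (z$1) within (\<lambda>z. z$1) ` swept_dom)"
      using der[of "z$1"] that by (auto simp: swept_dom_def has_vector_derivative_def intro: has_derivative_subset)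
    from has_derivative_in_compose[OF 1 this]
    have 2: "((\<lambda>z. g (z$1)) has_derivative (\<lambda>h. h$1 *\<^sub>R g' (z$1))) (at z within swept_dom)" .
    have 3: "((\<lambda>z::pt. z$2 *\<^sub>R v) has_derivative (\<lambda>h. h$2 *\<^sub>R v)) (at z within swept_dom)"
      by (intro has_derivative_scaleR_left bounded_linear.has_derivative[OF bounded_linear_vec_nth] has_derivative_ident)
    show ?thesis unfolding swept_map_def f'_def by (rule has_derivative_add[OF 2 3])
  qed
  have det: "det (matrix (f' z)) = cr (g' (z$1)) v" for z
    unfolding matrix_def f'_def cr_def by (simp add: det_2 axis_def)
  have bdd: "swept_dom \<subseteq> cbox (vector [-L,-L]) (vector [L,L])"
    using bB ba bb by (force simp: swept_dom_def mem_box_cart forall_2 vector_2)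
  have S: "swept_dom \<in> sets lebesgue" using swept_dom_borel by auto
  have Slm: "swept_dom \<in> lmeasurable"
    using bdd S lmeasurable_cbox by (meson bounded_cbox bounded_set_imp_lmeasurable bounded_subset)
  have [measurable]: "swept_dom \<in> sets borel" by (rule swept_dom_borel)
  have meas: "(\<lambda>z::pt. \<bar>cr (g' (z$1)) v\<bar>) \<in> borel_measurable borel" by measurable
  have ai: "(\<lambda>z. \<bar>cr (g' (z$1)) v\<bar>) absolutely_integrable_on swept_dom"
  proof (rule measurable_bounded_by_integrable_imp_absolutely_integrable)
    show "(\<lambda>z. \<bar>cr (g' (z$1)) v\<bar>) \<in> borel_measurable (lebesgue_on swept_dom)"
      using meas by (simp add: measurable_restrict_space1 measurable_completion)
    show "(\<lambda>z. M * norm v) integrable_on swept_dom" using Slm by (intro integrable_on_const)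
    show "norm \<bar>cr (g' (z$1)) v\<bar> \<le> M * norm v" if "z \<in> swept_dom" for z
      using abs_cr_le[of "g' (z$1)" v] bg'[of "z$1"] that mult_right_mono[of "norm (g' (z$1))" M "norm v"]
      by (auto simp: swept_dom_def)
  qed (rule S)
  have int: "(\<lambda>z. \<bar>cr (g' (z$1)) v\<bar>) integrable_on swept_dom"
    using ai absolutely_integrable_on_def by blast
  have int': "(\<lambda>x. \<bar>det (matrix (f' x))\<bar>) integrable_on swept_dom" using int by (simp add: det)
  show lm: "swept_map ` swept_dom \<in> lmeasurable"
    by (rule measurable_differentiable_image[OF S derF int'])
  have "(\<integral>\<^sup>+z. indicator swept_dom z * ennreal \<bar>cr (g' (z$1)) v\<bar> \<partial>lborel) = ennreal (integral swept_dom (\<lambda>z. \<bar>cr (g' (z$1)) v\<bar>))"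
  proof -
    have hi: "((\<lambda>z. \<bar>cr (g' (z$1)) v\<bar>) has_integral integral swept_dom (\<lambda>z. \<bar>cr (g' (z$1)) v\<bar>)) swept_dom"
      using int by (rule integrable_integral)
    have "(\<integral>\<^sup>+z. ennreal (indicator swept_dom z * \<bar>cr (g' (z$1)) v\<bar>) \<partial>lborel) = ennreal (integral swept_dom (\<lambda>z. \<bar>cr (g' (z$1)) v\<bar>))"
      by (rule nn_integral_has_integral_lebesgue[OF _ hi]) auto
    moreover have "(\<lambda>z. ennreal (indicator swept_dom z * \<bar>cr (g' (z$1)) v\<bar>)) = (\<lambda>z. indicator swept_dom z * ennreal \<bar>cr (g' (z$1)) v\<bar>)"
      by (auto simp: indicator_def)
    ultimately show ?thesis by simp
  qed
  moreover have "(\<integral>\<^sup>+z. indicator swept_dom z * ennreal \<bar>cr (g' (z$1)) v\<bar> \<partial>lborel) =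
     (\<integral>\<^sup>+s. indicator B s * ennreal \<bar>cr (g' s) v\<bar> * ennreal (b s - a s) \<partial>lborel)"
  proof -
    have "(\<integral>\<^sup>+z. indicator swept_dom z * ennreal \<bar>cr (g' (z$1)) v\<bar> \<partial>lborel) =
      (\<integral>\<^sup>+s. \<integral>\<^sup>+t. indicator swept_dom (vector [s,t]) * ennreal \<bar>cr (g' s) v\<bar> \<partial>lborel \<partial>lborel)"
      by (subst nn_integral_vec2) (auto simp: vector_2)
    also have "\<dots> = (\<integral>\<^sup>+s. indicator B s * ennreal \<bar>cr (g' s) v\<bar> * ennreal (b s - a s) \<partial>lborel)"
    proof (rule nn_integral_cong)
      fix s
      have "(\<integral>\<^sup>+t. indicator swept_dom (vector [s,t]) * ennreal \<bar>cr (g' s) v\<bar> \<partial>lborel) =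
        (\<integral>\<^sup>+t. (indicator B s * ennreal \<bar>cr (g' s) v\<bar>) * indicator {a s<..<b s} t \<partial>lborel)"
        by (rule nn_integral_cong) (auto simp: swept_dom_def vector_2 indicator_def)
      also have "\<dots> = indicator B s * ennreal \<bar>cr (g' s) v\<bar> * emeasure lborel {a s<..<b s}"
        by (subst nn_integral_cmult) auto
      \<comment> \<open>If b s < a s the interval is empty, and \<open>ennreal\<close> truncates the
        negative length to 0.\<close>
      also have "emeasure lborel {a s<..<b s} = ennreal (b s - a s)"
        by (cases "a s \<le> b s") (auto simp: ennreal_neg)
      finally show "(\<integral>\<^sup>+t. indicator swept_dom (vector [s,t]) * ennreal \<bar>cr (g' s) v\<bar> \<partial>lborel) = indicator B s * ennreal \<bar>cr (g' s) v\<bar> * ennreal (b s - a s)" .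
    qed
    finally show ?thesis .
  qed
  ultimately have *: "(\<integral>\<^sup>+s. indicator B s * ennreal \<bar>cr (g' s) v\<bar> * ennreal (b s - a s) \<partial>lborel) = ennreal (integral swept_dom (\<lambda>z. \<bar>det (matrix (f' z))\<bar>))"
    by (simp add: det)
  show "emeasure lebesgue (swept_map ` swept_dom) \<le>
     (\<integral>\<^sup>+s. indicator B s * ennreal \<bar>cr (g' s) v\<bar> * ennreal (b s - a s) \<partial>lborel)"
    unfolding * using measure_differentiable_image[OF S derF int'] lm
    by (simp add: emeasure_eq_measure2 ennreal_leI)
  show "emeasure lebesgue (swept_map ` swept_dom) =
     (\<integral>\<^sup>+s. indicator B s * ennreal \<bar>cr (g' s) v\<bar> * ennreal (b s - a s) \<partial>lborel)" if "inj_on swept_map swept_dom"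
    unfolding * using measure_differentiable_image_eq[OF S derF that int'] lm
    by (simp add: emeasure_eq_measure2)
qed

end

section \<open>The uniform measure on directions\<close>

lemma unit_vec_nth [simp]: "unit_vec a $ 1 = cos a" "unit_vec a $ 2 = sin a"
  by (simp_all add: unit_vec_def vector_2)

lemma norm_unit_vec [simp]: "norm (unit_vec a) = 1"
  by (simp add: norm_eq_sqrt_inner inner2 flip: power2_eq_square)

lemma measurable_unit_vec [measurable]: "unit_vec \<in> borel_measurable borel"
  unfolding unit_vec_def by measurable

lemma unit_vec_periodic [simp]: "unit_vec (x + 2*pi) = unit_vec x"
  by (simp add: vector2_eq_iff)

text \<open>Reflections and rotations shift the angular window; this moves it back to [0, 2
  pi).\<close>

lemma nn_integral_periodic:
  fixes f :: "real \<Rightarrow> ennreal"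
  assumes [measurable]: "f \<in> borel_measurable borel" and per: "\<And>x. f (x + 2*pi) = f x"
  shows "(\<integral>\<^sup>+x. indicator {a..<a+2*pi} x * f x \<partial>lborel) = (\<integral>\<^sup>+x. indicator {0..<2*pi} x * f x \<partial>lborel)"
proof -
  have shift: "(\<integral>\<^sup>+x. indicator {u+c..<w+c} x * f x \<partial>lborel) = (\<integral>\<^sup>+x. indicator {u..<w} x * f x \<partial>lborel)"
    if c: "\<And>x. f (x + c) = f x" for u w c :: real
  proof -
    have "(\<integral>\<^sup>+x. indicator {u+c..<w+c} x * f x \<partial>lborel) = (\<integral>\<^sup>+x. indicator {u+c..<w+c} (c+1*x) * f (c+1*x) \<partial>lborel)"
      by (subst nn_integral_real_affine[where c=1 and t=c]) auto
    also have "\<dots> = (\<integral>\<^sup>+x. indicator {u..<w} x * f x \<partial>lborel)"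
      using c by (intro nn_integral_cong) (auto simp: indicator_def add.commute)
    finally show ?thesis .
  qed
  have pern: "f (x + 2*pi * real n) = f x" for x n
    by (induction n) (simp_all add: algebra_simps per[of "x + 2*pi * real _", simplified algebra_simps])
  have peri: "f (x + 2*pi * of_int k) = f x" for x k
    using pern[of x "nat k"] pern[of "x + 2*pi * of_int k" "nat (-k)"] by (cases "k \<ge> 0") auto
  \<comment> \<open>The shift by a multiple of 2 pi leaves a window starting at r in [0, 2 pi),
    which is cut at 2 pi and its upper part moved down by one period.\<close>
  define k where "k = \<lfloor>a / (2*pi)\<rfloor>"
  define r where "r = a - 2*pi * of_int k"
  have "of_int k \<le> a/(2*pi)" "a/(2*pi) < of_int k + 1" unfolding k_def by linarith+
  then have r: "0 \<le> r" "r < 2*pi" by (simp_all add: r_def field_simps)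
  have "(\<integral>\<^sup>+x. indicator {a..<a+2*pi} x * f x \<partial>lborel) = (\<integral>\<^sup>+x. indicator {r..<r+2*pi} x * f x \<partial>lborel)"
    using shift[of "2*pi * of_int k" r "r+2*pi"] peri by (simp add: r_def)
  also have "\<dots> = (\<integral>\<^sup>+x. indicator {r..<2*pi} x * f x + indicator {0+2*pi..<r+2*pi} x * f x \<partial>lborel)"
    using r by (intro nn_integral_cong) (auto simp: indicator_def)
  also have "\<dots> = (\<integral>\<^sup>+x. indicator {r..<2*pi} x * f x \<partial>lborel) + (\<integral>\<^sup>+x. indicator {0..<r} x * f x \<partial>lborel)"
    by (subst nn_integral_add) (auto simp only: shift[OF per], auto)
  also have "\<dots> = (\<integral>\<^sup>+x. indicator {r..<2*pi} x * f x + indicator {0..<r} x * f x \<partial>lborel)"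
    by (subst nn_integral_add) auto
  also have "\<dots> = (\<integral>\<^sup>+x. indicator {0..<2*pi} x * f x \<partial>lborel)"
    using r by (intro nn_integral_cong) (auto simp: indicator_def)
  finally show ?thesis .
qed

text \<open>Arc length on the unit circle, as a measure on all of \<open>pt\<close> so that
  reflections act on directions as plain vectors; norm 1 then holds almost everywhere.\<close>

definition circ :: "pt measure" where
  "circ = distr (density lborel (indicator {0..<2*pi})) borel unit_vec"

lemma sets_circ [simp, measurable_cong]: "sets circ = sets borel"
  by (simp add: circ_def)

lemma space_circ [simp]: "space circ = UNIV"
  by (simp add: circ_def)

lemma nn_integral_circ:
  assumes [measurable]: "h \<in> borel_measurable borel"
  shows "(\<integral>\<^sup>+v. h v \<partial>circ) = (\<integral>\<^sup>+\<phi>. indicator {0..<2*pi} \<phi> * h (unit_vec \<phi>) \<partial>lborel)"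
  unfolding circ_def by (simp add: nn_integral_distr nn_integral_density)

lemma emeasure_circ: "emeasure circ UNIV = ennreal (2*pi)"
proof -
  have "emeasure circ UNIV = (\<integral>\<^sup>+v. 1 \<partial>circ)" by simp
  also have "\<dots> = ennreal (2*pi)" by (subst nn_integral_circ) auto
  finally show ?thesis .
qed

interpretation circ: finite_measure circ
  by standard (simp add: emeasure_circ)

lemma AE_circ: "AE v in circ. norm v = 1"
  unfolding circ_def by (subst AE_distr_iff) auto

lemma nn_integral_circ_cong:
  assumes "\<And>v. norm v = 1 \<Longrightarrow> f v = g v"
  shows "(\<integral>\<^sup>+v. f v \<partial>circ) = (\<integral>\<^sup>+v. g v \<partial>circ)"
  by (rule nn_integral_cong_AE) (use AE_circ assms in auto)

lemma nn_integral_circ_mono: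
  assumes "\<And>v. norm v = 1 \<Longrightarrow> f v \<le> g v"
  shows "(\<integral>\<^sup>+v. f v \<partial>circ) \<le> (\<integral>\<^sup>+v. g v \<partial>circ)"
  by (rule nn_integral_mono_AE) (use AE_circ assms in auto)

lemma polar_form:
  fixes \<tau> :: pt assumes "\<tau> \<noteq> 0"
  obtains \<alpha> where "\<tau> = norm \<tau> *\<^sub>R unit_vec \<alpha>"
proof -
  have "(\<tau>$1)\<^sup>2 + (\<tau>$2)\<^sup>2 = (norm \<tau>)\<^sup>2" using power2_norm_eq_inner[of \<tau>] by (simp only: inner2 power2_eq_square)
  moreover have "(norm \<tau>)\<^sup>2 \<noteq> 0" using assms by simp
  ultimately have "(\<tau>$1 / norm \<tau>)\<^sup>2 + (\<tau>$2 / norm \<tau>)\<^sup>2 = 1"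
    unfolding power_divide add_divide_distrib[symmetric] by (metis divide_self)
  then obtain t where t: "\<tau>$1 / norm \<tau> = cos t" "\<tau>$2 / norm \<tau> = sin t" by (rule sincos_total_2pi)
  have "\<tau> = norm \<tau> *\<^sub>R unit_vec t"
    unfolding vector2_eq_iff vector_scaleR_component unit_vec_nth t[symmetric] using assms by simp
  then show ?thesis by (rule that)
qed

section \<open>Reflection in a tangent line\<close>

lemma reflect_unit_vec:
  assumes "r > 0"
  shows "reflect_tangent (r *\<^sub>R unit_vec \<alpha>) (unit_vec \<phi>) = unit_vec (2*\<alpha> - \<phi>)"
proof -
  \<comment> \<open>Measuring the angle from the tangent makes both identities consequences of the
    addition formulas.\<close>
  define \<beta> where "\<beta> = \<phi> - \<alpha>"
  have e: "2*\<alpha> - \<phi> = \<alpha> - \<beta>" "\<phi> = \<alpha> + \<beta>" by (simp_all add: \<beta>_def)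
  have 1: "cos (2*\<alpha>-\<phi>) = 2 * cos (\<phi>-\<alpha>) * cos \<alpha> - cos \<phi>"
    and 2: "sin (2*\<alpha>-\<phi>) = 2 * cos (\<phi>-\<alpha>) * sin \<alpha> - sin \<phi>"
    unfolding e(1) unfolding e(2) by (simp_all add: cos_add cos_diff sin_add sin_diff)
  have a: "unit_vec \<phi> \<bullet> unit_vec \<alpha> = cos (\<phi>-\<alpha>)" by (simp add: inner2 cos_diff)
  have b: "unit_vec \<alpha> \<bullet> unit_vec \<alpha> = 1" by (simp add: inner2 flip: power2_eq_square)
  show ?thesis unfolding reflect_tangent_def using assms
    by (simp add: a b vector2_eq_iff 1 2)
qed

lemma norm_reflect [simp]: "norm (reflect_tangent \<tau> u) = norm u"
proof (cases "\<tau> = 0")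
  case False
  then have "reflect_tangent \<tau> u \<bullet> reflect_tangent \<tau> u = u \<bullet> u"
    unfolding reflect_tangent_def by (simp add: inner_diff field_simps inner_commute)
  then show ?thesis by (simp add: norm_eq_sqrt_inner)
qed (simp add: reflect_tangent_def)

text \<open>The component of the velocity normal to the tangent changes sign, so the density of the
  boundary measure is invariant under reflection.\<close>

lemma cr_reflect: "cr \<tau> (reflect_tangent \<tau> u) = - cr \<tau> u"
  unfolding reflect_tangent_def cr_def by (simp add: algebra_simps)

lemma measurable_reflect [measurable]:
  assumes [measurable]: "f \<in> borel_measurable M" "g \<in> borel_measurable M"
  shows "(\<lambda>x. reflect_tangent (f x) (g x)) \<in> borel_measurable M"
  unfolding reflect_tangent_def by measurable

text \<open>In angles the reflection is \<phi> to 2\<alpha> - \<phi>, an isometry of the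
  circle.\<close>

lemma nn_integral_circ_reflect:
  assumes [measurable]: "h \<in> borel_measurable borel" and "\<tau> \<noteq> 0"
  shows "(\<integral>\<^sup>+v. h (reflect_tangent \<tau> v) \<partial>circ) = (\<integral>\<^sup>+v. h v \<partial>circ)"
proof -
  obtain \<alpha> where \<alpha>: "\<tau> = norm \<tau> *\<^sub>R unit_vec \<alpha>" using assms polar_form by blast
  have "(\<integral>\<^sup>+v. h (reflect_tangent \<tau> v) \<partial>circ) = (\<integral>\<^sup>+\<phi>. indicator {0..<2*pi} \<phi> * h (unit_vec (2*\<alpha>-\<phi>)) \<partial>lborel)"
    using reflect_unit_vec[of "norm \<tau>" \<alpha>, folded \<alpha>] assms(2) by (subst nn_integral_circ) auto
  also have "\<dots> = (\<integral>\<^sup>+\<phi>. indicator {0..<2*pi} (2*\<alpha> + (-1)*\<phi>) * h (unit_vec (2*\<alpha>-(2*\<alpha> + (-1)*\<phi>))) \<partial>lborel)"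
    by (subst nn_integral_real_affine[where c="-1" and t="2*\<alpha>"]) auto
  also have "\<dots> = (\<integral>\<^sup>+\<phi>. indicator {2*\<alpha>-2*pi..<2*\<alpha>-2*pi+2*pi} \<phi> * h (unit_vec \<phi>) \<partial>lborel)"
  proof (rule nn_integral_cong_AE)
    \<comment> \<open>Reversal turns the half-open window [0, 2 pi) into one closed on the other
      side, so the two windows differ exactly in these two endpoints.\<close>
    have "AE \<phi> in lborel. \<phi> \<noteq> 2*\<alpha>" "AE \<phi> in lborel. \<phi> \<noteq> 2*\<alpha>-2*pi" by (rule AE_lborel_singleton)+
    then show "AE \<phi> in lborel. indicator {0..<2*pi} (2*\<alpha> + (-1)*\<phi>) * h (unit_vec (2*\<alpha>-(2*\<alpha> + (-1)*\<phi>))) =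
       indicator {2*\<alpha>-2*pi..<2*\<alpha>-2*pi+2*pi} \<phi> * h (unit_vec \<phi>)"
      by eventually_elim (auto simp: indicator_def)
  qed
  also have "\<dots> = (\<integral>\<^sup>+\<phi>. indicator {0..<2*pi} \<phi> * h (unit_vec \<phi>) \<partial>lborel)"
    by (rule nn_integral_periodic) auto
  also have "\<dots> = (\<integral>\<^sup>+v. h v \<partial>circ)" by (simp add: nn_integral_circ)
  finally show ?thesis .
qed

section \<open>Billiards outside a compact set\<close>

lemma rot_inner: "rot v \<bullet> v = 0" "v \<bullet> rot v = 0"
  by (simp_all add: inner2)

lemma norm_rot: "rot v \<bullet> rot v = v \<bullet> v"
  by (simp add: inner2)

lemma orthogonal_decomposition:
  assumes "norm v = 1" shows "y = (y \<bullet> rot v) *\<^sub>R rot v + (y \<bullet> v) *\<^sub>R v"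
proof -
  have "v$1 * v$1 + v$2 * v$2 = 1" using assms by (simp add: norm_eq_1 inner2)
  then have "y$1 = y$1 * (v$1 * v$1 + v$2 * v$2)" "y$2 = y$2 * (v$1 * v$1 + v$2 * v$2)" by simp_all
  then show ?thesis unfolding vector2_eq_iff by (simp add: inner2 algebra_simps)
qed

text \<open>G parametrises the boundary injectively over A, tn x is a tangent vector at the boundary point x, and
  N0 contains the countably many boundary points at which the local structure is not controlled. Directions
  are unit vectors, a state is a pair of a position and a velocity.\<close>

locale billiard =
  fixes C :: "pt set" and A :: "real set" and G :: "real \<Rightarrow> pt" and tn :: "pt \<Rightarrow> pt"
    and N0 :: "pt set" and c :: pt and R M :: real
  assumes C_compact: "compact C" and C_cball: "C \<subseteq> cball c R" and R_pos: "R > 0"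
    and A_borel [measurable]: "A \<in> sets borel" and A_bound: "\<And>s. s \<in> A \<Longrightarrow> \<bar>s\<bar> \<le> M"
    and G_meas [measurable]: "G \<in> borel_measurable borel"
    and G_der: "\<And>s. s \<in> A \<Longrightarrow> (G has_vector_derivative tn (G s)) (at s within A)"
    and tn_meas [measurable]: "tn \<in> borel_measurable borel"
    and tn_bound: "\<And>s. s \<in> A \<Longrightarrow> norm (tn (G s)) \<le> M"
    and tn_nonzero: "\<And>s. s \<in> A \<Longrightarrow> tn (G s) \<noteq> 0"
    and G_inj: "inj_on G A" and G_C: "G ` A \<subseteq> C" and frontier_C: "frontier C \<subseteq> G ` A"
    and N0_countable: "countable N0"
    and reg: "\<And>x u w. \<lbrakk>x \<in> G ` A; x \<notin> N0; \<exists>\<epsilon>>0. \<forall>t\<in>{0<..<\<epsilon>}. x + t *\<^sub>R u \<notin> C; cr (tn x) w * cr (tn x) u > 0\<rbrakk>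
       \<Longrightarrow> \<exists>\<epsilon>>0. \<forall>t\<in>{0<..<\<epsilon>}. x + t *\<^sub>R w \<notin> C"
begin

definition hits :: "pt \<times> pt \<Rightarrow> bool" where
  "hits z \<longleftrightarrow> (\<exists>t>0. fst z + t *\<^sub>R snd z \<in> C)"

text \<open>For a ray that never hits C this is the unspecified value Inf {}; for a ray that starts inside C,
  or tangentially along it, it may be 0. Both cases are excluded by the set hitting.\<close>

definition hit_time :: "pt \<times> pt \<Rightarrow> real" where
  "hit_time z = Inf {t. t > 0 \<and> fst z + t *\<^sub>R snd z \<in> C}"

definition hitting where "hitting = {z. hits z \<and> hit_time z > 0}"

definition hit_point :: "pt \<times> pt \<Rightarrow> pt" where "hit_point z = fst z + hit_time z *\<^sub>R snd z"

definition step :: "pt \<times> pt \<Rightarrow> pt \<times> pt" where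
  "step z = (hit_point z, reflect_tangent (tn (hit_point z)) (snd z))"

text \<open>The margin 1 keeps the starting points, and the first unit of their rays, away from C;
  it cancels in the final bound.\<close>

definition \<rho> where "\<rho> = R + 1"

text \<open>Length of the free flight inside the reference square: a ray that never hits C is cut
  off where its coordinate along its own direction reaches \<rho>.\<close>

definition len :: "pt \<times> pt \<Rightarrow> real" where
  "len z = (if hits z then hit_time z else max 0 (\<rho> - (fst z - c) \<bullet> snd z))"

text \<open>For each direction the reference square is rotated so that two of its sides are parallel
  to v; \<open>start p v\<close> runs along the side through which lines of direction v
  enter.\<close>

definition start :: "real \<Rightarrow> pt \<Rightarrow> pt" where
  "start p v = c + p *\<^sub>R rot v - \<rho> *\<^sub>R v"

text \<open>The density |n . v| with respect to arc length: the cross product with the tangent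
  vector contains both the normal component of v and the speed of the parametrisation.\<close>

abbreviation weight :: "pt \<Rightarrow> real \<Rightarrow> ennreal" where
  "weight v s \<equiv> indicator A s * ennreal \<bar>cr (tn (G s)) v\<bar>"

abbreviation strip :: "pt \<Rightarrow> pt set" where
  "strip v \<equiv> {start p v + t *\<^sub>R v | p t. p \<in> {-\<rho><..<\<rho>} \<and> 0 < t \<and> t < 2*\<rho>}"

lemma C_closed: "closed C" using C_compact by (rule compact_imp_closed)

lemma hit_time_nonneg: "hits z \<Longrightarrow> hit_time z \<ge> 0"
  unfolding hits_def hit_time_def by (intro cInf_greatest) auto

lemma hit_time_le: "t > 0 \<Longrightarrow> fst z + t *\<^sub>R snd z \<in> C \<Longrightarrow> hit_time z \<le> t"
  unfolding hit_time_def by (intro cInf_lower) (auto intro!: bdd_belowI[of _ 0])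

lemma hit_time_less: "0 < t \<Longrightarrow> t < hit_time z \<Longrightarrow> fst z + t *\<^sub>R snd z \<notin> C"
  using hit_time_le by force

lemma hit_time_less_iff: "hits z \<Longrightarrow> hit_time z < a \<longleftrightarrow> (\<exists>t>0. t < a \<and> fst z + t *\<^sub>R snd z \<in> C)"
  unfolding hit_time_def hits_def by (subst cInf_less_iff) (auto intro!: bdd_belowI[of _ 0])

lemma hit_time_ge: "hits z \<Longrightarrow> (\<And>t. t > 0 \<Longrightarrow> t < e \<Longrightarrow> fst z + t *\<^sub>R snd z \<notin> C) \<Longrightarrow> e \<le> hit_time z"
  using hit_time_less_iff[of z e] by force

lemma hit_point_in: assumes "z \<in> hitting" shows "hit_point z \<in> C"
proof -
  let ?S = "{t. t > 0 \<and> fst z + t *\<^sub>R snd z \<in> C}"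
  \<comment> \<open>A positive infimum allows the open condition t > 0 to be replaced by the closed
    condition t >= \<open>hit_time z\<close>; hence the infimum is attained.\<close>
  have "?S = {hit_time z..} \<inter> (\<lambda>t. fst z + t *\<^sub>R snd z) -` C"
    using assms hit_time_le unfolding hitting_def by fastforce
  moreover have "closed ({hit_time z..} \<inter> (\<lambda>t. fst z + t *\<^sub>R snd z) -` C)"
    by (intro closed_Int closed_atLeast continuous_closed_vimage C_closed continuous_intros)
  ultimately have "closed ?S" by simp
  moreover have "?S \<noteq> {}" using assms by (auto simp: hitting_def hits_def)
  moreover have "bdd_below ?S" by (auto intro!: bdd_belowI[of _ 0])
  ultimately have "Inf ?S \<in> ?S" by (intro closed_contains_Inf)
  then have "hit_time z \<in> ?S" by (simp only: hit_time_def)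
  then show ?thesis by (simp add: hit_point_def)
qed

lemma hit_point_boundary: assumes "z \<in> hitting" shows "hit_point z \<in> G ` A"
proof -
  have "hit_point z \<notin> interior C"
  proof
    assume "hit_point z \<in> interior C"
    then have "hit_time z \<in> (\<lambda>t. fst z + t *\<^sub>R snd z) -` interior C" by (simp add: hit_point_def)
    moreover have "open ((\<lambda>t. fst z + t *\<^sub>R snd z) -` interior C)"
      by (intro continuous_open_vimage continuous_intros open_interior)
    ultimately obtain e where e: "e > 0" "ball (hit_time z) e \<subseteq> (\<lambda>t. fst z + t *\<^sub>R snd z) -` interior C"
      by (meson openE)
    \<comment> \<open>A time shortly before the hit, still positive, at which the ray would already
      be in the interior of C.\<close>
    define t where "t = max (hit_time z / 2) (hit_time z - e/2)"
    have "hit_time z > 0" using assms by (simp add: hitting_def)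
    then have "t \<in> ball (hit_time z) e" "0 < t" "t < hit_time z" using e(1) by (auto simp: t_def dist_real_def)
    then show False using e(2) hit_time_less interior_subset by blast
  qed
  moreover have "hit_point z \<in> closure C" using hit_point_in[OF assms] closure_subset by blast
  ultimately show ?thesis using frontier_C by (auto simp: frontier_def)
qed

section \<open>Measurability of the flight data\<close>

text \<open>Projecting a closed set along a compact time interval gives a closed set. The other
  hitting events are countable unions of sets of this kind.\<close>

lemma closed_hits_between: "closed {z::pt\<times>pt. \<exists>t\<in>{a..b}. fst z + t *\<^sub>R snd z \<in> C}"
proof -
  have "closed {z::pt\<times>pt. \<exists>t. t \<in> {a..b} \<and> (t, z) \<in> (\<lambda>(t,z). fst z + t *\<^sub>R snd z) -` C}"
  proof (rule closed_compact_projection)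
    show "closed ((\<lambda>(t,z::pt\<times>pt). fst z + t *\<^sub>R snd z) -` C)"
    proof (rule closed_vimage[OF C_closed])
      have "continuous_on UNIV (\<lambda>p::real\<times>pt\<times>pt. fst (snd p) + fst p *\<^sub>R snd (snd p))"
        by (intro continuous_intros)
      then show "continuous_on UNIV (\<lambda>(t,z::pt\<times>pt). fst z + t *\<^sub>R snd z)"
        by (simp add: case_prod_unfold)
    qed
  qed simp
  then show ?thesis by (simp add: Bex_def)
qed

lemma hits_between_meas [measurable]: "{z::pt\<times>pt. \<exists>t\<in>{a..b}. fst z + t *\<^sub>R snd z \<in> C} \<in> sets borel"
  using closed_hits_between by (rule borel_closed)

lemma hits_below_meas: "{z::pt\<times>pt. \<exists>t>0. t < a \<and> fst z + t *\<^sub>R snd z \<in> C} \<in> sets borel"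
proof -
  have "{z::pt\<times>pt. \<exists>t>0. t < a \<and> fst z + t *\<^sub>R snd z \<in> C} =
     (\<Union>n::nat. {z::pt\<times>pt. \<exists>t\<in>{1/Suc n..a - 1/Suc n}. fst z + t *\<^sub>R snd z \<in> C})" (is "?L = ?R")
  proof (intro equalityI subsetI)
    fix z assume "z \<in> ?L"
    then obtain t where t: "t > 0" "t < a" "fst z + t *\<^sub>R snd z \<in> C" by blast
    then obtain n where "1 / Suc n < min t (a - t)" using nat_approx_posE[of "min t (a-t)"] by auto
    with t show "z \<in> ?R" by (force intro!: exI[of _ n] bexI[of _ t])
  next
    fix z assume "z \<in> ?R"
    then obtain n t where t: "t \<ge> 1 / Suc n" "t \<le> a - 1/Suc n" "fst z + t *\<^sub>R snd z \<in> C" by auto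
    have "1 / real (Suc n) > 0" by simp
    then show "z \<in> ?L" using t by (intro CollectI exI[of _ t]) linarith
  qed
  then show ?thesis by simp
qed

lemma hits_meas [measurable]: "{z. hits z} \<in> sets borel"
proof -
  have "{z. hits z} = (\<Union>n::nat. {z::pt\<times>pt. \<exists>t>0. t < n \<and> fst z + t *\<^sub>R snd z \<in> C})"
    unfolding hits_def using reals_Archimedean2 by blast
  then show ?thesis using hits_below_meas by simp
qed

lemma hits_pred [measurable]: "Measurable.pred borel hits"
  using hits_meas by (simp add: pred_def)

lemma hit_time_meas [measurable]: "hit_time \<in> borel_measurable borel"
proof (unfold borel_measurable_iff_less, safe)
  fix a
  \<comment> \<open>Off \<open>hits\<close> the infimum is that of the empty set, a fixed real
    number; whatever its value, this part of the sublevel set is empty or the whole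
    complement.\<close>
  have "{w. hit_time w < a} = ({z. hits z} \<inter> {z::pt\<times>pt. \<exists>t>0. t < a \<and> fst z + t *\<^sub>R snd z \<in> C}) \<union> (- {z. hits z} \<inter> {z. Inf ({}::real set) < a})"
  proof -
    have "{t. t > 0 \<and> fst z + t *\<^sub>R snd z \<in> C} = {}" if "\<not> hits z" for z
      using that unfolding hits_def by blast
    then have *: "hit_time z = Inf {}" if "\<not> hits z" for z
      using that unfolding hit_time_def by presburger
    show ?thesis
    proof (rule set_eqI)
      fix z show "z \<in> {w. hit_time w < a} \<longleftrightarrow> z \<in> ({z. hits z} \<inter> {z::pt\<times>pt. \<exists>t>0. t < a \<and> fst z + t *\<^sub>R snd z \<in> C}) \<union> (- {z. hits z} \<inter> {z. Inf ({}::real set) < a})"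
        unfolding Un_iff Int_iff Compl_iff mem_Collect_eq using *[of z] hit_time_less_iff[of z a] by (cases "hits z") simp_all
    qed
  qed
  moreover have "{z. hits z} \<in> sets borel" "{z::pt\<times>pt. \<exists>t>0. t < a \<and> fst z + t *\<^sub>R snd z \<in> C} \<in> sets borel"
    by (auto intro: hits_below_meas)
  ultimately show "{w \<in> space borel. hit_time w < a} \<in> sets borel" by auto
qed

lemma hitting_meas [measurable]: "hitting \<in> sets borel"
  unfolding hitting_def by measurable

lemma borel_measurable_fst_snd [measurable]:
  "(fst :: pt\<times>pt \<Rightarrow> pt) \<in> borel_measurable borel" "(snd :: pt\<times>pt \<Rightarrow> pt) \<in> borel_measurable borel"
  by (auto intro!: borel_measurable_continuous_onI continuous_intros)

lemma hit_point_meas [measurable]: "hit_point \<in> borel_measurable borel"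
  unfolding hit_point_def by measurable

lemma step_meas [measurable]: "step \<in> borel_measurable borel"
  unfolding step_def by measurable

lemma len_meas [measurable]: "len \<in> borel_measurable borel"
  unfolding len_def by measurable

lemma start_meas [measurable]:
  assumes [measurable]: "f \<in> borel_measurable N" "g \<in> borel_measurable N"
  shows "(\<lambda>x. start (f x) (g x)) \<in> borel_measurable N"
  unfolding start_def by measurable

lemma len_nonneg: "len z \<ge> 0"
  using hit_time_nonneg by (auto simp: len_def)

lemma len_less_notin: "0 < t \<Longrightarrow> t < len z \<Longrightarrow> fst z + t *\<^sub>R snd z \<notin> C"
  using hit_time_less by (auto simp: len_def hits_def split: if_splits)

lemma in_C: "x \<in> C \<Longrightarrow> norm (x - c) \<le> R"
  using C_cball by (auto simp: dist_norm norm_minus_commute)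

lemma in_C_inner: "x \<in> C \<Longrightarrow> norm v = 1 \<Longrightarrow> \<bar>(x - c) \<bullet> v\<bar> \<le> R"
  using in_C[of x] Cauchy_Schwarz_ineq2[of "x-c" v] by simp

lemma start_inner: "norm v = 1 \<Longrightarrow> (start p v - c) \<bullet> v = - \<rho>"
  by (simp add: start_def rot_inner norm_eq_1 inner_diff_left)

lemma start_rot: "norm v = 1 \<Longrightarrow> (start p v - c) \<bullet> rot v = p"
  by (simp add: start_def rot_inner norm_rot inner_diff_left norm_eq_1)

lemma inner_ray: "norm v = 1 \<Longrightarrow> (x + t *\<^sub>R v - c) \<bullet> v = (x - c) \<bullet> v + t"
  by (simp add: inner_diff_left inner_add_left norm_eq_1)

lemma len_less_inner:
  assumes "norm v = 1" "0 \<le> t" "t < len (x,v)"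
  shows "(x + t *\<^sub>R v - c) \<bullet> v < \<rho>"
proof (cases "hits (x,v)")
  case True
  then obtain t' where t': "t' > 0" "x + t' *\<^sub>R v \<in> C" by (auto simp: hits_def)
  have "t < t'" using assms True hit_time_le[of t' "(x,v)"] t' by (simp add: len_def)
  have "\<bar>(x + t' *\<^sub>R v - c) \<bullet> v\<bar> \<le> R" using in_C_inner assms t' by blast
  then show ?thesis unfolding inner_ray[OF assms(1)] using \<open>t < t'\<close> by (simp add: \<rho>_def)
next
  case False
  then show ?thesis unfolding inner_ray[OF assms(1)] using assms by (simp add: len_def)
qed

lemma len_le: assumes "norm v = 1" "- \<rho> \<le> (x - c) \<bullet> v" shows "len (x,v) \<le> 2*\<rho>"
proof (rule ccontr)
  assume "\<not> len (x,v) \<le> 2*\<rho>"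
  then have "(x + (2*\<rho>) *\<^sub>R v - c) \<bullet> v < \<rho>" using assms R_pos by (intro len_less_inner) (auto simp: \<rho>_def)
  then show False unfolding inner_ray[OF assms(1)] using assms by simp
qed


section \<open>The transfer inequality\<close>


text \<open>Two flights of equal direction through one point lie on a common line. If one started
  closer to that point, its starting point, which belongs to C, would lie in the interior of the
  other flight.\<close>

lemma rays_disjoint_boundary:
  assumes "s1 \<in> A" "s2 \<in> A" "0 \<le> t1" "0 \<le> t2" "t1 < len (G s1, v)" "t2 < len (G s2, v)"
    "G s1 + t1 *\<^sub>R v = G s2 + t2 *\<^sub>R v"
  shows "s1 = s2 \<and> t1 = t2"
proof -
  have aux: "\<not> t < t'" if "s \<in> A" "s' \<in> A" "0 \<le> t" "t' < len (G s', v)" "G s + t *\<^sub>R v = G s' + t' *\<^sub>R v" for s s' t t'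
  proof
    assume "t < t'"
    then have "fst (G s', v) + (t' - t) *\<^sub>R snd (G s', v) \<notin> C" using that by (intro len_less_notin) auto
    moreover have "G s' + (t' - t) *\<^sub>R v = G s" using that(5) by (simp add: algebra_simps)
    ultimately show False using G_C that(1) by auto
  qed
  have "t1 = t2" using aux[of s1 s2 t1 t2] aux[of s2 s1 t2 t1] assms by force
  then have "G s1 = G s2" using assms by simp
  then show ?thesis using \<open>t1 = t2\<close> G_inj assms by (auto dest: inj_onD)
qed

lemma rays_disjoint_start:
  assumes "norm v = 1" "start p1 v + t1 *\<^sub>R v = start p2 v + t2 *\<^sub>R v"
  shows "p1 = p2 \<and> t1 = t2"
proof -
  have "t1 = t2" using inner_ray[OF assms(1), of "start p1 v" t1] inner_ray[OF assms(1), of "start p2 v" t2] assms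
    by (simp add: start_inner)
  then have "start p1 v = start p2 v" using assms by simp
  then show ?thesis using start_rot[OF assms(1), of p1] start_rot[OF assms(1), of p2] \<open>t1 = t2\<close> by metis
qed

text \<open>An incoming line starts in front of all of C, so it would have to pass through G s
  before reaching the common point, and its free flight would have ended there.\<close>

lemma rays_disjoint_boundary_start:
  assumes "norm v = 1" "s \<in> A" "0 \<le> t1" "t2 < len (start p v, v)"
  shows "G s + t1 *\<^sub>R v \<noteq> start p v + t2 *\<^sub>R v"
proof
  assume eq: "G s + t1 *\<^sub>R v = start p v + t2 *\<^sub>R v"
  have GC: "G s \<in> C" using assms G_C by auto
  then have "- R \<le> (G s - c) \<bullet> v" using in_C_inner[OF GC assms(1)] by simp
  moreover have "(G s - c) \<bullet> v + t1 = - \<rho> + t2"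
    using eq inner_ray[OF assms(1), of "G s" t1] inner_ray[OF assms(1), of "start p v" t2] assms(1) by (simp add: start_inner)
  ultimately have "t1 < t2" by (simp add: \<rho>_def)
  then have "fst (start p v, v) + (t2 - t1) *\<^sub>R snd (start p v, v) \<notin> C" using assms by (intro len_less_notin) auto
  moreover have "start p v + (t2 - t1) *\<^sub>R v = G s" using eq by (simp add: algebra_simps)
  ultimately show False using GC by simp
qed

lemma start_has_derivative: "((\<lambda>p. start p v) has_vector_derivative rot v) (at p within S)"
  unfolding start_def has_vector_derivative_def by (auto intro!: derivative_eq_intros)

text \<open>For a fixed direction the free flights from boundary points and from the entry side are
  pairwise disjoint, so the areas of any measurable choice of sub-stretches add up. It is applied to
  the last stretches of the flights and to the complete flights.\<close>

lemma area_rays: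
  fixes \<alpha> \<beta> :: "pt \<times> pt \<Rightarrow> real"
  assumes v: "norm v = 1" and [measurable]: "\<alpha> \<in> borel_measurable borel" "\<beta> \<in> borel_measurable borel"
    and \<alpha>: "\<And>z. 0 \<le> \<alpha> z" and \<beta>: "\<And>z. \<beta> z \<le> len z"
  defines "X1 \<equiv> {G s + t *\<^sub>R v | s t. s \<in> A \<and> \<alpha> (G s, v) < t \<and> t < \<beta> (G s, v)}"
    and "X2 \<equiv> {start p v + t *\<^sub>R v | p t. p \<in> {-\<rho><..<\<rho>} \<and> \<alpha> (start p v, v) < t \<and> t < \<beta> (start p v, v)}"
  shows "X1 \<in> lmeasurable" "X2 \<in> lmeasurable"
    "emeasure lebesgue (X1 \<union> X2) =
      (\<integral>\<^sup>+s. weight v s * ennreal (\<beta> (G s,v) - \<alpha> (G s,v)) \<partial>lborel) +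
      (\<integral>\<^sup>+p. indicator {-\<rho><..<\<rho>} p * ennreal (\<beta> (start p v,v) - \<alpha> (start p v,v)) \<partial>lborel)"
proof -
  let ?L = "max M (2*\<rho>)"
  have \<rho>: "\<rho> > 0" using R_pos by (simp add: \<rho>_def)
  have lenG: "len (G s, v) \<le> 2*\<rho>" if "s \<in> A" for s
  proof -
    have "G s \<in> C" using that G_C by auto
    then show ?thesis using in_C_inner[OF _ v, of "G s"] by (intro len_le v) (auto simp: \<rho>_def)
  qed
  have lenS: "len (start p v, v) \<le> 2*\<rho>" for p by (intro len_le v) (simp add: start_inner v)
  have b1: "\<And>s. s \<in> A \<Longrightarrow> \<bar>s\<bar> \<le> ?L" using A_bound by fastforce
  have a1: "\<And>s. s \<in> A \<Longrightarrow> - ?L \<le> \<alpha> (G s, v)" using \<alpha> \<rho> by (smt (verit))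
  have c1: "\<And>s. s \<in> A \<Longrightarrow> \<beta> (G s, v) \<le> ?L" using \<beta> lenG by (smt (verit))
  have m1: "(\<lambda>s. tn (G s)) \<in> borel_measurable borel" "(\<lambda>s. \<alpha> (G s,v)) \<in> borel_measurable borel" "(\<lambda>s. \<beta> (G s,v)) \<in> borel_measurable borel"
    by measurable
  interpret S1: swept_region A G "\<lambda>s. tn (G s)" "\<lambda>s. \<alpha> (G s,v)" "\<lambda>s. \<beta> (G s,v)" v ?L M
    by unfold_locales (fact A_borel b1 G_der m1 tn_bound a1 c1)+
  have b2: "\<And>s. s \<in> {-\<rho><..<\<rho>} \<Longrightarrow> \<bar>s\<bar> \<le> ?L" using \<rho> by fastforce
  have a2: "\<And>s. s \<in> {-\<rho><..<\<rho>} \<Longrightarrow> - ?L \<le> \<alpha> (start s v, v)" using \<alpha> \<rho> by (smt (verit))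
  have c2: "\<And>s. s \<in> {-\<rho><..<\<rho>} \<Longrightarrow> \<beta> (start s v, v) \<le> ?L" using \<beta> lenS by (smt (verit))
  have m2: "(\<lambda>s::real. rot v) \<in> borel_measurable borel" "(\<lambda>s. \<alpha> (start s v,v)) \<in> borel_measurable borel" "(\<lambda>s. \<beta> (start s v,v)) \<in> borel_measurable borel"
    by measurable
  have nr: "norm (rot v) \<le> 1" using v by (simp add: norm_eq_sqrt_inner norm_rot)
  interpret S2: swept_region "{-\<rho><..<\<rho>}" "\<lambda>p. start p v" "\<lambda>s. rot v" "\<lambda>s. \<alpha> (start s v,v)" "\<lambda>s. \<beta> (start s v,v)" v ?L 1
    by unfold_locales (fact b2 m2 a2 c2 | rule start_has_derivative nr borel_open[OF open_greaterThanLessThan])+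
  have X1: "X1 = S1.swept_map ` S1.swept_dom"
    unfolding X1_def by (rule S1.swept_image[symmetric])
  have X2: "X2 = S2.swept_map ` S2.swept_dom"
    unfolding X2_def by (rule S2.swept_image[symmetric])
  show L1: "X1 \<in> lmeasurable" unfolding X1 by (rule S1.swept_lmeas)
  show L2: "X2 \<in> lmeasurable" unfolding X2 by (rule S2.swept_lmeas)
  have i1: "inj_on S1.swept_map S1.swept_dom"
  proof (rule inj_onI)
    fix x y assume x: "x \<in> S1.swept_dom" and y: "y \<in> S1.swept_dom" and eq: "S1.swept_map x = S1.swept_map y"
    have "x$2 \<ge> 0" "y$2 \<ge> 0" "x$2 < len (G (x$1), v)" "y$2 < len (G (y$1), v)"
      using x y \<alpha>[of "(G (x$1), v)"] \<alpha>[of "(G (y$1), v)"] \<beta>[of "(G (x$1), v)"] \<beta>[of "(G (y$1), v)"]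
      by (auto simp: S1.swept_dom_def)
    then show "x = y" using x y eq unfolding vector2_eq_iff[of x]
      by (intro rays_disjoint_boundary) (auto simp: S1.swept_dom_def S1.swept_map_def)
  qed
  have i2: "inj_on S2.swept_map S2.swept_dom"
  proof (rule inj_onI)
    fix x y assume "S2.swept_map x = S2.swept_map y"
    then show "x = y" unfolding vector2_eq_iff[of x] S2.swept_map_def by (rule rays_disjoint_start[OF v])
  qed
  have "X1 \<inter> X2 = {}"
  proof -
    have False if "s \<in> A" "\<alpha> (G s, v) < t" "\<alpha> (start p v, v) < t'" "t' < \<beta> (start p v, v)" "G s + t *\<^sub>R v = start p v + t' *\<^sub>R v" for s t p t'
      using rays_disjoint_boundary_start[of v s t t' p] that v \<alpha>[of "(G s,v)"] \<beta>[of "(start p v, v)"] by linarith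
    then show ?thesis unfolding X1_def X2_def by blast
  qed
  then have "emeasure lebesgue (X1 \<union> X2) = emeasure lebesgue X1 + emeasure lebesgue X2"
    using L1 L2 by (intro plus_emeasure[symmetric]) (auto simp: fmeasurable_def)
  also have "emeasure lebesgue X1 = (\<integral>\<^sup>+s. weight v s * ennreal (\<beta> (G s,v) - \<alpha> (G s,v)) \<partial>lborel)"
    unfolding X1 by (rule S1.swept_eq[OF i1])
  also have "emeasure lebesgue X2 = (\<integral>\<^sup>+p. indicator {-\<rho><..<\<rho>} p * ennreal (\<beta> (start p v,v) - \<alpha> (start p v,v)) \<partial>lborel)"
  proof -
    have "\<bar>cr (rot v) v\<bar> = 1" using v by (simp add: cr_def norm_eq_1 inner2)
    then show ?thesis unfolding X2 by (subst S2.swept_eq[OF i2]) simp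
  qed
  finally show "emeasure lebesgue (X1 \<union> X2) =
      (\<integral>\<^sup>+s. weight v s * ennreal (\<beta> (G s,v) - \<alpha> (G s,v)) \<partial>lborel) +
      (\<integral>\<^sup>+p. indicator {-\<rho><..<\<rho>} p * ennreal (\<beta> (start p v,v) - \<alpha> (start p v,v)) \<partial>lborel)" .
qed

text \<open>The area swept by the last stretches of length d of the flights is computed from the starting points,
  where the sweep is injective, and bounded from the end points, where injectivity is not needed. Letting d
  tend to 0 removes the restriction to flights longer than d.\<close>

lemma flight_short:
  assumes v: "norm v = 1" and E[measurable]: "E \<in> sets borel" and d: "d > 0"
  defines "H \<equiv> {z \<in> hitting. hit_point z \<in> E \<and> hit_time z > d}"
  shows "(\<integral>\<^sup>+s. weight v s * indicator H (G s,v) \<partial>lborel) +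
      (\<integral>\<^sup>+p. indicator {-\<rho><..<\<rho>} p * indicator H (start p v,v) \<partial>lborel)
     \<le> (\<integral>\<^sup>+s. weight v s * indicator E (G s) \<partial>lborel)" (is "?l1 + ?l2 \<le> ?r")
proof -
  have [measurable]: "H \<in> sets borel" unfolding H_def by measurable
  \<comment> \<open>States outside H get the empty stretch from 0 to 0.\<close>
  define \<alpha> where "\<alpha> = (\<lambda>z. if z \<in> H then hit_time z - d else 0)"
  define \<beta> where "\<beta> = (\<lambda>z. if z \<in> H then hit_time z else 0)"
  have [measurable]: "\<alpha> \<in> borel_measurable borel" "\<beta> \<in> borel_measurable borel"
    unfolding \<alpha>_def \<beta>_def by measurable
  have \<alpha>: "0 \<le> \<alpha> z" for z by (auto simp: \<alpha>_def H_def)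
  have \<beta>: "\<beta> z \<le> len z" for z by (auto simp: \<beta>_def H_def len_def hitting_def len_nonneg hit_time_nonneg)
  have \<beta>\<alpha>: "ennreal (\<beta> z - \<alpha> z) = ennreal d * indicator H z" for z
    by (auto simp: \<alpha>_def \<beta>_def)
  note ar = area_rays[OF v _ _ \<alpha> \<beta>, simplified]
  let ?X1 = "{G s + t *\<^sub>R v | s t. s \<in> A \<and> \<alpha> (G s, v) < t \<and> t < \<beta> (G s, v)}"
  let ?X2 = "{start p v + t *\<^sub>R v | p t. p \<in> {-\<rho><..<\<rho>} \<and> \<alpha> (start p v, v) < t \<and> t < \<beta> (start p v, v)}"
  have eq: "emeasure lebesgue (?X1 \<union> ?X2) = ennreal d * (?l1 + ?l2)"
    unfolding area_rays(3)[OF v \<open>\<alpha> \<in> _\<close> \<open>\<beta> \<in> _\<close> \<alpha> \<beta>] \<beta>\<alpha> distrib_left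
    by (subst (1 2) nn_integral_cmult[symmetric]) (auto simp: mult_ac)
  let ?B = "A \<inter> G -` E"
  have B: "?B \<in> sets borel"
    using measurable_sets[OF G_meas E] by (auto)
  let ?L = "max M d"
  have b1: "\<And>s. s \<in> ?B \<Longrightarrow> \<bar>s\<bar> \<le> ?L" using A_bound by fastforce
  have der: "\<And>s. s \<in> ?B \<Longrightarrow> (G has_vector_derivative tn (G s)) (at s within ?B)"
    using G_der by (auto intro: has_vector_derivative_within_subset)
  have m1: "(\<lambda>s. tn (G s)) \<in> borel_measurable borel" by measurable
  have tb: "\<And>s. s \<in> ?B \<Longrightarrow> norm (tn (G s)) \<le> M" using tn_bound by auto
  have a1: "\<And>s. s \<in> ?B \<Longrightarrow> - ?L \<le> 0" using d by simp
  have c1: "\<And>s. s \<in> ?B \<Longrightarrow> d \<le> ?L" by simp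
  interpret S: swept_region ?B G "\<lambda>s. tn (G s)" "\<lambda>s. 0" "\<lambda>s. d" "-v" ?L M
    by unfold_locales (fact B b1 der m1 tb borel_measurable_const a1 c1)+
  have sub: "?X1 \<union> ?X2 \<subseteq> {G s + t *\<^sub>R (-v) | s t. s \<in> ?B \<and> 0 < t \<and> t < d}"
  proof -
    have "x + t *\<^sub>R v \<in> {G s + t *\<^sub>R (-v) | s t. s \<in> ?B \<and> 0 < t \<and> t < d}" if "\<alpha> (x,v) < t" "t < \<beta> (x,v)" for x t
    proof -
      have H: "(x,v) \<in> H" using that by (auto simp: \<alpha>_def \<beta>_def split: if_splits)
      then have t: "hit_time (x,v) - d < t" "t < hit_time (x,v)" using that by (auto simp: \<alpha>_def \<beta>_def)
      have "(x,v) \<in> hitting" "hit_point (x,v) \<in> E" using H by (auto simp: H_def)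
      then obtain s where s: "s \<in> A" "hit_point (x,v) = G s" using hit_point_boundary by blast
      have "x + t *\<^sub>R v = G s + (hit_time (x,v) - t) *\<^sub>R (-v)"
        unfolding s(2)[symmetric] by (simp add: hit_point_def algebra_simps)
      then show ?thesis using s t \<open>hit_point (x,v) \<in> E\<close> by force
    qed
    then show ?thesis by blast
  qed
  have "emeasure lebesgue (?X1 \<union> ?X2) \<le> emeasure lebesgue {G s + t *\<^sub>R (-v) | s t. s \<in> ?B \<and> 0 < t \<and> t < d}"
    using S.swept_lmeas sub unfolding S.swept_image by (intro emeasure_mono) (auto simp: fmeasurable_def)
  also have "\<dots> \<le> (\<integral>\<^sup>+s. indicator ?B s * ennreal \<bar>cr (tn (G s)) (-v)\<bar> * ennreal (d - 0) \<partial>lborel)"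
    using S.swept_le unfolding S.swept_image .
  also have "\<dots> = (\<integral>\<^sup>+s. ennreal d * (weight v s * indicator E (G s)) \<partial>lborel)"
    by (intro nn_integral_cong) (auto simp: indicator_def cr_def mult_ac abs_minus_commute)
  also have "\<dots> = ennreal d * ?r"
    by (rule nn_integral_cmult) measurable
  finally have "ennreal d * (?l1 + ?l2) \<le> ennreal d * ?r" unfolding eq .
  then show ?thesis using d by (simp add: ennreal_mult_le_mult_iff)
qed

lemma flight_sets:
  assumes v: "norm v = 1" and E[measurable]: "E \<in> sets borel"
  shows "(\<integral>\<^sup>+s. weight v s * indicator {z\<in>hitting. hit_point z \<in> E} (G s,v) \<partial>lborel) +
      (\<integral>\<^sup>+p. indicator {-\<rho><..<\<rho>} p * indicator {z\<in>hitting. hit_point z \<in> E} (start p v,v) \<partial>lborel)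
     \<le> (\<integral>\<^sup>+s. weight v s * indicator E (G s) \<partial>lborel)"
proof -
  define H where "H n = {z \<in> hitting. hit_point z \<in> E \<and> hit_time z > 1 / real (Suc n)}" for n
  define H' where "H' = {z \<in> hitting. hit_point z \<in> E}"
  have [measurable]: "H n \<in> sets borel" for n unfolding H_def by measurable
  have inc: "incseq H" unfolding H_def
    by (intro monoI) (auto elim!: le_less_trans[rotated] intro!: divide_left_mono)
  \<comment> \<open>On \<open>hitting\<close> the hit time is positive, so every state of the limit
    set belongs to H n from some n on.\<close>
  have ev: "eventually (\<lambda>n. indicator (H n) z = (indicator H' z :: ennreal)) sequentially" for z
  proof (cases "z \<in> H'")
    case True
    then have "hit_time z > 0" by (auto simp: H'_def hitting_def)
    then obtain N where N: "1 / real (Suc N) < hit_time z" using nat_approx_posE by blast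
    then have "z \<in> H N" using True by (simp add: H_def H'_def)
    then have "z \<in> H n" if "n \<ge> N" for n using inc that by (auto dest: incseqD)
    then show ?thesis using True unfolding eventually_sequentially by (intro exI[of _ N]) auto
  next
    case False then show ?thesis by (auto simp: H_def H'_def)
  qed
  have 1: "(\<lambda>n. \<integral>\<^sup>+s. weight v s * indicator (H n) (G s,v) \<partial>lborel) \<longlonglongrightarrow>
    (\<integral>\<^sup>+s. weight v s * indicator H' (G s,v) \<partial>lborel)"
  proof (rule nn_integral_LIMSEQ)
    show "incseq (\<lambda>n s. weight v s * indicator (H n) (G s,v))"
      using inc by (intro monoI le_funI mult_left_mono) (auto simp: indicator_def dest: incseqD)
    show "(\<lambda>n. weight v s * indicator (H n) (G s,v)) \<longlonglongrightarrow> weight v s * indicator H' (G s,v)" for s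
      by (intro tendsto_eventually eventually_mono[OF ev[of "(G s,v)"]]) simp
  qed measurable
  have 2: "(\<lambda>n. \<integral>\<^sup>+p. indicator {-\<rho><..<\<rho>} p * indicator (H n) (start p v,v) \<partial>lborel) \<longlonglongrightarrow>
    (\<integral>\<^sup>+p. indicator {-\<rho><..<\<rho>} p * indicator H' (start p v,v) \<partial>lborel)"
  proof (rule nn_integral_LIMSEQ)
    show "incseq (\<lambda>n p. indicator {-\<rho><..<\<rho>} p * indicator (H n) (start p v,v) :: ennreal)"
      using inc by (intro monoI le_funI mult_left_mono) (auto simp: indicator_def dest: incseqD)
    show "(\<lambda>n. indicator {-\<rho><..<\<rho>} p * indicator (H n) (start p v,v)) \<longlonglongrightarrow> (indicator {-\<rho><..<\<rho>} p * indicator H' (start p v,v) :: ennreal)" for p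
      by (intro tendsto_eventually eventually_mono[OF ev[of "(start p v,v)"]]) simp
  qed measurable
  show ?thesis unfolding H'_def[symmetric]
    by (rule LIMSEQ_le_const2[OF tendsto_add[OF 1 2]]) (use flight_short[OF v E] in \<open>auto simp: H_def\<close>)
qed

text \<open>For a fixed direction, the image of the measure on flights under the map to the point of
  impact is dominated by the boundary measure. The extension from sets to nonnegative functions is
  by the usual induction over simple functions and suprema.\<close>

lemma flight:
  assumes v: "norm v = 1" and k: "k \<in> borel_measurable borel"
  shows "(\<integral>\<^sup>+s. weight v s * (indicator hitting (G s,v) * k (hit_point (G s,v))) \<partial>lborel) +
      (\<integral>\<^sup>+p. indicator {-\<rho><..<\<rho>} p * (indicator hitting (start p v,v) * k (hit_point (start p v,v))) \<partial>lborel)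
     \<le> (\<integral>\<^sup>+s. weight v s * k (G s) \<partial>lborel)"
  using k
proof (induction rule: borel_measurable_induct)
  case (cong f g)
  then have "f = g" by auto
  then show ?case using cong by simp
next
  case (set E)
  then show ?case using flight_sets[OF v, of E]
    by (simp add: indicator_inter_arith[symmetric] Collect_conj_eq vimage_def indicator_def of_bool_conj cong: if_cong)
next
  case (mult u a)
  note [measurable] = mult.hyps(2)
  have "a * ((\<integral>\<^sup>+s. weight v s * (indicator hitting (G s,v) * u (hit_point (G s,v))) \<partial>lborel) +
      (\<integral>\<^sup>+p. indicator {-\<rho><..<\<rho>} p * (indicator hitting (start p v,v) * u (hit_point (start p v,v))) \<partial>lborel))
     \<le> a * (\<integral>\<^sup>+s. weight v s * u (G s) \<partial>lborel)"
    by (rule mult_left_mono[OF mult.IH]) simp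
  then show ?case unfolding distrib_left
    by (subst (asm) (1 2 3) nn_integral_cmult[symmetric]) (auto simp: mult_ac)
next
  case (add u w)
  note [measurable] = add.hyps(1,3)
  show ?case unfolding distrib_left
    by (subst (1 2 3) nn_integral_add) (use add_mono[OF add.IH] in \<open>auto simp: add_ac\<close>)
next
  case (seq U)
  have lim: "(\<lambda>i. \<integral>\<^sup>+x. w x * U i (f x) \<partial>lborel) \<longlonglongrightarrow> (\<integral>\<^sup>+x. w x * (SUP i. U i) (f x) \<partial>lborel)"
    if [measurable]: "w \<in> borel_measurable borel" "f \<in> borel_measurable borel" and fin: "\<And>x. w x < top" for w :: "real \<Rightarrow> ennreal" and f
  proof (rule nn_integral_LIMSEQ)
    show "incseq (\<lambda>i x. w x * U i (f x))"
      using seq.hyps(3) by (intro monoI le_funI mult_left_mono) (auto simp: incseq_def le_fun_def)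
    have "incseq (\<lambda>i. U i (f x))" for x using seq.hyps(3) by (auto simp: incseq_def le_fun_def)
    then show "(\<lambda>i. w x * U i (f x)) \<longlonglongrightarrow> w x * (SUP i. U i) (f x)" for x
      using fin by (intro ennreal_tendsto_cmult) (simp_all add: LIMSEQ_SUP image_comp)
    show "(\<lambda>x. w x * U i (f x)) \<in> borel_measurable lborel" for i
      using seq.hyps(1) by measurable
  qed
  have 1: "(\<lambda>i. \<integral>\<^sup>+s. weight v s * (indicator hitting (G s,v) * U i (hit_point (G s,v))) \<partial>lborel) \<longlonglongrightarrow>
     (\<integral>\<^sup>+s. weight v s * (indicator hitting (G s,v) * (SUP i. U i) (hit_point (G s,v))) \<partial>lborel)"
    unfolding mult.assoc[symmetric] by (rule lim) (auto simp: indicator_def)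
  have 2: "(\<lambda>i. \<integral>\<^sup>+p. indicator {-\<rho><..<\<rho>} p * (indicator hitting (start p v,v) * U i (hit_point (start p v,v))) \<partial>lborel) \<longlonglongrightarrow>
     (\<integral>\<^sup>+p. indicator {-\<rho><..<\<rho>} p * (indicator hitting (start p v,v) * (SUP i. U i) (hit_point (start p v,v))) \<partial>lborel)"
    unfolding mult.assoc[symmetric] by (rule lim) (auto simp: indicator_def)
  have 3: "(\<lambda>i. \<integral>\<^sup>+s. weight v s * U i (G s) \<partial>lborel) \<longlonglongrightarrow>
     (\<integral>\<^sup>+s. weight v s * (SUP i. U i) (G s) \<partial>lborel)"
    by (rule lim) (auto simp: indicator_def)
  show ?case
    by (rule LIMSEQ_le[OF tendsto_add[OF 1 2] 3]) (use seq.IH in auto)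
qed


section \<open>Phase space integrals and the collision map\<close>

definition boundary_int :: "(pt \<times> pt \<Rightarrow> ennreal) \<Rightarrow> ennreal" where
  "boundary_int h = (\<integral>\<^sup>+v. \<integral>\<^sup>+s. weight v s * h (G s, v) \<partial>lborel \<partial>circ)"

definition line_int :: "(pt \<times> pt \<Rightarrow> ennreal) \<Rightarrow> ennreal" where
  "line_int h = (\<integral>\<^sup>+v. \<integral>\<^sup>+p. indicator {-\<rho><..<\<rho>} p * h (start p v, v) \<partial>lborel \<partial>circ)"

text \<open>Composition with the collision map, extended by 0 to states without a further collision;
  its n-th power therefore sees only trajectories with at least n collisions.\<close>

definition transfer_op :: "(pt \<times> pt \<Rightarrow> ennreal) \<Rightarrow> pt \<times> pt \<Rightarrow> ennreal" where
  "transfer_op h z = indicator hitting z * h (step z)"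

lemma transfer_op_meas [measurable]:
  assumes [measurable]: "h \<in> borel_measurable borel"
  shows "transfer_op h \<in> borel_measurable borel"
  unfolding transfer_op_def by measurable

text \<open>\<open>flight\<close> handles the free motion at a fixed direction. After exchanging the
  integrals the boundary point is fixed instead, and there the reflection preserves both
  \<open>circ\<close> and the weight.\<close>

lemma transfer:
  assumes [measurable]: "h \<in> borel_measurable borel"
  shows "line_int (transfer_op h) + boundary_int (transfer_op h) \<le> boundary_int h"
proof -
  interpret P: pair_sigma_finite lborel circ by unfold_locales
  have "line_int (transfer_op h) + boundary_int (transfer_op h) =
     (\<integral>\<^sup>+v. (\<integral>\<^sup>+s. weight v s * transfer_op h (G s, v) \<partial>lborel) +
      (\<integral>\<^sup>+p. indicator {-\<rho><..<\<rho>} p * transfer_op h (start p v, v) \<partial>lborel) \<partial>circ)"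
    unfolding boundary_int_def line_int_def by (subst nn_integral_add) (auto simp: add.commute)
  also have "\<dots> \<le> (\<integral>\<^sup>+v. \<integral>\<^sup>+s. weight v s * h (G s, reflect_tangent (tn (G s)) v) \<partial>lborel \<partial>circ)"
  proof (rule nn_integral_circ_mono)
    fix v :: pt assume v: "norm v = 1"
    have "(\<lambda>x. h (x, reflect_tangent (tn x) v)) \<in> borel_measurable borel" by measurable
    from flight[OF v this] show "(\<integral>\<^sup>+s. weight v s * transfer_op h (G s, v) \<partial>lborel) +
      (\<integral>\<^sup>+p. indicator {-\<rho><..<\<rho>} p * transfer_op h (start p v, v) \<partial>lborel)
      \<le> (\<integral>\<^sup>+s. weight v s * h (G s, reflect_tangent (tn (G s)) v) \<partial>lborel)"
      by (simp add: transfer_op_def step_def)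
  qed
  also have "\<dots> = (\<integral>\<^sup>+s. \<integral>\<^sup>+v. weight v s * h (G s, reflect_tangent (tn (G s)) v) \<partial>circ \<partial>lborel)"
    by (rule P.Fubini') measurable
  also have "\<dots> = (\<integral>\<^sup>+s. \<integral>\<^sup>+v. weight v s * h (G s, v) \<partial>circ \<partial>lborel)"
  proof (rule nn_integral_cong)
    fix s
    show "(\<integral>\<^sup>+v. weight v s * h (G s, reflect_tangent (tn (G s)) v) \<partial>circ) =
      (\<integral>\<^sup>+v. weight v s * h (G s, v) \<partial>circ)"
    proof (cases "s \<in> A")
      case True
      have m: "(\<lambda>v. weight v s * h (G s, v)) \<in> borel_measurable borel" by measurable
      show ?thesis using nn_integral_circ_reflect[OF m tn_nonzero[OF True]] by (simp add: cr_reflect)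
    qed simp
  qed
  also have "\<dots> = boundary_int h"
    unfolding boundary_int_def by (rule P.Fubini'[symmetric]) measurable
  finally show ?thesis .
qed

text \<open>Telescoping: the boundary integral remaining after N collisions pays for the line
  integral of the next one.\<close>

lemma transfer_sum:
  assumes [measurable]: "h \<in> borel_measurable borel"
  shows "(\<Sum>n<N. line_int ((transfer_op ^^ Suc n) h)) + boundary_int ((transfer_op ^^ N) h) \<le> boundary_int h"
proof (induction N)
  case (Suc N)
  have m: "(transfer_op ^^ n) h \<in> borel_measurable borel" for n by (induction n) auto
  have "(\<Sum>n<Suc N. line_int ((transfer_op ^^ Suc n) h)) + boundary_int ((transfer_op ^^ Suc N) h) =
    (\<Sum>n<N. line_int ((transfer_op ^^ Suc n) h)) + (line_int (transfer_op ((transfer_op ^^ N) h)) + boundary_int (transfer_op ((transfer_op ^^ N) h)))" by (simp add: add.assoc)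
  also have "\<dots> \<le> (\<Sum>n<N. line_int ((transfer_op ^^ Suc n) h)) + boundary_int ((transfer_op ^^ N) h)"
    by (intro add_left_mono transfer m)
  finally show ?case using Suc by order
qed simp

lemma transfer_suminf:
  assumes "h \<in> borel_measurable borel"
  shows "(\<Sum>n. line_int ((transfer_op ^^ Suc n) h)) \<le> boundary_int h"
proof (rule suminf_le_const)
  show "(\<Sum>n<N. line_int ((transfer_op ^^ Suc n) h)) \<le> boundary_int h" for N
    by (rule order_trans[OF _ transfer_sum[OF assms, of N]]) (simp add: add_increasing2)
qed simp


section \<open>Almost every line leaves\<close>


text \<open>The set is an open square of side 2\<rho> centred at c; obtaining its area as a sweep
  makes it visibly the same for all directions.\<close>

lemma emeasure_strip_box:
  assumes v: "norm v = 1"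
  shows "emeasure lebesgue (strip v) = ennreal (4 * \<rho>\<^sup>2)"
    "strip v \<in> lmeasurable"
proof -
  have \<rho>: "\<rho> > 0" using R_pos by (simp add: \<rho>_def)
  have b2: "\<And>s. s \<in> {-\<rho><..<\<rho>} \<Longrightarrow> \<bar>s\<bar> \<le> 2*\<rho>" using \<rho> by fastforce
  have nr: "norm (rot v) \<le> 1" using v by (simp add: norm_eq_sqrt_inner norm_rot)
  interpret S: swept_region "{-\<rho><..<\<rho>}" "\<lambda>p. start p v" "\<lambda>s. rot v" "\<lambda>s. 0" "\<lambda>s. 2*\<rho>" v "2*\<rho>" 1
    by unfold_locales (fact b2 borel_measurable_const | rule start_has_derivative nr borel_open[OF open_greaterThanLessThan] | use \<rho> in simp)+
  have "inj_on S.swept_map S.swept_dom"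
  proof (rule inj_onI)
    fix x y assume "S.swept_map x = S.swept_map y"
    then show "x = y" unfolding vector2_eq_iff[of x] S.swept_map_def by (rule rays_disjoint_start[OF v])
  qed
  from S.swept_eq[OF this] have "emeasure lebesgue (strip v) =
    (\<integral>\<^sup>+s. indicator {-\<rho><..<\<rho>} s * ennreal \<bar>cr (rot v) v\<bar> * ennreal (2*\<rho> - 0) \<partial>lborel)"
    unfolding S.swept_image .
  also have "\<bar>cr (rot v) v\<bar> = 1" using v by (simp add: cr_def norm_eq_1 inner2)
  also have "(\<integral>\<^sup>+s. indicator {-\<rho><..<\<rho>} s * ennreal 1 * ennreal (2*\<rho> - 0) \<partial>lborel) = ennreal (4 * \<rho>\<^sup>2)"
    using \<rho> by (simp add: nn_integral_multc ennreal_mult[symmetric] power2_eq_square)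
  finally show "emeasure lebesgue (strip v) = ennreal (4 * \<rho>\<^sup>2)" .
  show "strip v \<in> lmeasurable"
    using S.swept_lmeas unfolding S.swept_image .
qed

lemma strip_box_iff:
  assumes v: "norm v = 1"
  shows "y \<in> strip v \<longleftrightarrow>
    \<bar>(y - c) \<bullet> v\<bar> < \<rho> \<and> \<bar>(y - c) \<bullet> rot v\<bar> < \<rho>"
proof
  assume "y \<in> strip v"
  then obtain p t where y: "y = start p v + t *\<^sub>R v" "p \<in> {-\<rho><..<\<rho>}" "0 < t" "t < 2*\<rho>" by blast
  have "(y - c) \<bullet> v = - \<rho> + t" unfolding y(1) inner_ray[OF v] start_inner[OF v] ..
  moreover have "(y - c) \<bullet> rot v = p"
    using start_rot[OF v, of p] by (simp add: y(1) inner_diff_left inner_add_left rot_inner)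
  ultimately show "\<bar>(y - c) \<bullet> v\<bar> < \<rho> \<and> \<bar>(y - c) \<bullet> rot v\<bar> < \<rho>" using y by auto
next
  assume *: "\<bar>(y - c) \<bullet> v\<bar> < \<rho> \<and> \<bar>(y - c) \<bullet> rot v\<bar> < \<rho>"
  define p where "p = (y - c) \<bullet> rot v"
  define t where "t = (y - c) \<bullet> v + \<rho>"
  have "y - c = p *\<^sub>R rot v + (t - \<rho>) *\<^sub>R v"
    unfolding p_def t_def using orthogonal_decomposition[OF v, of "y - c"] by simp
  then have "y = start p v + t *\<^sub>R v" unfolding start_def by (simp add: algebra_simps)
  moreover have "p \<in> {-\<rho><..<\<rho>}" "0 < t" "t < 2*\<rho>" using * by (auto simp: p_def t_def)
  ultimately show "y \<in> strip v" by blast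
qed

lemma C_strip:
  assumes v: "norm v = 1" shows "C \<subseteq> strip v"
proof
  fix y assume y: "y \<in> C"
  have "norm (rot v) = 1" using v by (simp add: norm_eq_sqrt_inner norm_rot)
  then show "y \<in> strip v"
    unfolding strip_box_iff[OF v] using in_C_inner[OF y v] in_C_inner[OF y, of "rot v"] by (simp add: \<rho>_def)
qed

text \<open>This concerns single flights, one from every incoming line and every boundary state. For
  each direction they are disjoint and lie in the square minus C; the directions contribute the
  factor 2 pi.\<close>

lemma volume_ineq:
  "line_int (\<lambda>z. ennreal (len z)) + boundary_int (\<lambda>z. ennreal (len z)) \<le> ennreal (2 * pi) * (ennreal (4 * \<rho>\<^sup>2) - emeasure lebesgue C)"
proof -
  have "line_int (\<lambda>z. ennreal (len z)) + boundary_int (\<lambda>z. ennreal (len z)) =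
     (\<integral>\<^sup>+v. (\<integral>\<^sup>+s. weight v s * ennreal (len (G s, v)) \<partial>lborel) +
      (\<integral>\<^sup>+p. indicator {-\<rho><..<\<rho>} p * ennreal (len (start p v, v)) \<partial>lborel) \<partial>circ)"
    unfolding boundary_int_def line_int_def by (subst nn_integral_add) (auto simp: add.commute)
  also have "\<dots> \<le> (\<integral>\<^sup>+v. ennreal (4 * \<rho>\<^sup>2) - emeasure lebesgue C \<partial>circ)"
  proof (rule nn_integral_circ_mono)
    fix v :: pt assume v: "norm v = 1"
    let ?X1 = "{G s + t *\<^sub>R v | s t. s \<in> A \<and> 0 < t \<and> t < len (G s, v)}"
    let ?X2 = "{start p v + t *\<^sub>R v | p t. p \<in> {-\<rho><..<\<rho>} \<and> 0 < t \<and> t < len (start p v, v)}"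
    have C_lm: "C \<in> lmeasurable" using C_compact by (rule lmeasurable_compact)
    have ar: "emeasure lebesgue (?X1 \<union> ?X2) =
      (\<integral>\<^sup>+s. weight v s * ennreal (len (G s, v)) \<partial>lborel) +
      (\<integral>\<^sup>+p. indicator {-\<rho><..<\<rho>} p * ennreal (len (start p v, v)) \<partial>lborel)"
      using area_rays(3)[OF v, of "\<lambda>_. 0" len] len_meas by simp
    have nr: "norm (rot v) = 1" using v by (simp add: norm_eq_sqrt_inner norm_rot)
    have CP: "C \<subseteq> strip v" by (rule C_strip[OF v])
    have ray: "x + t *\<^sub>R v \<in> strip v - C" if "0 < t" "t < len (x,v)" "- \<rho> \<le> (x - c) \<bullet> v" "\<bar>(x - c) \<bullet> rot v\<bar> < \<rho>" for x t
    proof -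
      have "(x + t *\<^sub>R v - c) \<bullet> v < \<rho>" using that v by (intro len_less_inner) auto
      moreover have "- \<rho> < (x + t *\<^sub>R v - c) \<bullet> v" using inner_ray[OF v, of x t] that by simp
      moreover have "(x + t *\<^sub>R v - c) \<bullet> rot v = (x - c) \<bullet> rot v"
        by (simp add: inner_diff_left inner_add_left rot_inner)
      moreover have "x + t *\<^sub>R v \<notin> C" using len_less_notin[of t "(x,v)"] that by simp
      ultimately show ?thesis using that strip_box_iff[OF v, of "x + t *\<^sub>R v"] by simp
    qed
    have "?X1 \<subseteq> strip v - C"
    proof -
      have "G s + t *\<^sub>R v \<in> strip v - C" if "s \<in> A" "0 < t" "t < len (G s, v)" for s t
      proof -
        have "G s \<in> C" using that G_C by auto
        then show ?thesis using in_C_inner[of "G s" v] in_C_inner[of "G s" "rot v"] v nr that by (intro ray) (auto simp: \<rho>_def)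
      qed
      then show ?thesis by blast
    qed
    moreover have "?X2 \<subseteq> strip v - C"
    proof -
      have "start p v + t *\<^sub>R v \<in> strip v - C" if "p \<in> {-\<rho><..<\<rho>}" "0 < t" "t < len (start p v, v)" for p t
        using that by (intro ray) (auto simp: start_inner[OF v] start_rot[OF v])
      then show ?thesis by blast
    qed
    ultimately have "emeasure lebesgue (?X1 \<union> ?X2) \<le> emeasure lebesgue (strip v - C)"
      using C_lm emeasure_strip_box(2)[OF v] by (intro emeasure_mono) (auto simp: fmeasurable_def)
    also have "\<dots> = emeasure lebesgue (strip v) - emeasure lebesgue C"
      using C_lm emeasure_strip_box(2)[OF v] CP by (intro emeasure_Diff) (auto simp: fmeasurable_def)
    finally show "(\<integral>\<^sup>+s. weight v s * ennreal (len (G s, v)) \<partial>lborel) +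
      (\<integral>\<^sup>+p. indicator {-\<rho><..<\<rho>} p * ennreal (len (start p v, v)) \<partial>lborel) \<le> ennreal (4 * \<rho>\<^sup>2) - emeasure lebesgue C"
      unfolding ar emeasure_strip_box(1)[OF v] .
  qed
  also have "\<dots> = ennreal (2 * pi) * (ennreal (4 * \<rho>\<^sup>2) - emeasure lebesgue C)"
    by (simp add: emeasure_circ mult.commute)
  finally show ?thesis .
qed

section \<open>The measure on incoming lines and its null sets\<close>

definition line_measure :: "(pt \<times> pt) measure" where
  "line_measure = distr (density (circ \<Otimes>\<^sub>M lborel) (\<lambda>(v,p). indicator {-\<rho><..<\<rho>} p)) borel (\<lambda>(v,p). (start p v, v))"

lemma sets_line_measure [simp, measurable_cong]: "sets line_measure = sets borel" by (simp add: line_measure_def)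
lemma space_line_measure [simp]: "space line_measure = UNIV" by (simp add: line_measure_def)

lemma line_int_eq:
  assumes [measurable]: "h \<in> borel_measurable borel"
  shows "line_int h = (\<integral>\<^sup>+z. h z \<partial>line_measure)"
  unfolding line_int_def line_measure_def
  by (subst nn_integral_distr, measurable, subst nn_integral_density, measurable, subst lborel.nn_integral_fst[symmetric])
     (auto simp: split_beta)

lemma AE_line_measureI:
  assumes [measurable]: "Measurable.pred borel P" and "\<And>v p. norm v = 1 \<Longrightarrow> p \<in> {-\<rho><..<\<rho>} \<Longrightarrow> P (start p v, v)"
  shows "AE z in line_measure. P z"
proof -
  have "emeasure line_measure {z. \<not> P z} = line_int (indicator {z. \<not> P z})"
    by (subst line_int_eq) (auto simp: pred_def intro!: nn_integral_indicator[symmetric])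
  also have "\<dots> = (\<integral>\<^sup>+v. 0 \<partial>(circ :: pt measure))"
    unfolding line_int_def using assms(2) by (intro nn_integral_circ_cong) (auto simp: indicator_def intro!: nn_integral_0_iff_AE[THEN iffD2])
  finally show ?thesis by (intro AE_I[where N="{z. \<not> P z}"]) auto
qed

lemma transfer_op_pow: "(transfer_op ^^ n) h z = (if \<forall>j<n. (step ^^ j) z \<in> hitting then h ((step ^^ n) z) else 0)"
proof (induction n arbitrary: z)
  case (Suc n)
  have "(transfer_op ^^ Suc n) h z = indicator hitting z * (transfer_op ^^ n) h (step z)" by (simp add: transfer_op_def)
  also have "\<dots> = (if z \<in> hitting \<and> (\<forall>j<n. (step ^^ Suc j) z \<in> hitting) then h ((step ^^ Suc n) z) else 0)"
    unfolding Suc by (cases "z \<in> hitting") (auto simp: funpow_swap1)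
  also have "(z \<in> hitting \<and> (\<forall>j<n. (step ^^ Suc j) z \<in> hitting)) \<longleftrightarrow> (\<forall>j<Suc n. (step ^^ j) z \<in> hitting)"
    by (simp add: All_less_Suc2)
  finally show ?case .
qed simp

lemma transfer_op_pow_meas: "h \<in> borel_measurable borel \<Longrightarrow> (transfer_op ^^ n) h \<in> borel_measurable borel"
  by (induction n) auto

lemma step_pow_meas [measurable]: "(step ^^ n) \<in> borel_measurable borel"
proof (induction n)
  case (Suc n)
  show ?case unfolding funpow.simps by (rule measurable_comp[OF Suc step_meas])
qed (simp add: id_def)

text \<open>States just after a collision at an exceptional point or with a grazing
  direction.\<close>

definition Bad where "Bad = {z. fst z \<in> N0 \<or> cr (tn (fst z)) (snd z) = 0}"

lemma N0_borel [measurable]: "N0 \<in> sets borel"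
  using N0_countable by (rule sets.countable[rotated]) simp

lemma Bad_borel [measurable]: "Bad \<in> sets borel"
  unfolding Bad_def by measurable

text \<open>A countable set of points has countably many parameters because G is injective on A, and
  grazing directions carry weight 0.\<close>

lemma boundary_int_Bad: "boundary_int (indicator Bad) = 0"
proof -
  have "countable (A \<inter> G -` N0)"
  proof (rule countable_image_inj_on)
    show "countable (G ` (A \<inter> G -` N0))" by (rule countable_subset[OF _ N0_countable]) auto
    show "inj_on G (A \<inter> G -` N0)" using G_inj by (rule inj_on_subset) auto
  qed
  then have "AE s in lborel. s \<notin> A \<inter> G -` N0" by (intro AE_not_in countable_imp_null_set_lborel)
  then have ae: "AE s in lborel. weight v s * indicator Bad (G s, v) = 0" for v
    by eventually_elim (auto simp: Bad_def indicator_def)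
  have "(\<integral>\<^sup>+s. weight v s * indicator Bad (G s, v) \<partial>lborel) = 0" for v
    using ae by (subst nn_integral_0_iff_AE) auto
  then show ?thesis unfolding boundary_int_def by simp
qed

lemma boundary_int_1: "boundary_int (\<lambda>_. 1) < \<infinity>"
proof -
  have "boundary_int (\<lambda>_. 1) \<le> (\<integral>\<^sup>+v. \<integral>\<^sup>+s. ennreal M * indicator {-M..M} s \<partial>lborel \<partial>circ)"
    unfolding boundary_int_def
  proof (intro nn_integral_circ_mono nn_integral_mono)
    fix v :: pt and s assume v: "norm v = 1"
    have "\<bar>cr (tn (G s)) v\<bar> \<le> M" if "s \<in> A"
      using abs_cr_le[of "tn (G s)" v] tn_bound[OF that] v by simp
    then show "weight v s * 1 \<le> ennreal M * indicator {-M..M} s"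
      using A_bound[of s] by (auto simp: indicator_def intro: ennreal_leI)
  qed
  also have "\<dots> = ennreal M * emeasure lborel {-M..M} * ennreal (2*pi)"
    by (simp add: nn_integral_cmult emeasure_circ)
  also have "\<dots> < \<infinity>" by (simp add: ennreal_mult_less_top emeasure_lborel_Icc_eq)
  finally show ?thesis .
qed

text \<open>By \<open>transfer_suminf\<close>, the measure of the lines that are bad after some
  given number of collisions is bounded by the boundary measure of \<open>Bad\<close>, which is
  0.\<close>

lemma AE_not_bad: "AE z in line_measure. \<forall>n. (\<forall>j<Suc n. (step ^^ j) z \<in> hitting) \<longrightarrow> (step ^^ Suc n) z \<notin> Bad"
proof (subst AE_all_countable, rule allI)
  fix n
  have "(\<Sum>n. line_int ((transfer_op ^^ Suc n) (indicator Bad))) \<le> 0"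
    using transfer_suminf[of "indicator Bad"] boundary_int_Bad by simp
  then have "line_int ((transfer_op ^^ Suc n) (indicator Bad)) = 0"
    using suminf_eq_zero_iff[of "\<lambda>n. line_int ((transfer_op ^^ Suc n) (indicator Bad))"] by auto
  then have "(\<integral>\<^sup>+z. (transfer_op ^^ Suc n) (indicator Bad) z \<partial>line_measure) = 0"
    by (subst (asm) line_int_eq) (auto intro: transfer_op_pow_meas simp del: funpow.simps)
  then have "AE z in line_measure. (transfer_op ^^ Suc n) (indicator Bad) z = 0"
    by (subst (asm) nn_integral_0_iff_AE) (use transfer_op_pow_meas[of "indicator Bad" "Suc n"] in \<open>auto simp del: funpow.simps\<close>)
  then show "AE z in line_measure. (\<forall>j<Suc n. (step ^^ j) z \<in> hitting) \<longrightarrow> (step ^^ Suc n) z \<notin> Bad"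
    unfolding transfer_op_pow by eventually_elim (auto split: if_splits simp del: funpow.simps)
qed

text \<open>Borel-Cantelli: with h = 1 the transfer inequality bounds the integrated number of
  collisions by the total boundary measure.\<close>

lemma AE_terminates: "AE z in line_measure. \<exists>n. (step ^^ n) z \<notin> hitting"
proof -
  have m: "(transfer_op ^^ n) (\<lambda>_. 1) \<in> borel_measurable borel" for n by (intro transfer_op_pow_meas) simp
  have "(\<integral>\<^sup>+z. (\<Sum>n. (transfer_op ^^ Suc n) (\<lambda>_. 1) z) \<partial>line_measure) = (\<Sum>n. \<integral>\<^sup>+z. (transfer_op ^^ Suc n) (\<lambda>_. 1) z \<partial>line_measure)"
    by (rule nn_integral_suminf) (use m in \<open>auto simp del: funpow.simps\<close>)
  also have "\<dots> = (\<Sum>n. line_int ((transfer_op ^^ Suc n) (\<lambda>_. 1)))"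
    by (simp only: line_int_eq[OF m])
  also have "\<dots> < \<infinity>" using transfer_suminf[of "\<lambda>_. 1"] boundary_int_1 by (auto intro: le_less_trans)
  finally have "AE z in line_measure. (\<Sum>n. (transfer_op ^^ Suc n) (\<lambda>_. 1) z) \<noteq> \<infinity>"
    by (intro nn_integral_PInf_AE) (use m in \<open>auto simp del: funpow.simps\<close>)
  then show ?thesis
  proof eventually_elim
    fix z assume fin: "(\<Sum>n. (transfer_op ^^ Suc n) (\<lambda>_. 1) z) \<noteq> \<infinity>"
    show "\<exists>n. (step ^^ n) z \<notin> hitting"
    proof (rule ccontr)
      assume "\<not> ?thesis"
      then have eq: "(\<Sum>n. (transfer_op ^^ Suc n) (\<lambda>_. 1) z) = (\<Sum>n. (1::ennreal))" unfolding transfer_op_pow by simp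
      then obtain N where "(\<Sum>n. (1::ennreal)) < of_nat N"
        using fin ennreal_Ex_less_of_nat[of "\<Sum>n. (1::ennreal)"] by (auto simp: less_top)
      moreover have "(\<Sum>n<N. (1::ennreal)) \<le> (\<Sum>n. 1)" by (rule sum_le_suminf) auto
      ultimately show False by simp
    qed
  qed
qed


section \<open>Deflection of lines\<close>


text \<open>A state outside \<open>hitting\<close> either meets C no more or has hit time 0, that
  is, it is stuck at the boundary; \<open>good_exits\<close> excludes the latter.\<close>

definition exit_time :: "pt \<times> pt \<Rightarrow> nat" where
  "exit_time z = (LEAST n. (step ^^ n) z \<notin> hitting)"

definition v_out :: "pt \<times> pt \<Rightarrow> pt" where
  "v_out z = snd ((step ^^ exit_time z) z)"

definition good :: "pt \<times> pt \<Rightarrow> bool" where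
  "good z \<longleftrightarrow> norm (snd z) = 1 \<and> (fst z - c) \<bullet> snd z = - \<rho> \<and> (\<exists>n. (step ^^ n) z \<notin> hitting) \<and>
     (\<forall>n. (\<forall>j<Suc n. (step ^^ j) z \<in> hitting) \<longrightarrow> (step ^^ Suc n) z \<notin> Bad)"

lemma v_out_meas [measurable]: "v_out \<in> borel_measurable borel"
proof -
  have [measurable]: "exit_time \<in> measurable borel (count_space UNIV)"
    unfolding exit_time_def by measurable
  have "(\<lambda>z. (step ^^ exit_time z) z) \<in> borel_measurable borel"
    by (rule measurable_compose_countable[where f="\<lambda>n z. (step ^^ n) z"]) measurable
  then show ?thesis unfolding v_out_def by measurable
qed

lemma good_meas [measurable]: "Measurable.pred borel good"
  proof -
  have [measurable]: "Measurable.pred borel (\<lambda>z. (step ^^ n) z \<in> X)" if [measurable]: "X \<in> sets borel" for n X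
    by measurable
  show ?thesis unfolding good_def by measurable
qed

lemma AE_good: "AE z in line_measure. good z"
proof -
  have "AE z in line_measure. norm (snd z) = 1 \<and> (fst z - c) \<bullet> snd z = - \<rho>"
    by (rule AE_line_measureI) (measurable, auto simp: start_inner)
  then show ?thesis using AE_not_bad AE_terminates unfolding good_def by eventually_elim auto
qed

lemma norm_snd_step: "norm (snd ((step ^^ n) z)) = norm (snd z)"
  by (induction n) (auto simp: step_def)

lemma good_before_exit: "good z \<Longrightarrow> j < exit_time z \<Longrightarrow> (step ^^ j) z \<in> hitting"
  unfolding exit_time_def using not_less_Least by blast

lemma good_at_exit: "good z \<Longrightarrow> (step ^^ exit_time z) z \<notin> hitting"
  unfolding exit_time_def good_def by (metis (mono_tags, lifting) LeastI)

text \<open>Followed backwards, the flight just completed shows that the point of impact is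
  accessible from the complement of C, which is what the regularity assumptions ask for.\<close>

lemma good_collision:
  assumes "good z" "j < exit_time z"
  defines "x \<equiv> fst ((step ^^ Suc j) z)" and "u \<equiv> snd ((step ^^ j) z)"
  shows "x \<in> G ` A" "x \<notin> N0" "cr (tn x) u \<noteq> 0" "\<exists>\<epsilon>>0. \<forall>t\<in>{0<..<\<epsilon>}. x + t *\<^sub>R (-u) \<notin> C"
    "snd ((step ^^ Suc j) z) = reflect_tangent (tn x) u"
proof -
  let ?z = "(step ^^ j) z"
  have z: "?z \<in> hitting" using good_before_exit assms by blast
  have x: "x = hit_point ?z" by (simp add: x_def step_def)
  show "snd ((step ^^ Suc j) z) = reflect_tangent (tn x) u" by (simp add: x u_def step_def)
  then have s: "snd (step ?z) = reflect_tangent (tn x) u" by simp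
  show "x \<in> G ` A" using hit_point_boundary[OF z] x by simp
  have "\<forall>i<Suc j. (step ^^ i) z \<in> hitting" using good_before_exit[OF assms(1)] assms(2) by simp
  then have "(step ^^ Suc j) z \<notin> Bad" using assms(1) unfolding good_def by blast
  then have "x \<notin> N0 \<and> cr (tn x) (snd (step ?z)) \<noteq> 0" unfolding Bad_def x_def by simp
  then show "x \<notin> N0" "cr (tn x) u \<noteq> 0" unfolding s cr_reflect by auto
  have "x + t *\<^sub>R (-u) \<notin> C" if "0 < t" "t < hit_time ?z" for t
  proof -
    have "x + t *\<^sub>R (-u) = fst ?z + (hit_time ?z - t) *\<^sub>R snd ?z" by (simp add: x u_def hit_point_def algebra_simps)
    then show ?thesis using hit_time_less[of "hit_time ?z - t" ?z] that by simp
  qed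
  moreover have "hit_time ?z > 0" using z by (simp add: hitting_def)
  ultimately show "\<exists>\<epsilon>>0. \<forall>t\<in>{0<..<\<epsilon>}. x + t *\<^sub>R (-u) \<notin> C" by auto
qed

lemma start_outgoing:
  assumes "norm (snd z) = 1" "(fst z - c) \<bullet> snd z = - \<rho>" "t < 1"
  shows "fst z + t *\<^sub>R snd z \<notin> C"
  using inner_ray[OF assms(1), of "fst z" t] in_C_inner[OF _ assms(1), of "fst z + t *\<^sub>R snd z"] assms by (force simp: \<rho>_def)

text \<open>The reflected velocity points to the same side of the tangent as the reversed incoming
  velocity, so by \<open>reg\<close> it leads out of C at first. A further hit would then have a
  positive hit time.\<close>

lemma good_exits: assumes "good z" shows "\<not> hits ((step ^^ exit_time z) z)"
proof
  let ?N = "exit_time z" let ?z = "(step ^^ ?N) z"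
  assume hits: "hits ?z"
  have "\<exists>\<epsilon>>0. \<forall>t\<in>{0<..<\<epsilon>}. fst ?z + t *\<^sub>R snd ?z \<notin> C"
  proof (cases ?N)
    case 0
    then show ?thesis using start_outgoing[of z] assms unfolding good_def by (intro exI[of _ 1]) auto
  next
    case (Suc k)
    let ?x = "fst ((step ^^ Suc k) z)" and ?u = "snd ((step ^^ k) z)"
    have "k < exit_time z" using Suc by simp
    note gc = good_collision[OF assms this]
    have "cr (tn ?x) (reflect_tangent (tn ?x) ?u) * cr (tn ?x) (- ?u) = (cr (tn ?x) ?u)\<^sup>2"
      unfolding cr_reflect by (simp add: cr_def power2_eq_square algebra_simps)
    then have "cr (tn ?x) (reflect_tangent (tn ?x) ?u) * cr (tn ?x) (- ?u) > 0" using gc(3) by simp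
    from reg[OF gc(1,2,4) this] show ?thesis unfolding Suc gc(5) .
  qed
  then obtain \<epsilon> where "\<epsilon> > 0" "\<And>t. 0 < t \<Longrightarrow> t < \<epsilon> \<Longrightarrow> fst ?z + t *\<^sub>R snd ?z \<notin> C" by auto
  then have "hit_time ?z > 0" using hit_time_ge[OF hits, of \<epsilon>] by force
  then show False using good_at_exit[OF assms] hits by (simp add: hitting_def)
qed

text \<open>Projected to the initial direction, every flight advances by at most its length. The
  last flight is measured along the final direction instead; exchanging the directions at the last
  point of impact, which lies within R of c, costs R times their distance. Lines missing C need no
  correction, which later keeps the estimate in terms of R rather than \<rho>.\<close>

lemma total_length:
  assumes "good z"
  shows "2 * \<rho> \<le> (\<Sum>n\<le>exit_time z. len ((step ^^ n) z)) + (if hits z then R * norm (snd z - v_out z) else 0)"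
proof -
  let ?N = "exit_time z" and ?v = "snd z"
  have v: "norm ?v = 1" and st: "(fst z - c) \<bullet> ?v = - \<rho>" using assms by (auto simp: good_def)
  \<comment> \<open>Progress along the initial direction up to the n-th collision.\<close>
  have path: "(fst ((step ^^ n) z) - fst z) \<bullet> ?v \<le> (\<Sum>j<n. len ((step ^^ j) z))" if "n \<le> ?N" for n
    using that
  proof (induction n)
    case (Suc n)
    let ?z = "(step ^^ n) z"
    have z: "?z \<in> hitting" using good_before_exit[OF assms] Suc by simp
    have "fst ((step ^^ Suc n) z) = fst ?z + hit_time ?z *\<^sub>R snd ?z" by (simp add: step_def hit_point_def)
    then have "(fst ((step ^^ Suc n) z) - fst z) \<bullet> ?v = (fst ?z - fst z) \<bullet> ?v + hit_time ?z * (snd ?z \<bullet> ?v)"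
      by (simp add: inner_diff_left inner_add_left)
    moreover have "snd ?z \<bullet> ?v \<le> 1" using norm_cauchy_schwarz[of "snd ?z" ?v] v by (simp add: norm_snd_step)
    then have "hit_time ?z * (snd ?z \<bullet> ?v) \<le> hit_time ?z" using z by (simp add: hitting_def mult_left_le)
    moreover have "len ?z = hit_time ?z" using z by (simp add: hitting_def len_def)
    ultimately show ?case using Suc by simp
  qed simp
  let ?zN = "(step ^^ ?N) z"
  have lenN: "len ?zN \<ge> \<rho> - (fst ?zN - c) \<bullet> v_out z" using good_exits[OF assms] by (simp add: len_def v_out_def)
  have sum: "(\<Sum>n\<le>?N. len ((step ^^ n) z)) = (\<Sum>n<?N. len ((step ^^ n) z)) + len ?zN"
    by (simp add: lessThan_Suc_atMost[symmetric])
  show ?thesis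
  proof (cases ?N)
    case 0
    then have "v_out z = ?v" by (simp add: v_out_def)
    then show ?thesis using 0 sum lenN st R_pos by simp
  next
    case (Suc k)
    have "fst ?zN \<in> C" using good_collision(1)[OF assms, of k] Suc G_C by auto
    then have "norm (fst ?zN - c) \<le> R" by (rule in_C)
    have "- (R * norm (?v - v_out z)) \<le> (fst ?zN - c) \<bullet> (?v - v_out z)"
      using Cauchy_Schwarz_ineq2[of "fst ?zN - c" "?v - v_out z"] mult_right_mono[OF \<open>norm (fst ?zN - c) \<le> R\<close>, of "norm (?v - v_out z)"] by simp
    moreover have "hits z" using good_before_exit[OF assms, of 0] Suc by (simp add: hitting_def)
    moreover have "(fst ?zN - fst z) \<bullet> ?v = (fst ?zN - c) \<bullet> ?v + \<rho>" using st by (simp add: inner_diff_left)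
    ultimately show ?thesis using path[of ?N] lenN sum by (simp add: inner_diff_right)
  qed
qed

definition resist :: "pt \<times> pt \<Rightarrow> real" where
  "resist z = 1 - snd z \<bullet> v_out z"

lemma resist_meas [measurable]: "resist \<in> borel_measurable borel"
  unfolding resist_def by measurable

lemma resist_norm: "good z \<Longrightarrow> (norm (snd z - v_out z))\<^sup>2 = 2 * resist z"
proof -
  assume z: "good z"
  then have "norm (snd z) = 1" "norm (v_out z) = 1" by (auto simp: v_out_def norm_snd_step good_def)
  then have "snd z \<bullet> snd z = 1" "v_out z \<bullet> v_out z = 1" by (simp_all add: norm_eq_1)
  then show ?thesis by (simp add: resist_def power2_norm_eq_inner inner_diff inner_commute)
qed

lemma emeasure_line_measure: "emeasure line_measure UNIV = ennreal (4 * pi * \<rho>)"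
proof -
  have "emeasure line_measure UNIV = line_int (\<lambda>_. 1)" by (subst line_int_eq) auto
  also have "\<dots> = ennreal (4 * pi * \<rho>)"
  proof -
    have "\<rho> > 0" using R_pos by (simp add: \<rho>_def)
    then show ?thesis unfolding line_int_def by (simp add: emeasure_circ ennreal_mult[symmetric] mult_ac del: ennreal_plus)
  qed
  finally show ?thesis .
qed

text \<open>A line that meets C has offset at most R, so its measure does not feel the margin in
  \<rho>.\<close>

lemma line_int_hits: "(\<integral>\<^sup>+z. indicator {z. hits z} z \<partial>line_measure) \<le> ennreal (4 * pi * R)"
proof -
  have "(\<integral>\<^sup>+z. indicator {z. hits z} z \<partial>line_measure) = line_int (indicator {z. hits z})" by (rule line_int_eq[symmetric]) measurable
  also have "\<dots> \<le> (\<integral>\<^sup>+v. \<integral>\<^sup>+p. indicator {-R..R} p \<partial>lborel \<partial>circ)"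
    unfolding line_int_def
  proof (intro nn_integral_circ_mono nn_integral_mono)
    fix v :: pt and p :: real assume v: "norm v = 1"
    have "\<bar>p\<bar> \<le> R" if h: "hits (start p v, v)"
    proof -
      obtain t where "start p v + t *\<^sub>R v \<in> C" using h by (auto simp: hits_def)
      moreover have "norm (rot v) = 1" using v by (simp add: norm_eq_sqrt_inner norm_rot)
      ultimately have "\<bar>(start p v + t *\<^sub>R v - c) \<bullet> rot v\<bar> \<le> R" using in_C_inner by blast
      moreover have "(start p v + t *\<^sub>R v - c) \<bullet> rot v = p"
        using start_rot[OF v, of p] by (simp add: inner_diff_left inner_add_left rot_inner)
      ultimately show ?thesis by simp
    qed
    then show "(indicator {- \<rho><..<\<rho>} p * indicator {z. hits z} (start p v, v) :: ennreal) \<le> indicator {-R..R} p"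
      by (auto simp: indicator_def)
  qed
  also have "\<dots> = ennreal (4 * pi * R)"
    using R_pos by (simp add: emeasure_circ ennreal_mult[symmetric] mult_ac)
  finally show ?thesis .
qed

text \<open>\<open>total_length\<close> is integrated over all lines. The straight crossings
  contribute 2\<rho> times 4 pi \<rho>, exactly the phase volume 2 pi times 4\<rho>^2 of the
  squares, so everything depending on \<rho> cancels and 2 pi times the area of C remains.\<close>

lemma integral_deflection:
  "ennreal (2 * pi * measure lebesgue C) \<le> ennreal R * (\<integral>\<^sup>+z. indicator {z. hits z} z * ennreal (norm (snd z - v_out z)) \<partial>line_measure)"
proof -
  let ?h = "\<lambda>z. ennreal (len z)"
  let ?X = "\<integral>\<^sup>+z. indicator {z. hits z} z * ennreal (norm (snd z - v_out z)) \<partial>line_measure"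
  have m: "(transfer_op ^^ n) ?h \<in> borel_measurable borel" for n by (intro transfer_op_pow_meas) measurable
  have \<rho>: "\<rho> > 0" using R_pos by (simp add: \<rho>_def)
  have Cm: "emeasure lebesgue C = ennreal (measure lebesgue C)"
    using C_compact by (intro emeasure_eq_measure2 lmeasurable_compact)
  have "ennreal (2 * \<rho>) * emeasure line_measure UNIV = (\<integral>\<^sup>+z. ennreal (2 * \<rho>) \<partial>line_measure)" by simp
  also have "\<dots> \<le> (\<integral>\<^sup>+z. (\<Sum>n. (transfer_op ^^ n) ?h z) + ennreal R * (indicator {z. hits z} z * ennreal (norm (snd z - v_out z))) \<partial>line_measure)"
  proof (rule nn_integral_mono_AE, use AE_good in eventually_elim)
    fix z assume z: "good z"
    have "ennreal (2 * \<rho>) \<le> ennreal ((\<Sum>n\<le>exit_time z. len ((step ^^ n) z)) + (if hits z then R * norm (snd z - v_out z) else 0))"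
      by (rule ennreal_leI[OF total_length[OF z]])
    also have "\<dots> = (\<Sum>n\<le>exit_time z. ?h ((step ^^ n) z)) + ennreal R * (indicator {z. hits z} z * ennreal (norm (snd z - v_out z)))"
      using R_pos by (subst ennreal_plus) (auto intro!: sum_nonneg len_nonneg simp: sum_ennreal ennreal_mult len_nonneg)
    also have "(\<Sum>n\<le>exit_time z. ?h ((step ^^ n) z)) = (\<Sum>n\<le>exit_time z. (transfer_op ^^ n) ?h z)"
      using good_before_exit[OF z] by (intro sum.cong) (auto simp: transfer_op_pow)
    also have "\<dots> \<le> (\<Sum>n. (transfer_op ^^ n) ?h z)" by (rule sum_le_suminf) auto
    finally show "ennreal (2 * \<rho>) \<le> (\<Sum>n. (transfer_op ^^ n) ?h z) + ennreal R * (indicator {z. hits z} z * ennreal (norm (snd z - v_out z)))"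
      by (simp add: add_right_mono)
  qed
  also have "\<dots> = (\<Sum>n. line_int ((transfer_op ^^ n) ?h)) + ennreal R * ?X"
    using m by (subst nn_integral_add) (auto simp: nn_integral_suminf nn_integral_cmult line_int_eq[OF m])
  also have "(\<Sum>n. line_int ((transfer_op ^^ n) ?h)) = line_int ?h + (\<Sum>n. line_int ((transfer_op ^^ Suc n) ?h))"
    using suminf_offset[of "\<lambda>n. line_int ((transfer_op ^^ n) ?h)" 1] by (simp add: add.commute)
  also have "\<dots> \<le> line_int ?h + boundary_int ?h"
    by (intro add_left_mono transfer_suminf) measurable
  also have "\<dots> \<le> ennreal (2 * pi) * (ennreal (4 * \<rho>\<^sup>2) - emeasure lebesgue C)" by (rule volume_ineq)
  finally have *: "ennreal (2 * \<rho>) * ennreal (4 * pi * \<rho>) \<le> ennreal (2 * pi) * (ennreal (4 * \<rho>\<^sup>2) - ennreal (measure lebesgue C)) + ennreal R * ?X"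
    unfolding emeasure_line_measure Cm by (simp add: add_right_mono)
  show ?thesis
  proof (cases "?X = top")
    case True then show ?thesis using R_pos by (simp add: ennreal_mult_top)
  next
    case False
    then obtain X where X: "?X = ennreal X" "X \<ge> 0" by (cases ?X) auto
    \<comment> \<open>Subtraction of \<open>ennreal\<close> truncates at 0; this inequality makes
      the difference a genuine one, so that the estimate can be rearranged over the reals.\<close>
    have le: "measure lebesgue C \<le> 4 * \<rho>\<^sup>2"
    proof -
      let ?v = "unit_vec 0"
      have v: "norm ?v = 1" by simp
      have "C \<subseteq> strip ?v" by (rule C_strip[OF v])
      then have "emeasure lebesgue C \<le> emeasure lebesgue (strip ?v)"
        using emeasure_strip_box(2)[OF v] by (intro emeasure_mono) (auto simp: fmeasurable_def)
      then show ?thesis unfolding Cm emeasure_strip_box(1)[OF v] by simp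
    qed
    have "2 * \<rho> * (4 * pi * \<rho>) \<le> 2 * pi * (4 * \<rho>\<^sup>2 - measure lebesgue C) + R * X"
      using * \<rho> R_pos le X(2) unfolding X(1) by (simp add: ennreal_mult[symmetric] ennreal_minus ennreal_plus[symmetric] del: ennreal_plus)
    then have "2 * pi * measure lebesgue C \<le> R * X" by (simp add: algebra_simps power2_eq_square)
    then show ?thesis using X R_pos by (simp add: ennreal_mult[symmetric] ennreal_leI)
  qed
qed

lemma resistance_lines:
  assumes "measure lebesgue C > 0"
  shows "ennreal (pi / 2 * (measure lebesgue C)\<^sup>2 / R^3) \<le> (\<integral>\<^sup>+z. ennreal (resist z) \<partial>line_measure)"
proof (cases "(\<integral>\<^sup>+z. ennreal (resist z) \<partial>line_measure) = top")
  case False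
  then obtain Q where Q: "(\<integral>\<^sup>+z. ennreal (resist z) \<partial>line_measure) = ennreal Q" "Q \<ge> 0" by (cases "\<integral>\<^sup>+z. ennreal (resist z) \<partial>line_measure") auto
  define m where "m = measure lebesgue C"
  \<comment> \<open>Cauchy-Schwarz enters as d <= \<alpha>/2 + d^2/(2\<alpha>). This \<alpha>
    maximises the resulting lower bound (2 pi m / R - 2 pi R \<alpha>) \<alpha> for Q.\<close>
  define \<alpha> where "\<alpha> = m / (2 * R\<^sup>2)"
  have \<alpha>: "\<alpha> > 0" using assms R_pos by (simp add: \<alpha>_def m_def)
  have "(\<integral>\<^sup>+z. indicator {z. hits z} z * ennreal (norm (snd z - v_out z)) \<partial>line_measure) \<le>
    (\<integral>\<^sup>+z. ennreal (\<alpha>/2) * indicator {z. hits z} z + ennreal (1/\<alpha>) * ennreal (resist z) \<partial>line_measure)"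
  proof (rule nn_integral_mono_AE, use AE_good in eventually_elim)
    fix z assume z: "good z"
    let ?d = "norm (snd z - v_out z)"
    have "0 \<le> (?d - \<alpha>)\<^sup>2" by simp
    then have "2 * \<alpha> * ?d \<le> ?d\<^sup>2 + \<alpha>\<^sup>2" by (simp add: power2_diff algebra_simps)
    then have "?d \<le> \<alpha>/2 + resist z / \<alpha>" using \<alpha> resist_norm[OF z] by (simp add: field_simps power2_eq_square)
    moreover have "resist z \<ge> 0" using resist_norm[OF z] by (metis zero_le_power2 zero_le_mult_iff not_numeral_le_zero zero_le_numeral)
    ultimately have "ennreal ?d \<le> ennreal (\<alpha>/2) + ennreal (1/\<alpha>) * ennreal (resist z)"
      using \<alpha> by (simp add: ennreal_mult[symmetric] ennreal_plus[symmetric] ennreal_leI del: ennreal_plus)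
    then show "indicator {z. hits z} z * ennreal ?d \<le> ennreal (\<alpha>/2) * indicator {z. hits z} z + ennreal (1/\<alpha>) * ennreal (resist z)"
      by (auto simp: indicator_def)
  qed
  also have "\<dots> = ennreal (\<alpha>/2) * (\<integral>\<^sup>+z. indicator {z. hits z} z \<partial>line_measure) + ennreal (1/\<alpha>) * ennreal Q"
    unfolding Q(1)[symmetric] by (subst nn_integral_add) (auto simp: nn_integral_cmult simp del: nn_integral_indicator)
  also have "\<dots> \<le> ennreal (\<alpha>/2) * ennreal (4 * pi * R) + ennreal (1/\<alpha>) * ennreal Q"
    by (intro add_right_mono mult_left_mono line_int_hits) simp
  also have "\<dots> = ennreal (2 * pi * R * \<alpha> + Q / \<alpha>)"
    using \<alpha> Q(2) R_pos by (simp add: ennreal_mult[symmetric] ennreal_plus[symmetric] mult_ac del: ennreal_plus)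
  finally have "ennreal (2 * pi * m) \<le> ennreal R * ennreal (2 * pi * R * \<alpha> + Q / \<alpha>)"
    using integral_deflection unfolding m_def by (meson mult_left_mono order_trans zero_le)
  then have "2 * pi * m \<le> R * (2 * pi * R * \<alpha> + Q / \<alpha>)"
    using R_pos \<alpha> Q(2) by (simp add: ennreal_mult[symmetric] del: ennreal_plus)
  then have "\<alpha> * (2 * pi * m) \<le> \<alpha> * (R * (2 * pi * R * \<alpha> + Q / \<alpha>))" using \<alpha> by (intro mult_left_mono) auto
  also have "\<alpha> * (R * (2 * pi * R * \<alpha> + Q / \<alpha>)) = 2 * pi * R\<^sup>2 * \<alpha>\<^sup>2 + R * Q" using \<alpha> by (simp add: field_simps power2_eq_square)
  finally have "pi * m\<^sup>2 / (2 * R\<^sup>2) \<le> R * Q" unfolding \<alpha>_def using R_pos by (simp add: field_simps power2_eq_square)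
  then have "pi / 2 * m\<^sup>2 / R^3 \<le> Q" using R_pos by (simp add: field_simps power2_eq_square power3_eq_cube)
  then show ?thesis unfolding Q(1) m_def by (rule ennreal_leI)
qed simp

end

section \<open>Trajectories\<close>

lemma has_real_derivative_nth:
  assumes "(\<gamma> has_vector_derivative \<tau>) (at a within S)"
  shows "((\<lambda>t. (\<gamma> t :: pt) $ i) has_real_derivative \<tau> $ i) (at a within S)"
  unfolding has_real_derivative_iff_has_vector_derivative
  by (rule bounded_linear.has_vector_derivative[OF bounded_linear_vec_nth assms])

lemma quotient_limit:
  assumes "(\<gamma> has_vector_derivative \<tau>) (at a)" "s \<longlonglongrightarrow> a" "\<And>n::nat. s n \<noteq> a"
  shows "(\<lambda>n. ((\<gamma> (s n) :: pt) $ i - \<gamma> a $ i) / (s n - a)) \<longlonglongrightarrow> \<tau> $ i"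
proof -
  have "((\<lambda>t. (\<gamma> t $ i - \<gamma> a $ i) / (t - a)) \<longlongrightarrow> \<tau> $ i) (at a)"
    using has_real_derivative_nth[OF assms(1)] by (simp add: has_field_derivative_iff)
  then show ?thesis by (rule filterlim_compose) (use assms in \<open>auto simp: filterlim_at\<close>)
qed

text \<open>At common points the increments of both curves coincide, so the cross product of their
  difference quotients vanishes; the limit is the cross product of the derivatives.\<close>

lemma parallel_limit:
  assumes d1: "(\<gamma>1 has_vector_derivative \<tau>1) (at a)" and d2: "(\<gamma>2 has_vector_derivative \<tau>2) (at b)"
    and s: "s \<longlonglongrightarrow> a" "\<And>n::nat. s n \<noteq> a" and t: "t \<longlonglongrightarrow> b" "\<And>n. t n \<noteq> b"
    and eq: "\<And>n. \<gamma>1 (s n) = \<gamma>2 (t n)" "\<gamma>1 a = \<gamma>2 b"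
  shows "cr \<tau>1 \<tau>2 = 0"
proof -
  have "(\<lambda>n. (\<gamma>1 (s n) $ 1 - \<gamma>1 a $ 1) / (s n - a) * ((\<gamma>2 (t n) $ 2 - \<gamma>2 b $ 2) / (t n - b)) -
    (\<gamma>1 (s n) $ 2 - \<gamma>1 a $ 2) / (s n - a) * ((\<gamma>2 (t n) $ 1 - \<gamma>2 b $ 1) / (t n - b))) \<longlonglongrightarrow> cr \<tau>1 \<tau>2"
    unfolding cr_def by (intro tendsto_intros quotient_limit[OF d1 s] quotient_limit[OF d2 t])
  then show ?thesis unfolding eq by (simp add: LIMSEQ_const_iff)
qed

lemma parallel_scale:
  assumes "cr \<tau>1 \<tau>2 = 0" "\<tau>1 \<noteq> 0" "\<tau>2 \<noteq> 0"
  obtains k where "k \<noteq> 0" "\<tau>2 = k *\<^sub>R \<tau>1"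
proof -
  define k where "k = (\<tau>1 \<bullet> \<tau>2) / (\<tau>1 \<bullet> \<tau>1)"
  have 0: "\<tau>1 \<bullet> \<tau>1 \<noteq> 0" using assms by simp
  have "(\<tau>1 \<bullet> \<tau>1) *\<^sub>R \<tau>2 = (\<tau>1 \<bullet> \<tau>2) *\<^sub>R \<tau>1"
  proof -
    have 1: "\<tau>1$1 * \<tau>2$2 = \<tau>1$2 * \<tau>2$1" using assms(1) by (simp add: cr_def)
    have "(\<tau>1$1 * \<tau>1$1 + \<tau>1$2 * \<tau>1$2) * \<tau>2$1 = (\<tau>1$1 * \<tau>2$1 + \<tau>1$2 * \<tau>2$2) * \<tau>1$1"
      using 1 by algebra
    moreover have "(\<tau>1$1 * \<tau>1$1 + \<tau>1$2 * \<tau>1$2) * \<tau>2$2 = (\<tau>1$1 * \<tau>2$1 + \<tau>1$2 * \<tau>2$2) * \<tau>1$2"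
      using 1 by algebra
    ultimately show ?thesis unfolding vector2_eq_iff by (simp add: inner2)
  qed
  then have "(1 / (\<tau>1 \<bullet> \<tau>1)) *\<^sub>R ((\<tau>1 \<bullet> \<tau>1) *\<^sub>R \<tau>2) = (1 / (\<tau>1 \<bullet> \<tau>1)) *\<^sub>R ((\<tau>1 \<bullet> \<tau>2) *\<^sub>R \<tau>1)" by simp
  then have "\<tau>2 = k *\<^sub>R \<tau>1" using 0 by (simp add: k_def)
  moreover then have "k \<noteq> 0" using assms by auto
  ultimately show ?thesis using that by blast
qed

lemma reflect_scale: "k \<noteq> 0 \<Longrightarrow> reflect_tangent (k *\<^sub>R \<tau>) u = reflect_tangent \<tau> u"
  unfolding reflect_tangent_def by simp

lemma C1_has_vector_derivative:
  "\<gamma> C1_differentiable_on S \<Longrightarrow> t \<in> S \<Longrightarrow> (\<gamma> has_vector_derivative vector_derivative \<gamma> (at t)) (at t)"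
  unfolding C1_differentiable_on_def by (metis vector_derivative_at)

lemma C1_continuous_on: "\<gamma> C1_differentiable_on S \<Longrightarrow> continuous_on S \<gamma>"
  by (rule C1_differentiable_imp_continuous_on)

text \<open>\<open>boundary_tangent\<close> admits many curves, so determinism of the motion needs
  this. Points of one curve tending to p lie on the other; the inverse of an injective curve on a
  compact interval is continuous, so their parameters there tend to 0 and the tangents are parallel.
  A reflection depends only on the tangent line.\<close>

lemma reflect_unique:
  assumes "boundary_tangent D p \<tau>1" "boundary_tangent D p \<tau>2"
  shows "reflect_tangent \<tau>1 u = reflect_tangent \<tau>2 u"
proof -
  let ?I = "{-1..1::real}"
  obtain \<gamma>1 e1 where 1: "\<tau>1 \<noteq> 0" "e1 > 0" "\<gamma>1 C1_differentiable_on ?I" "inj_on \<gamma>1 ?I" "\<gamma>1 0 = p"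
    "vector_derivative \<gamma>1 (at 0) = \<tau>1" "frontier D \<inter> ball p e1 = \<gamma>1 ` ?I \<inter> ball p e1"
    using assms(1) unfolding boundary_tangent_def by auto
  obtain \<gamma>2 e2 where 2: "\<tau>2 \<noteq> 0" "e2 > 0" "\<gamma>2 C1_differentiable_on ?I" "inj_on \<gamma>2 ?I" "\<gamma>2 0 = p"
    "vector_derivative \<gamma>2 (at 0) = \<tau>2" "frontier D \<inter> ball p e2 = \<gamma>2 ` ?I \<inter> ball p e2"
    using assms(2) unfolding boundary_tangent_def by auto
  have d1: "(\<gamma>1 has_vector_derivative \<tau>1) (at 0)" using C1_has_vector_derivative[OF 1(3), of 0] 1 by simp
  have d2: "(\<gamma>2 has_vector_derivative \<tau>2) (at 0)" using C1_has_vector_derivative[OF 2(3), of 0] 2 by simp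
  have c1: "continuous_on ?I \<gamma>1" using 1 by (intro C1_continuous_on)
  define e where "e = min e1 e2"
  have "isCont \<gamma>2 0" using d2 by (rule has_vector_derivative_continuous)
  moreover have "e > 0" using 1 2 by (simp add: e_def)
  ultimately obtain d where d: "d > 0" "\<And>x. dist x 0 < d \<Longrightarrow> dist (\<gamma>2 x) (\<gamma>2 0) < e"
    unfolding continuous_at_eps_delta by blast
  define t where "t n = min d 1 / (real n + 2)" for n
  have t0: "t n > 0" "t n < d" "t n \<le> 1" for n
  proof -
    have "min d 1 / (real n + 2) < min d 1 / 1" using d by (intro divide_strict_left_mono) auto
    then show "t n > 0" "t n < d" "t n \<le> 1" using d by (auto simp: t_def)
  qed
  have tlim: "t \<longlonglongrightarrow> 0" 
  proof -
    have "(\<lambda>n. min d 1 * inverse (real (Suc (Suc n)))) \<longlonglongrightarrow> min d 1 * 0"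
      by (rule tendsto_mult[OF tendsto_const LIMSEQ_Suc[OF LIMSEQ_inverse_real_of_nat]])
    then show ?thesis by (simp add: t_def[abs_def] divide_inverse add.commute)
  qed
  have "\<gamma>2 (t n) \<in> \<gamma>1 ` ?I" for n
  proof -
    have "\<gamma>2 (t n) \<in> ball p e" using d(2)[of "t n"] t0[of n] 2(5) by (simp add: dist_commute)
    moreover have "\<gamma>2 (t n) \<in> \<gamma>2 ` ?I" using t0[of n] by auto
    ultimately have "\<gamma>2 (t n) \<in> frontier D \<inter> ball p e2" unfolding 2(7) by (simp add: e_def)
    then have "\<gamma>2 (t n) \<in> frontier D \<inter> ball p e1" using \<open>\<gamma>2 (t n) \<in> ball p e\<close> by (simp add: e_def)
    then show ?thesis unfolding 1(7) by simp
  qed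
  then have inI: "\<gamma>2 (t n) \<in> \<gamma>1 ` ?I" for n .
  define s where "s n = inv_into ?I \<gamma>1 (\<gamma>2 (t n))" for n
  have s: "\<gamma>1 (s n) = \<gamma>2 (t n)" "s n \<in> ?I" for n
    using f_inv_into_f[OF inI] inv_into_into[OF inI] by (simp_all add: s_def)
  have ci: "continuous_on (\<gamma>1 ` ?I) (inv_into ?I \<gamma>1)"
    by (rule continuous_on_inv[OF c1]) (use 1(4) in auto)
  have lim: "(\<lambda>n. \<gamma>2 (t n)) \<longlonglongrightarrow> p"
    using isCont_tendsto_compose[OF \<open>isCont \<gamma>2 0\<close> tlim] 2(5) by simp
  have pin: "p \<in> \<gamma>1 ` ?I" using 1(5) by (intro image_eqI[of _ _ 0]) auto
  have "(\<lambda>n. inv_into ?I \<gamma>1 (\<gamma>2 (t n))) \<longlonglongrightarrow> inv_into ?I \<gamma>1 p"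
    by (rule continuous_on_tendsto_compose[OF ci lim pin]) (use inI in simp)
  moreover have "inv_into ?I \<gamma>1 p = 0" using inv_into_f_f[OF 1(4), of 0] 1(5) by simp
  ultimately have slim: "s \<longlonglongrightarrow> 0" by (simp add: s_def[abs_def])
  have "s n \<noteq> 0" for n
  proof
    assume "s n = 0"
    then have "\<gamma>2 (t n) = \<gamma>2 0" using s[of n] 1(5) 2(5) by simp
    then have "t n = 0" using 2(4) t0[of n] by (auto dest: inj_onD)
    then show False using t0[of n] by simp
  qed
  then have "cr \<tau>1 \<tau>2 = 0"
    using t0 1(5) 2(5) s(1) by (intro parallel_limit[OF d1 d2 slim _ tlim]) (auto simp: less_imp_neq[symmetric])
  then obtain k where "k \<noteq> 0" "\<tau>2 = k *\<^sub>R \<tau>1" using parallel_scale 1 2 by metis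
  then show ?thesis by (simp add: reflect_scale)
qed

lemma billiard_exit_norm:
  assumes "billiard_exit D \<xi> v w" shows "norm w = norm v"
proof -
  obtain n x u where *: "u 0 = v" "u n = w" "\<And>i. i < n \<Longrightarrow> \<exists>\<tau>. u (Suc i) = reflect_tangent \<tau> (u i)"
    using assms unfolding billiard_exit_def by blast
  have "norm (u i) = norm v" if "i \<le> n" for i
    using that by (induction i) (use * in \<open>auto simp: Suc_le_eq dest!: *(3)\<close>)
  then show ?thesis using * by blast
qed

text \<open>A starting point matters only through its oriented line, as long as it lies in front of
  the closure. This allows points of a reference circle to be exchanged for the starting points of
  lines.\<close>

lemma billiard_exit_slide:
  assumes be: "billiard_exit D \<xi> v w" and \<xi>': "\<xi>' = \<xi> + a *\<^sub>R v"
    and out: "\<And>t. t \<le> 0 \<Longrightarrow> \<xi> + t *\<^sub>R v \<notin> closure D" "\<And>t. t \<le> 0 \<Longrightarrow> \<xi>' + t *\<^sub>R v \<notin> closure D"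
  shows "billiard_exit D \<xi>' v w"
proof -
  obtain n x u where x: "x 0 = \<xi>" "u 0 = v" "u n = w"
    and st: "\<And>i. i < n \<Longrightarrow> (\<exists>t>0. x (Suc i) = x i + t *\<^sub>R u i) \<and>
               open_segment (x i) (x (Suc i)) \<inter> closure D = {} \<and>
               x (Suc i) \<in> frontier D \<and>
               (\<exists>\<tau>. boundary_tangent D (x (Suc i)) \<tau> \<and> u (Suc i) = reflect_tangent \<tau> (u i))"
    and fin: "\<And>s. s > 0 \<Longrightarrow> x n + s *\<^sub>R u n \<notin> closure D"
    using be unfolding billiard_exit_def by blast
  define x' where "x' = x(0 := \<xi>')"
  have x'S: "x' (Suc i) = x (Suc i)" for i by (simp add: x'_def)
  have st': "(\<exists>t>0. x' (Suc i) = x' i + t *\<^sub>R u i) \<and>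
               open_segment (x' i) (x' (Suc i)) \<inter> closure D = {} \<and>
               x' (Suc i) \<in> frontier D \<and>
               (\<exists>\<tau>. boundary_tangent D (x' (Suc i)) \<tau> \<and> u (Suc i) = reflect_tangent \<tau> (u i))" if i: "i < n" for i
  proof (cases i)
    case (Suc k) then show ?thesis using st[OF i] by (simp add: x'_def)
  next
    case 0
    then obtain t where t: "t > 0" "x 1 = \<xi> + t *\<^sub>R v" using st[OF i] x by auto
    have xC: "x 1 \<in> closure D" using st[OF i] 0 by (auto simp: frontier_def)
    have x1: "x 1 = \<xi>' + (t - a) *\<^sub>R v" using t \<xi>' by (simp add: algebra_simps)
    have ta: "t - a > 0" using out(2)[of "t-a"] xC x1 by force
    have "y \<notin> closure D" if "y \<in> open_segment \<xi>' (x 1)" for y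
    proof
      assume y: "y \<in> closure D"
      from that have "\<exists>q. 0 < q \<and> q < 1 \<and> y = (1 - q) *\<^sub>R \<xi>' + q *\<^sub>R x 1" by (simp only: in_segment(2))
      then obtain q where q: "0 < q" "q < 1" "y = (1 - q) *\<^sub>R \<xi>' + q *\<^sub>R x 1" by (elim exE conjE)
      have y1: "y = \<xi> + (a + q * (t - a)) *\<^sub>R v" unfolding q(3) x1 \<xi>' by (simp add: algebra_simps)
      have pos: "a + q * (t - a) > 0" using out(1)[of "a + q * (t-a)"] y y1 by force
      have less: "a + q * (t - a) < t"
      proof -
        have "q * (t - a) < 1 * (t - a)" using q ta by (intro mult_strict_right_mono) auto
        then show ?thesis by simp
      qed
      define r where "r = (a + q * (t - a)) / t"
      have r: "0 < r" "r < 1" "a + q * (t - a) = r * t" using pos less t by (auto simp: r_def)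
      have "y = (1 - r) *\<^sub>R \<xi> + r *\<^sub>R x 1" unfolding y1 r(3) t(2) by (simp add: algebra_simps)
      moreover have "\<xi> \<noteq> x 1" using out(1)[of 0] xC by auto
      ultimately have "y \<in> open_segment \<xi> (x 1)" using r by (auto simp: in_segment)
      then show False using st[OF i] 0 x y by auto
    qed
    then have "open_segment (x' i) (x' (Suc i)) \<inter> closure D = {}" using 0 by (auto simp: x'_def)
    moreover have "\<exists>t'>0. x' (Suc i) = x' i + t' *\<^sub>R u i"
      using 0 x1 ta x by (intro exI[of _ "t - a"]) (auto simp: x'_def)
    ultimately show ?thesis using st[OF i] unfolding x'S by blast
  qed
  have fin': "x' n + s *\<^sub>R u n \<notin> closure D" if "s > 0" for s
  proof (cases n)
    case 0
    show ?thesis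
    proof (cases "a + s \<le> 0")
      case True
      then show ?thesis using out(1)[of "a+s"] 0 x \<xi>' by (simp add: x'_def algebra_simps)
    next
      case False
      then show ?thesis using fin[of "a+s"] 0 x \<xi>' by (simp add: x'_def algebra_simps)
    qed
  next
    case (Suc k) then show ?thesis using fin[OF that] by (simp add: x'_def)
  qed
  show ?thesis unfolding billiard_exit_def
    using st' fin' x by (intro exI[of _ n] exI[of _ x'] exI[of _ u]) (auto simp: x'_def)
qed


text \<open>The obstacle is now the closure of D. The tangent is prescribed up to a factor because
  the local curves in \<open>boundary_tangent\<close> live on [-1, 1] and have to be
  reparametrised.\<close>

locale domain_billiard = billiard "closure D" A G tn N0 c R M
  for D :: "pt set" and A G tn N0 c R M +
  assumes boundary_G: "G ` A = frontier D"
    and boundary_tangent_tn: "\<And>x u. \<lbrakk>x \<in> G ` A; x \<notin> N0; cr (tn x) u \<noteq> 0; \<exists>\<epsilon>>0. \<forall>t\<in>{0<..<\<epsilon>}. x + t *\<^sub>R u \<notin> closure D\<rbrakk>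
       \<Longrightarrow> \<exists>k. k \<noteq> 0 \<and> boundary_tangent D x (k *\<^sub>R tn x)"
begin

text \<open>Iterating \<open>step\<close> gives one trajectory. Any other agrees with it by
  induction: the next boundary point is forced because the open segment before it avoids the
  closure, and the next velocity by \<open>reflect_unique\<close>.\<close>

lemma good_billiard_exit:
  assumes z: "good z"
  shows "billiard_exit D (fst z) (snd z) w \<longleftrightarrow> w = v_out z"
proof -
  define N where "N = exit_time z"
  define x where "x i = fst ((step ^^ i) z)" for i
  define u where "u i = snd ((step ^^ i) z)" for i
  have x0: "x 0 = fst z" "u 0 = snd z" "u N = v_out z" by (simp_all add: x_def u_def v_out_def N_def)
  have hitting_z: "(step ^^ i) z \<in> hitting" if "i < N" for i using good_before_exit[OF z] that by (simp add: N_def)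
  have hit_time_pos: "hit_time ((step ^^ i) z) > 0" if "i < N" for i using hitting_z[OF that] by (simp add: hitting_def)
  have xS: "x (Suc i) = x i + hit_time ((step ^^ i) z) *\<^sub>R u i" for i by (simp add: x_def u_def step_def hit_point_def)
  have free: "x i + t *\<^sub>R u i \<notin> closure D" if "0 < t" "t < hit_time ((step ^^ i) z)" for i t
    using hit_time_less[OF that] by (simp add: x_def u_def)
  have coll: "x (Suc i) \<in> frontier D" "\<exists>k. k \<noteq> 0 \<and> boundary_tangent D (x (Suc i)) (k *\<^sub>R tn (x (Suc i)))" "u (Suc i) = reflect_tangent (tn (x (Suc i))) (u i)"
    if "i < N" for i
  proof -
    note gc = good_collision[OF z that[unfolded N_def], folded x_def u_def]
    show "x (Suc i) \<in> frontier D" using gc(1) boundary_G by simp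
    show "u (Suc i) = reflect_tangent (tn (x (Suc i))) (u i)" by (rule gc(5))
    have "cr (tn (x (Suc i))) (- u i) \<noteq> 0" using gc(3) by (simp add: cr_def)
    then show "\<exists>k. k \<noteq> 0 \<and> boundary_tangent D (x (Suc i)) (k *\<^sub>R tn (x (Suc i)))" by (rule boundary_tangent_tn[OF gc(1,2) _ gc(4)])
  qed
  have final: "x N + s *\<^sub>R u N \<notin> closure D" if "s > 0" for s
    using good_exits[OF z] that unfolding hits_def x_def u_def N_def by blast
  show ?thesis
  proof
    assume "w = v_out z"
    moreover have "(\<exists>t>0. x (Suc i) = x i + t *\<^sub>R u i) \<and> open_segment (x i) (x (Suc i)) \<inter> closure D = {} \<and>
               x (Suc i) \<in> frontier D \<and> (\<exists>\<tau>. boundary_tangent D (x (Suc i)) \<tau> \<and> u (Suc i) = reflect_tangent \<tau> (u i))" if i: "i < N" for i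
    proof -
      have "y \<notin> closure D" if "y \<in> open_segment (x i) (x (Suc i))" for y
      proof -
        from that have "\<exists>q. 0 < q \<and> q < 1 \<and> y = (1 - q) *\<^sub>R x i + q *\<^sub>R x (Suc i)" by (simp only: in_segment(2))
        then obtain q where q: "0 < q" "q < 1" "y = (1 - q) *\<^sub>R x i + q *\<^sub>R x (Suc i)" by (elim exE conjE)
        have "y = x i + (q * hit_time ((step ^^ i) z)) *\<^sub>R u i" unfolding q(3) xS by (simp add: algebra_simps)
        moreover have "q * hit_time ((step ^^ i) z) < 1 * hit_time ((step ^^ i) z)"
          using q hit_time_pos[OF i] by (intro mult_strict_right_mono) auto
        ultimately show ?thesis using free[of "q * hit_time ((step ^^ i) z)" i] q hit_time_pos[OF i] by simp
      qed
      moreover obtain k where "k \<noteq> 0" "boundary_tangent D (x (Suc i)) (k *\<^sub>R tn (x (Suc i)))" using coll(2)[OF i] by blast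
      then have "\<exists>\<tau>. boundary_tangent D (x (Suc i)) \<tau> \<and> u (Suc i) = reflect_tangent \<tau> (u i)"
        using coll(3)[OF i] by (metis reflect_scale)
      ultimately show ?thesis using coll(1)[OF i] hit_time_pos[OF i] xS[of i] by blast
    qed
    ultimately show "billiard_exit D (fst z) (snd z) w"
      unfolding billiard_exit_def using x0 final by (intro exI[of _ N] exI[of _ x] exI[of _ u]) auto
  next
    assume "billiard_exit D (fst z) (snd z) w"
    then obtain n x' u' where x': "x' 0 = fst z" "u' 0 = snd z" "u' n = w"
      and st: "\<And>i. i < n \<Longrightarrow> (\<exists>t>0. x' (Suc i) = x' i + t *\<^sub>R u' i) \<and>
               open_segment (x' i) (x' (Suc i)) \<inter> closure D = {} \<and>
               x' (Suc i) \<in> frontier D \<and>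
               (\<exists>\<tau>. boundary_tangent D (x' (Suc i)) \<tau> \<and> u' (Suc i) = reflect_tangent \<tau> (u' i))"
      and fin: "\<And>s. s > 0 \<Longrightarrow> x' n + s *\<^sub>R u' n \<notin> closure D"
      unfolding billiard_exit_def by blast
    have eq: "x' i = x i \<and> u' i = u i" if "i \<le> n" "i \<le> N" for i
      using that
    proof (induction i)
      case 0 then show ?case using x' x0 by simp
    next
      case (Suc i)
      let ?\<tau> = "hit_time ((step ^^ i) z)"
      have IH: "x' i = x i" "u' i = u i" and i: "i < n" "i < N" using Suc by auto
      obtain t where t: "t > 0" "x' (Suc i) = x i + t *\<^sub>R u i" using st[OF i(1)] IH by auto
      have xC: "x' (Suc i) \<in> closure D" using st[OF i(1)] by (auto simp: frontier_def)
      have "?\<tau> \<le> t" using free[of t i] t xC by force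
      moreover have "\<not> ?\<tau> < t"
      proof
        assume less: "?\<tau> < t"
        define q where "q = ?\<tau> / t"
        have q: "0 < q" "q < 1" "?\<tau> = q * t" using less t hit_time_pos[OF i(2)] by (auto simp: q_def)
        have "x (Suc i) = (1 - q) *\<^sub>R x i + q *\<^sub>R x' (Suc i)" unfolding xS t(2) q(3) by (simp add: algebra_simps)
        \<comment> \<open>A degenerate open segment is empty and would say nothing; it would require
          velocity 0, against the free flight before the hit.\<close>
        moreover have "x i \<noteq> x' (Suc i)"
        proof
          assume "x i = x' (Suc i)"
          then have "u i = 0" using t by simp
          then have "x (Suc i) = x i + (?\<tau>/2) *\<^sub>R u i" by (simp add: xS)
          then show False using free[of "?\<tau>/2" i] hit_time_pos[OF i(2)] coll(1)[OF i(2)] by (simp add: frontier_def)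
        qed
        ultimately have "x (Suc i) \<in> open_segment (x i) (x' (Suc i))" using q by (auto simp: in_segment)
        then show False using st[OF i(1)] IH coll(1)[OF i(2)] by (auto simp: frontier_def)
      qed
      ultimately have x1: "x' (Suc i) = x (Suc i)" using t xS by simp
      obtain \<sigma> where "boundary_tangent D (x (Suc i)) \<sigma>" "u' (Suc i) = reflect_tangent \<sigma> (u i)"
        using st[OF i(1)] IH x1 by auto
      then show ?case using x1 coll(2,3)[OF i(2)] by (metis reflect_unique reflect_scale)
    qed
    \<comment> \<open>A shorter trajectory would need a free final ray where a hit occurs, a longer
      one a hit on a ray that is free.\<close>
    have "n = N"
    proof (rule ccontr)
      assume "n \<noteq> N"
      then consider "n < N" | "N < n" by linarith
      then show False
      proof cases
        case 1
        then have "x n + hit_time ((step ^^ n) z) *\<^sub>R u n \<notin> closure D" using fin[OF hit_time_pos[OF 1]] eq[of n] by simp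
        then show False using coll(1)[OF 1] xS[of n] by (simp add: frontier_def)
      next
        case 2
        then obtain t where "t > 0" "x' (Suc N) = x N + t *\<^sub>R u N" using st[OF 2] eq[of N] by auto
        then show False using final[of t] st[OF 2] by (auto simp: frontier_def)
      qed
    qed
    then show "w = v_out z" using eq[of N] x' x0 by simp
  qed
qed

text \<open>This is the link to the circle in the definition of the resistance: a point where a good
  line enters an arbitrary ball around the closure has that line's exit velocity.\<close>

lemma ball_exit:
  assumes z: "good z" and ball: "closure D \<subseteq> ball c' R'" and \<xi>: "dist \<xi> c' = R'" "(\<xi> - c') \<bullet> snd z \<le> 0"
    and line: "\<xi> = fst z + a *\<^sub>R snd z"
  shows "\<exists>!w. billiard_exit D \<xi> (snd z) w" "v_plus D (snd z) \<xi> = v_out z"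
proof -
  have v: "norm (snd z) = 1" using z by (simp add: good_def)
  have out1: "fst z + t *\<^sub>R snd z \<notin> closure D" if "t \<le> 0" for t
    using start_outgoing[of z t] z that by (simp add: good_def)
  \<comment> \<open>Since the velocity points into the ball, moving backwards from the circle does
    not decrease the distance to c'; the squared distance is expanded in t.\<close>
  have out2: "\<xi> + t *\<^sub>R snd z \<notin> closure D" if "t \<le> 0" for t
  proof
    assume "\<xi> + t *\<^sub>R snd z \<in> closure D"
    then have "dist (\<xi> + t *\<^sub>R snd z) c' < R'" using ball by (auto simp: dist_commute)
    then have "(norm (\<xi> - c' + t *\<^sub>R snd z))\<^sup>2 < R'\<^sup>2"
      by (intro power_strict_mono) (auto simp: dist_norm algebra_simps)
    moreover have "(norm (\<xi> - c' + t *\<^sub>R snd z))\<^sup>2 = R'\<^sup>2 + 2 * t * ((\<xi> - c') \<bullet> snd z) + t\<^sup>2"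
    proof -
      have "(\<xi> - c') \<bullet> (\<xi> - c') = R'\<^sup>2" using \<xi>(1) by (simp add: dist_norm flip: power2_norm_eq_inner)
      moreover have "snd z \<bullet> snd z = 1" using v by (simp add: norm_eq_1)
      ultimately show ?thesis unfolding power2_norm_eq_inner
        by (simp only: inner_add_left inner_add_right inner_scaleR_left inner_scaleR_right)
           (simp add: power2_eq_square inner_commute distrib_left)
    qed
    moreover have "t * ((\<xi> - c') \<bullet> snd z) \<ge> 0" using that \<xi>(2) by (rule mult_nonpos_nonpos)
    moreover have "2 * t * ((\<xi> - c') \<bullet> snd z) = 2 * (t * ((\<xi> - c') \<bullet> snd z))" by simp
    moreover have "t\<^sup>2 \<ge> 0" by simp
    ultimately show False by linarith
  qed
  have line': "fst z = \<xi> + (-a) *\<^sub>R snd z" using line by simp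
  have "billiard_exit D \<xi> (snd z) w \<longleftrightarrow> w = v_out z" for w
    using billiard_exit_slide[OF _ line out1 out2] billiard_exit_slide[OF _ line' out2 out1] good_billiard_exit[OF z] by blast
  then show "\<exists>!w. billiard_exit D \<xi> (snd z) w" "v_plus D (snd z) \<xi> = v_out z"
    unfolding v_plus_def by auto
qed

end

section \<open>From lines to the resistance integral\<close>

context domain_billiard begin

text \<open>Good states are the only ones where \<open>resist\<close> has a meaning. Lines missing C
  have resistance 0 anyway; excluding them explicitly makes the function vanish off every ball
  containing the closure.\<close>

definition line_resist :: "pt \<Rightarrow> real \<Rightarrow> real" where
  "line_resist v p = (if \<bar>p\<bar> < \<rho> \<and> good (start p v, v) \<and> hits (start p v, v) then resist (start p v, v) else 0)"

lemma line_resist_meas [measurable]: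
  assumes [measurable]: "f \<in> borel_measurable N" "g \<in> borel_measurable N"
  shows "(\<lambda>x. line_resist (f x) (g x)) \<in> borel_measurable N"
  unfolding line_resist_def by measurable

lemma resist_nonneg: "good z \<Longrightarrow> resist z \<ge> 0"
  using resist_norm[of z] by (metis zero_le_power2 zero_le_mult_iff not_numeral_le_zero zero_le_numeral)

lemma line_resist_nonneg: "line_resist v p \<ge> 0"
  unfolding line_resist_def using resist_nonneg by auto

lemma resist_no_hit: "good z \<Longrightarrow> \<not> hits z \<Longrightarrow> resist z = 0"
proof -
  assume z: "good z" and "\<not> hits z"
  then have "(step ^^ 0) z \<notin> hitting" by (simp add: hitting_def)
  then have "exit_time z = 0" unfolding exit_time_def by (rule Least_eq_0)
  then have "v_out z = snd z" by (simp add: v_out_def)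
  then show ?thesis using z by (simp add: resist_def good_def norm_eq_1)
qed

lemma line_resist_integral:
  "(\<integral>\<^sup>+v. \<integral>\<^sup>+p. ennreal (line_resist v p) \<partial>lborel \<partial>circ) = (\<integral>\<^sup>+z. ennreal (resist z) \<partial>line_measure)"
proof -
  have "(\<integral>\<^sup>+z. ennreal (resist z) \<partial>line_measure) = (\<integral>\<^sup>+z. (if good z \<and> hits z then ennreal (resist z) else 0) \<partial>line_measure)"
    using AE_good by (intro nn_integral_cong_AE, eventually_elim) (auto simp: resist_no_hit)
  also have "\<dots> = line_int (\<lambda>z. if good z \<and> hits z then ennreal (resist z) else 0)"
    by (rule line_int_eq[symmetric]) measurable
  also have "\<dots> = (\<integral>\<^sup>+v. \<integral>\<^sup>+p. ennreal (line_resist v p) \<partial>lborel \<partial>circ)"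
    unfolding line_int_def by (intro nn_integral_cong) (auto simp: line_resist_def indicator_def abs_less_iff)
  finally show ?thesis ..
qed

lemma line_resist_outside:
  assumes v: "norm v = 1" and ball: "closure D \<subseteq> ball c' R'" and "\<bar>p - (c' - c) \<bullet> rot v\<bar> \<ge> R'"
  shows "line_resist v p = 0"
proof (rule ccontr)
  assume "line_resist v p \<noteq> 0"
  then have "hits (start p v, v)" by (auto simp: line_resist_def split: if_splits)
  then obtain t where y: "start p v + t *\<^sub>R v \<in> closure D" by (auto simp: hits_def)
  have nr: "norm (rot v) = 1" using v by (simp add: norm_eq_sqrt_inner norm_rot)
  have "\<bar>(start p v + t *\<^sub>R v - c') \<bullet> rot v\<bar> \<le> norm (start p v + t *\<^sub>R v - c')"
    using Cauchy_Schwarz_ineq2[of "start p v + t *\<^sub>R v - c'" "rot v"] nr by simp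
  also have "\<dots> < R'" using y ball by (auto simp: dist_norm norm_minus_commute)
  finally have "\<bar>(start p v + t *\<^sub>R v - c') \<bullet> rot v\<bar> < R'" .
  moreover have "(start p v + t *\<^sub>R v - c') \<bullet> rot v = p - (c' - c) \<bullet> rot v"
    using start_rot[OF v, of p] by (simp add: inner_diff_left inner_add_left rot_inner algebra_simps)
  ultimately show False using assms(3) by simp
qed

text \<open>The point with polar angle \<open>\<phi> + pi + \<psi>\<close> on the circle around c' lies on the line with offset
  p0 - R' sin \<open>\<psi>\<close>, so the weight R' cos \<open>\<psi>\<close> is the Jacobian of this change of variables.\<close>

lemma line_substitution:
  assumes v: "norm v = 1" and ball: "closure D \<subseteq> ball c' R'" and R': "R' > 0"
  defines "p0 \<equiv> (c' - c) \<bullet> rot v"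
  shows "(\<integral>\<^sup>+p. ennreal (line_resist v p) \<partial>lborel) =
     (\<integral>\<^sup>+\<psi>. ennreal (line_resist v (p0 - R' * sin \<psi>)) * ennreal (R' * cos \<psi>) * indicator {-pi/2..pi/2} \<psi> \<partial>lborel)"
proof -
  have "(\<integral>\<^sup>+p. ennreal (line_resist v p) \<partial>lborel) = (\<integral>\<^sup>+y. ennreal (line_resist v (p0 + (-1) * y)) \<partial>lborel)"
    by (subst nn_integral_real_affine[where c="-1" and t=p0]) auto
  also have "\<dots> = (\<integral>\<^sup>+y. ennreal (line_resist v (p0 - y)) * indicator {R' * sin (-pi/2)..R' * sin (pi/2)} y \<partial>lborel)"
  proof (rule nn_integral_cong)
    fix y
    show "ennreal (line_resist v (p0 + (-1) * y)) = ennreal (line_resist v (p0 - y)) * indicator {R' * sin (-pi/2)..R' * sin (pi/2)} y"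
      using line_resist_outside[OF v ball, of "p0 - y"] R' by (auto simp: indicator_def p0_def abs_if split: if_splits)
  qed
  also have "\<dots> = (\<integral>\<^sup>+\<psi>. ennreal (line_resist v (p0 - R' * sin \<psi>) * (R' * cos \<psi>) * indicator {-pi/2..pi/2} \<psi>) \<partial>lborel)"
  proof -
    have "set_borel_measurable borel {R' * sin (-pi/2)..R' * sin (pi/2)} (\<lambda>y. line_resist v (p0 - y))"
      unfolding set_borel_measurable_def by measurable
    then have "(\<integral>\<^sup>+y. ennreal (line_resist v (p0 - y) * indicator {R' * sin (-pi/2)..R' * sin (pi/2)} y) \<partial>lborel) =
      (\<integral>\<^sup>+\<psi>. ennreal (line_resist v (p0 - R' * sin \<psi>) * (R' * cos \<psi>) * indicator {-pi/2..pi/2} \<psi>) \<partial>lborel)"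
      by (rule nn_integral_substitution)
         (use R' in \<open>auto intro!: derivative_eq_intros continuous_intros cos_ge_zero mult_nonneg_nonneg\<close>)
    moreover have "ennreal (line_resist v (p0 - y) * indicator {R' * sin (-pi/2)..R' * sin (pi/2)} y) =
      ennreal (line_resist v (p0 - y)) * indicator {R' * sin (-pi/2)..R' * sin (pi/2)} y" for y
      by (auto simp: indicator_def)
    ultimately show ?thesis by simp
  qed
  also have "\<dots> = (\<integral>\<^sup>+\<psi>. ennreal (line_resist v (p0 - R' * sin \<psi>)) * ennreal (R' * cos \<psi>) * indicator {-pi/2..pi/2} \<psi> \<partial>lborel)"
    using line_resist_nonneg by (intro nn_integral_cong) (auto simp: indicator_def ennreal_mult')
  finally show ?thesis .
qed

text \<open>The resistance integrand is not known to be measurable, hence the detour through a measurable minorant.\<close>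

definition minorant :: "pt \<Rightarrow> real \<Rightarrow> real \<Rightarrow> real \<Rightarrow> ennreal" where
  "minorant c' R' \<phi> \<theta> = (if cos (\<theta> - \<phi>) \<le> 0
     then ennreal (line_resist (unit_vec \<phi>) ((c' - c) \<bullet> rot (unit_vec \<phi>) + R' * sin (\<theta> - \<phi>))) * ennreal (R' * \<bar>cos (\<theta> - \<phi>)\<bar>) else 0)"

lemma minorant_meas [measurable]:
  assumes [measurable]: "f \<in> borel_measurable N" "g \<in> borel_measurable N"
  shows "(\<lambda>x. minorant c' R' (f x) (g x)) \<in> borel_measurable N"
  unfolding minorant_def by measurable

lemma minorant_inner:
  assumes ball: "closure D \<subseteq> ball c' R'" and R': "R' > 0"
  shows "(\<integral>\<^sup>+p. ennreal (line_resist (unit_vec \<phi>) p) \<partial>lborel) \<le> (\<integral>\<^sup>+\<theta>. indicator {0..2*pi} \<theta> * minorant c' R' \<phi> \<theta> \<partial>lborel)"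
proof -
  \<comment> \<open>The entry points \<phi> + pi + \<psi> with |\<psi>| <= pi/2 fill the first half
    of the period that starts at this angle.\<close>
  let ?a = "\<phi> + pi/2"
  let ?p0 = "(c' - c) \<bullet> rot (unit_vec \<phi>)"
  have "(\<integral>\<^sup>+p. ennreal (line_resist (unit_vec \<phi>) p) \<partial>lborel) =
    (\<integral>\<^sup>+\<psi>. ennreal (line_resist (unit_vec \<phi>) (?p0 - R' * sin \<psi>)) * ennreal (R' * cos \<psi>) * indicator {-pi/2..pi/2} \<psi> \<partial>lborel)"
    by (rule line_substitution[OF norm_unit_vec ball R'])
  also have "\<dots> \<le> (\<integral>\<^sup>+\<psi>. indicator {?a..<?a+2*pi} ((\<phi> + pi) + 1 * \<psi>) * minorant c' R' \<phi> ((\<phi> + pi) + 1 * \<psi>) \<partial>lborel)"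
  proof (rule nn_integral_mono)
    fix \<psi> :: real
    have e: "sin (\<phi> + pi + \<psi> - \<phi>) = - sin \<psi>" "cos (\<phi> + pi + \<psi> - \<phi>) = - cos \<psi>"
      by (simp_all add: sin_add cos_add)
    show "ennreal (line_resist (unit_vec \<phi>) (?p0 - R' * sin \<psi>)) * ennreal (R' * cos \<psi>) * indicator {-pi/2..pi/2} \<psi>
      \<le> indicator {?a..<?a+2*pi} ((\<phi> + pi) + 1 * \<psi>) * minorant c' R' \<phi> ((\<phi> + pi) + 1 * \<psi>)"
    proof (cases "\<psi> \<in> {-pi/2..pi/2}")
      case True
      then have "cos \<psi> \<ge> 0" by (intro cos_ge_zero) auto
      moreover have "-pi/2 \<le> \<psi>" "\<psi> \<le> pi/2" using True by auto
      then have "?a \<le> (\<phi> + pi) + 1 * \<psi>" "(\<phi> + pi) + 1 * \<psi> < ?a+2*pi" using pi_gt_zero by linarith+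
      then have "(\<phi> + pi) + 1 * \<psi> \<in> {?a..<?a+2*pi}" by (simp only: atLeastLessThan_iff)
      ultimately show ?thesis using True by (simp add: minorant_def e)
    qed simp
  qed
  also have "\<dots> = (\<integral>\<^sup>+\<theta>. indicator {?a..<?a+2*pi} \<theta> * minorant c' R' \<phi> \<theta> \<partial>lborel)"
    by (subst (2) nn_integral_real_affine[where c=1 and t="\<phi> + pi"]) auto
  also have "\<dots> = (\<integral>\<^sup>+\<theta>. indicator {0..<2*pi} \<theta> * minorant c' R' \<phi> \<theta> \<partial>lborel)"
  proof (rule nn_integral_periodic)
    have "sin (x + 2*pi - \<phi>) = sin (x - \<phi>)" "cos (x + 2*pi - \<phi>) = cos (x - \<phi>)" for x
      using sin_periodic[of "x-\<phi>"] cos_periodic[of "x-\<phi>"] by (simp_all add: algebra_simps)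
    then show "minorant c' R' \<phi> (x + 2*pi) = minorant c' R' \<phi> x" for x by (simp add: minorant_def)
  qed measurable
  also have "\<dots> \<le> (\<integral>\<^sup>+\<theta>. indicator {0..2*pi} \<theta> * minorant c' R' \<phi> \<theta> \<partial>lborel)"
    by (intro nn_integral_mono mult_right_mono) (auto simp: indicator_def)
  finally show ?thesis .
qed

text \<open>Where the minorant is nonzero the line is good, so by \<open>ball_exit\<close> the
  uniqueness test of the integrand succeeds and the two values agree.\<close>

lemma minorant_le:
  assumes ball: "closure D \<subseteq> ball c' R'" and R': "R' > 0"
  shows "minorant c' R' \<phi> \<theta> \<le> ennreal (resistance_integrand D c' R' \<phi> \<theta>)"
proof (cases "minorant c' R' \<phi> \<theta> = 0")
  case False
  let ?v = "unit_vec \<phi>" and ?e = "unit_vec \<theta>"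
  let ?\<xi> = "c' + R' *\<^sub>R ?e"
  define p where "p = (c' - c) \<bullet> rot ?v + R' * sin (\<theta> - \<phi>)"
  define z where "z = (start p ?v, ?v)"
  have cos: "cos (\<theta> - \<phi>) \<le> 0" and lr: "line_resist ?v p \<noteq> 0" using False by (auto simp: minorant_def p_def split: if_splits)
  then have z: "good z" and lr': "line_resist ?v p = resist z" by (auto simp: line_resist_def z_def split: if_splits)
  have ve: "?v \<bullet> ?e = cos (\<theta> - \<phi>)" by (simp add: inner2 cos_diff mult.commute)
  have re: "?e \<bullet> rot ?v = sin (\<theta> - \<phi>)" by (simp add: inner2 sin_diff mult.commute)
  have \<xi>: "dist ?\<xi> c' = R'" "(?\<xi> - c') \<bullet> snd z \<le> 0"
    using R' ve cos by (auto simp: dist_norm z_def inner_commute mult_nonneg_nonpos)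
  have "?\<xi> - c = ((?\<xi> - c) \<bullet> rot ?v) *\<^sub>R rot ?v + ((?\<xi> - c) \<bullet> ?v) *\<^sub>R ?v"
    by (rule orthogonal_decomposition) simp
  moreover have "(?\<xi> - c) \<bullet> rot ?v = p"
    using re by (simp add: p_def inner_diff_left inner_add_left)
  ultimately have dec: "?\<xi> - c = p *\<^sub>R rot ?v + ((?\<xi> - c) \<bullet> ?v) *\<^sub>R ?v" by metis
  define a where "a = (?\<xi> - c) \<bullet> ?v"
  have "?\<xi> = c + (p *\<^sub>R rot ?v + a *\<^sub>R ?v)" using dec unfolding a_def[symmetric] by (simp add: diff_eq_eq add.commute)
  then have line: "?\<xi> = fst z + (a + \<rho>) *\<^sub>R snd z"
    by (simp add: z_def start_def algebra_simps)
  note be = ball_exit[OF z ball \<xi> line]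
  have "resistance_integrand D c' R' \<phi> \<theta> = resist z * \<bar>cos (\<theta> - \<phi>)\<bar> * R'"
    using be cos unfolding resistance_integrand_def Let_def ve by (simp add: z_def resist_def)
  moreover have "minorant c' R' \<phi> \<theta> = ennreal (resist z) * ennreal (R' * \<bar>cos (\<theta> - \<phi>)\<bar>)"
    unfolding minorant_def p_def[symmetric] lr' using cos by (simp only: if_True)
  moreover have "\<dots> = ennreal (resist z * (R' * \<bar>cos (\<theta> - \<phi>)\<bar>))"
    using resist_nonneg[OF z] R' by (intro ennreal_mult[symmetric]) auto
  ultimately show ?thesis by (simp only: mult_ac order_refl)
qed simp

text \<open>\<open>enn2real\<close> sends infinity to 0, so a lower bound for the integral passes to
  \<open>resistance_wrt\<close> only once the integral is known to be finite.\<close>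

lemma resistance_integrand_le:
  assumes R': "R' > 0" shows "resistance_integrand D c' R' \<phi> \<theta> \<le> 2 * R'"
proof -
  let ?v = "unit_vec \<phi>" and ?e = "unit_vec \<theta>"
  let ?w = "v_plus D ?v (c' + R' *\<^sub>R ?e)"
  let ?B = "?v \<bullet> ?e \<le> 0 \<and> (\<exists>!w. billiard_exit D (c' + R' *\<^sub>R ?e) ?v w)"
  have eq: "resistance_integrand D c' R' \<phi> \<theta> = (if ?B then (1 - ?v \<bullet> ?w) * \<bar>?v \<bullet> ?e\<bar> * R' else 0)"
    by (simp only: resistance_integrand_def Let_def)
  show ?thesis
  proof (cases ?B)
    case True
    then have "billiard_exit D (c' + R' *\<^sub>R ?e) ?v ?w" unfolding v_plus_def by (blast intro: theI')
    then have "norm ?w = 1" using billiard_exit_norm by fastforce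
    then have "\<bar>?v \<bullet> ?w\<bar> \<le> 1" using Cauchy_Schwarz_ineq2[of ?v ?w] by simp
    then have a: "0 \<le> 1 - ?v \<bullet> ?w" "1 - ?v \<bullet> ?w \<le> 2" by auto
    have b: "\<bar>?v \<bullet> ?e\<bar> \<le> 1" using Cauchy_Schwarz_ineq2[of ?v ?e] by simp
    have "(1 - ?v \<bullet> ?w) * \<bar>?v \<bullet> ?e\<bar> \<le> 2 * 1" using a b by (intro mult_mono) auto
    then have "(1 - ?v \<bullet> ?w) * \<bar>?v \<bullet> ?e\<bar> * R' \<le> 2 * 1 * R'" using R' by (intro mult_right_mono) auto
    then show ?thesis unfolding eq if_P[OF True] by simp
  next
    case False
    then show ?thesis unfolding eq if_not_P[OF False] using R' by simp
  qed
qed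

lemma resistance_wrt_ge:
  assumes ball: "closure D \<subseteq> ball c' R'" and R': "R' > 0" and pos: "measure lebesgue (closure D) > 0"
  shows "pi / 2 * (measure lebesgue (closure D))\<^sup>2 / R^3 \<le> resistance_wrt D c' R'"
proof -
  let ?I = "\<integral>\<^sup>+ p. indicator ({0..2*pi} \<times> {0..2*pi}) p * ennreal (resistance_integrand D c' R' (fst p) (snd p)) \<partial>lborel"
  have "?I \<le> (\<integral>\<^sup>+ p. ennreal (2 * R') * indicator ({0..2*pi} \<times> {0..2*pi}) p \<partial>(lborel :: (real \<times> real) measure))"
    using resistance_integrand_le[OF R'] by (intro nn_integral_mono) (auto simp: indicator_def intro!: ennreal_leI)
  also have "\<dots> = ennreal (2 * R') * emeasure (lborel \<Otimes>\<^sub>M lborel) ({0..2*pi} \<times> {0..2*pi::real})"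
    unfolding lborel_prod[symmetric] by (rule nn_integral_cmult_indicator) simp
  also have "\<dots> < top"
    by (subst lborel.emeasure_pair_measure_Times) (auto simp: ennreal_mult_less_top)
  finally have fin: "?I < top" .
  have "ennreal (pi / 2 * (measure lebesgue (closure D))\<^sup>2 / R^3) \<le> (\<integral>\<^sup>+z. ennreal (resist z) \<partial>line_measure)"
    by (rule resistance_lines[OF pos])
  also have "\<dots> = (\<integral>\<^sup>+\<phi>. indicator {0..<2*pi} \<phi> * (\<integral>\<^sup>+p. ennreal (line_resist (unit_vec \<phi>) p) \<partial>lborel) \<partial>lborel)"
    unfolding line_resist_integral[symmetric] by (rule nn_integral_circ) measurable
  also have "\<dots> \<le> (\<integral>\<^sup>+\<phi>. indicator {0..2*pi} \<phi> * (\<integral>\<^sup>+\<theta>. indicator {0..2*pi} \<theta> * minorant c' R' \<phi> \<theta> \<partial>lborel) \<partial>lborel)"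
    by (intro nn_integral_mono mult_mono minorant_inner ball R') (auto simp: indicator_def)
  also have "\<dots> = (\<integral>\<^sup>+\<phi>. \<integral>\<^sup>+\<theta>. indicator ({0..2*pi} \<times> {0..2*pi}) (\<phi>, \<theta>) * minorant c' R' (fst (\<phi>,\<theta>)) (snd (\<phi>,\<theta>)) \<partial>lborel \<partial>lborel)"
    by (intro nn_integral_cong) (auto simp: indicator_def)
  also have "\<dots> = (\<integral>\<^sup>+ p. indicator ({0..2*pi} \<times> {0..2*pi}) p * minorant c' R' (fst p) (snd p) \<partial>(lborel \<Otimes>\<^sub>M lborel))"
    by (rule lborel.nn_integral_fst) measurable
  also have "\<dots> \<le> ?I"
    unfolding lborel_prod by (intro nn_integral_mono mult_left_mono minorant_le ball R') auto
  finally have "ennreal (pi / 2 * (measure lebesgue (closure D))\<^sup>2 / R^3) \<le> ?I" .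
  then have "enn2real (ennreal (pi / 2 * (measure lebesgue (closure D))\<^sup>2 / R^3)) \<le> enn2real ?I"
    using fin by (intro enn2real_mono) auto
  moreover have "0 \<le> pi / 2 * (measure lebesgue (closure D))\<^sup>2 / R^3" using R_pos by simp
  ultimately show ?thesis unfolding resistance_wrt_def by simp
qed

end

section \<open>Regular boundary points\<close>

text \<open>Coordinates around p in the orthogonal frame formed by \<tau> and
  \<open>rot \<tau>\<close>, in units of the length of \<tau>; \<open>cP\<close> is the inverse
  map.\<close>

definition cX :: "pt \<Rightarrow> pt \<Rightarrow> pt \<Rightarrow> real" where "cX p \<tau> y = ((y - p) \<bullet> \<tau>) / (\<tau> \<bullet> \<tau>)"
definition cY :: "pt \<Rightarrow> pt \<Rightarrow> pt \<Rightarrow> real" where "cY p \<tau> y = cr \<tau> (y - p) / (\<tau> \<bullet> \<tau>)"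
definition cP :: "pt \<Rightarrow> pt \<Rightarrow> real \<Rightarrow> real \<Rightarrow> pt" where "cP p \<tau> x \<eta> = p + (x *\<^sub>R \<tau> + \<eta> *\<^sub>R rot \<tau>)"

lemma cX_cP [simp]: "\<tau> \<noteq> 0 \<Longrightarrow> cX p \<tau> (cP p \<tau> x \<eta>) = x"
  by (simp add: cX_def cP_def inner_add_left rot_inner)

lemma cY_cP [simp]: "\<tau> \<noteq> 0 \<Longrightarrow> cY p \<tau> (cP p \<tau> x \<eta>) = \<eta>"
proof -
  assume "\<tau> \<noteq> 0"
  moreover have "cr \<tau> (x *\<^sub>R \<tau> + \<eta> *\<^sub>R rot \<tau>) = \<eta> * (\<tau> \<bullet> \<tau>)" by (simp add: cr_def inner2 algebra_simps)
  ultimately show ?thesis by (simp add: cY_def cP_def)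
qed

lemma cP_cX_cY: assumes "\<tau> \<noteq> 0" shows "cP p \<tau> (cX p \<tau> y) (cY p \<tau> y) = y"
proof -
  have nz: "\<tau> \<bullet> \<tau> \<noteq> 0" using assms by simp
  let ?w = "y - p"
  have "(?w \<bullet> \<tau>) *\<^sub>R \<tau> + cr \<tau> ?w *\<^sub>R rot \<tau> = (\<tau> \<bullet> \<tau>) *\<^sub>R ?w"
    unfolding vector2_eq_iff by (simp add: cr_def inner2 algebra_simps)
  then have "(1 / (\<tau> \<bullet> \<tau>)) *\<^sub>R ((?w \<bullet> \<tau>) *\<^sub>R \<tau> + cr \<tau> ?w *\<^sub>R rot \<tau>) = ?w" using nz by simp
  then have "cX p \<tau> y *\<^sub>R \<tau> + cY p \<tau> y *\<^sub>R rot \<tau> = ?w" by (simp add: cX_def cY_def scaleR_add_right)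
  then show ?thesis by (simp add: cP_def)
qed

lemma continuous_on_cX [continuous_intros]: "continuous_on S f \<Longrightarrow> continuous_on S (\<lambda>z. cX p \<tau> (f z))"
  unfolding cX_def divide_inverse by (intro continuous_intros)
lemma continuous_on_cY [continuous_intros]: "continuous_on S f \<Longrightarrow> continuous_on S (\<lambda>z. cY p \<tau> (f z))"
  unfolding cY_def divide_inverse by (intro continuous_intros)

lemma cX_base [simp]: "cX p \<tau> p = 0" and cY_base [simp]: "cY p \<tau> p = 0"
  by (simp_all add: cX_def cY_def cr_def)

lemma cX_affine: "cX p \<tau> ((1 - q) *\<^sub>R y + q *\<^sub>R z) = (1 - q) * cX p \<tau> y + q * cX p \<tau> z"
  by (simp add: cX_def inner_diff_left inner_add_left diff_divide_distrib add_divide_distrib algebra_simps)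

lemma cY_affine: "cY p \<tau> ((1 - q) *\<^sub>R y + q *\<^sub>R z) = (1 - q) * cY p \<tau> y + q * cY p \<tau> z"
proof -
  have "cr \<tau> ((1 - q) *\<^sub>R y + q *\<^sub>R z - p) = (1 - q) * cr \<tau> (y - p) + q * cr \<tau> (z - p)"
    by (simp add: cr_def algebra_simps)
  then show ?thesis by (simp add: cY_def add_divide_distrib)
qed

lemma cX_ray: "cX p \<tau> (p + t *\<^sub>R w) = t * ((w \<bullet> \<tau>) / (\<tau> \<bullet> \<tau>))"
  by (simp add: cX_def)
lemma cY_ray: "cY p \<tau> (p + t *\<^sub>R w) = t * (cr \<tau> w / (\<tau> \<bullet> \<tau>))"
  by (simp add: cY_def cr_def algebra_simps diff_divide_distrib)

lemma dist_cP_le: "dist (cP p \<tau> x \<eta>) p \<le> (\<bar>x\<bar> + \<bar>\<eta>\<bar>) * norm \<tau>"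
proof -
  have "norm (rot \<tau>) = norm \<tau>" by (simp add: norm_eq_sqrt_inner norm_rot)
  then have "norm (x *\<^sub>R \<tau> + \<eta> *\<^sub>R rot \<tau>) \<le> \<bar>x\<bar> * norm \<tau> + \<bar>\<eta>\<bar> * norm \<tau>"
    using norm_triangle_ineq[of "x *\<^sub>R \<tau>" "\<eta> *\<^sub>R rot \<tau>"] by simp
  then show ?thesis by (simp add: cP_def dist_norm distrib_right)
qed

text \<open>D does not meet the frontier of any V k, so the component of D through a point of V k
  stays inside V k. The V k being disjoint, these components are distinct.\<close>

lemma finite_components_disjoint_open:
  fixes V :: "nat \<Rightarrow> 'a::topological_space set"
  assumes fin: "finite (components D)" and op: "\<And>k. open (V k)" and ne: "\<And>k. D \<inter> V k \<noteq> {}"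
    and cl: "\<And>k. D \<inter> closure (V k) \<subseteq> V k" and disj: "\<And>i j. i \<noteq> j \<Longrightarrow> V i \<inter> V j = {}"
  shows False
proof -
  define d where "d k = (SOME x. x \<in> D \<inter> V k)" for k
  have d: "d k \<in> D \<inter> V k" for k unfolding d_def by (rule someI_ex) (use ne[of k] in blast)
  define K where "K k = connected_component_set D (d k)" for k
  have dK: "d k \<in> K k" for k using d[of k] by (simp add: K_def)
  have KV: "K k \<subseteq> V k" for k
  proof (rule ccontr)
    assume "\<not> K k \<subseteq> V k"
    moreover have "d k \<in> K k \<inter> V k" using dK[of k] d[of k] by simp
    ultimately have "K k \<inter> frontier (V k) \<noteq> {}"
      by (intro connected_Int_frontier) (auto simp: K_def[of k] simp del: mem_Collect_eq)
    moreover have "K k \<subseteq> D" by (simp add: K_def connected_component_subset)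
    ultimately show False using cl[of k] op[of k] by (auto simp: frontier_def interior_open)
  qed
  have "inj K" using KV dK disj by (intro injI) (metis Int_iff empty_iff subsetD)
  moreover have "range K \<subseteq> components D" using d by (auto simp: K_def components_def)
  ultimately show False using fin finite_subset finite_imageD infinite_UNIV_nat by metis
qed

text \<open>If finitely many graphs agree at points accumulating at 0 but not near 0, the lenses between
  them contain infinitely many components of D.\<close>

lemma graphs_agree_right:
  fixes D :: "pt set" and X Y :: "pt \<Rightarrow> real" and f :: "'j \<Rightarrow> real \<Rightarrow> real"
  assumes D: "open D" "finite (components D)" and J: "finite J"
    and cont: "continuous_on UNIV X" "continuous_on UNIV Y" and onto: "\<And>x \<eta>. \<exists>y. X y = x \<and> Y y = \<eta>"
    and a: "a > 0" and cf: "\<And>j. j \<in> J \<Longrightarrow> continuous_on {-a<..<a} (f j)"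
    and fb: "\<And>j x. j \<in> J \<Longrightarrow> \<bar>x\<bar> < a \<Longrightarrow> \<bar>f j x\<bar> < b"
    and fr: "\<And>y. \<bar>X y\<bar> < a \<Longrightarrow> \<bar>Y y\<bar> < b \<Longrightarrow> y \<in> frontier D \<longleftrightarrow> (\<exists>j\<in>J. Y y = f j (X y))"
    and above: "\<And>y. \<bar>X y\<bar> < a \<Longrightarrow> \<bar>Y y\<bar> < b \<Longrightarrow> \<forall>j\<in>J. f j (X y) < Y y \<Longrightarrow> y \<notin> D"
    and acc: "\<And>\<delta>. \<delta> > 0 \<Longrightarrow> \<exists>x>0. x < \<delta> \<and> (\<forall>i\<in>J. \<forall>j\<in>J. f i x = f j x)"
  shows "\<exists>\<delta>>0. \<forall>x. 0 < x \<and> x < \<delta> \<longrightarrow> (\<forall>i\<in>J. \<forall>j\<in>J. f i x = f j x)"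
proof (rule ccontr)
  define E where "E x \<longleftrightarrow> (\<forall>i\<in>J. \<forall>j\<in>J. f i x = f j x)" for x
  assume "\<not> ?thesis"
  then have bad: "\<exists>x. 0 < x \<and> x < \<delta> \<and> \<not> E x" if "\<delta> > 0" for \<delta> using that by (auto simp: E_def)
  have acc': "\<exists>x. 0 < x \<and> x < \<delta> \<and> E x" if "\<delta> > 0" for \<delta> using acc[OF that] by (auto simp: E_def)
  \<comment> \<open>A decreasing sequence of abscissae at which all graphs agree, with a
    disagreement between any two neighbours.\<close>
  have "\<exists>z. \<forall>n::nat. (0 < z n \<and> z n < a \<and> E (z n)) \<and> (\<exists>x. z (Suc n) < x \<and> x < z n \<and> \<not> E x)"
  proof (rule dependent_nat_choice)
    show "\<exists>x. 0 < x \<and> x < a \<and> E x" using acc'[OF a] by blast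
    fix x :: real and n :: nat assume x: "0 < x \<and> x < a \<and> E x"
    obtain x1 where x1: "0 < x1" "x1 < x" "\<not> E x1" using bad[of x] x by auto
    obtain y where "0 < y" "y < x1" "E y" using acc'[OF x1(1)] by auto
    then show "\<exists>y. (0 < y \<and> y < a \<and> E y) \<and> (\<exists>xa. y < xa \<and> xa < x \<and> \<not> E xa)"
      using x x1 by (intro exI[of _ y]) auto
  qed
  then obtain z where z: "\<And>n::nat. 0 < z n" "\<And>n. z n < a" "\<And>n. E (z n)" and gap: "\<And>n. \<exists>x. z (Suc n) < x \<and> x < z n \<and> \<not> E x"
    by blast
  have "z (Suc n) \<le> z n" for n using gap[of n] by auto
  then have dec: "decseq z" by (rule decseq_SucI)
  \<comment> \<open>The open lenses between the lowest and the highest graph over consecutive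
    agreement points.\<close>
  define V where "V k = {y. z (Suc k) < X y \<and> X y < z k \<and> (\<exists>j\<in>J. Y y < f j (X y)) \<and> (\<exists>j\<in>J. f j (X y) < Y y)}" for k
  have bound: "\<bar>Y y\<bar> < b" if "i \<in> J" "j \<in> J" "\<bar>X y\<bar> < a" "Y y \<le> f i (X y)" "f j (X y) \<le> Y y" for i j y
    using fb[OF that(1) that(3)] fb[OF that(2) that(3)] that by linarith
  have cfX: "continuous_on S (\<lambda>y. f j (X y) - Y y)" if "j \<in> J" "\<And>y. y \<in> S \<Longrightarrow> \<bar>X y\<bar> < a" for j S
  proof (intro continuous_on_diff)
    show "continuous_on S (\<lambda>y. f j (X y))"
      by (rule continuous_on_compose2[OF cf[OF that(1)]]) (use that cont in \<open>force intro: continuous_on_subset\<close>)+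
    show "continuous_on S Y" using cont(2) by (rule continuous_on_subset) simp
  qed
  have Xopen: "open {y. z (Suc k) < X y \<and> X y < z k}" for k
    using cont by (intro open_Collect_conj open_Collect_less continuous_on_const) 
  have Xin: "\<bar>X y\<bar> < a" if "z (Suc k) \<le> X y" "X y \<le> z k" for y k
    using that z(1)[of "Suc k"] z(2)[of k] by linarith
  have half: "open {y. z (Suc k) < X y \<and> X y < z k \<and> Y y < f j (X y)}" "open {y. z (Suc k) < X y \<and> X y < z k \<and> f j (X y) < Y y}"
    if "j \<in> J" for j k
  proof -
    let ?S = "{y. z (Suc k) < X y \<and> X y < z k}"
    have c: "continuous_on ?S (\<lambda>y. f j (X y) - Y y)" using that Xin[of k] by (intro cfX) (simp_all add: less_imp_le)
    have "open (?S \<inter> (\<lambda>y. f j (X y) - Y y) -` {0<..})" "open (?S \<inter> (\<lambda>y. f j (X y) - Y y) -` {..<0})"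
      by (rule continuous_open_preimage[OF c Xopen]; simp)+
    moreover have "?S \<inter> (\<lambda>y. f j (X y) - Y y) -` {0<..} = {y. z (Suc k) < X y \<and> X y < z k \<and> Y y < f j (X y)}"
      "?S \<inter> (\<lambda>y. f j (X y) - Y y) -` {..<0} = {y. z (Suc k) < X y \<and> X y < z k \<and> f j (X y) < Y y}" by auto
    ultimately show "open {y. z (Suc k) < X y \<and> X y < z k \<and> Y y < f j (X y)}" "open {y. z (Suc k) < X y \<and> X y < z k \<and> f j (X y) < Y y}"
      by simp_all
  qed
  show False
  proof (rule finite_components_disjoint_open[OF D(2)])
    fix k
    have "V k = (\<Union>j\<in>J. {y. z (Suc k) < X y \<and> X y < z k \<and> Y y < f j (X y)}) \<inter> (\<Union>j\<in>J. {y. z (Suc k) < X y \<and> X y < z k \<and> f j (X y) < Y y})"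
      unfolding V_def by auto
    then show "open (V k)" by (simp only:) (intro open_Int open_UN ballI half)
    show "D \<inter> V k \<noteq> {}"
    proof -
      obtain x where x: "z (Suc k) < x" "x < z k" "\<not> E x" using gap by blast
      then obtain i0 j0 where ij: "i0 \<in> J" "j0 \<in> J" "f i0 x \<noteq> f j0 x" by (auto simp: E_def)
      have ne: "(\<lambda>j. f j x) ` J \<noteq> {}" using ij by auto
      have "Max ((\<lambda>j. f j x) ` J) \<in> (\<lambda>j. f j x) ` J" using J ne by (intro Max_in) auto
      then obtain m where m: "m \<in> J" "f m x = Max ((\<lambda>j. f j x) ` J)" by auto
      have mm: "f j x \<le> f m x" if "j \<in> J" for j unfolding m(2) using that J by (intro Max_ge) auto
      obtain i where i: "i \<in> J" "f i x < f m x" using ij mm[of i0] mm[of j0] by (metis linorder_neqE_linordered_idom not_le order_le_imp_less_or_eq)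
      obtain q where q: "X q = x" "Y q = f m x" using onto by blast
      \<comment> \<open>The point q on the highest graph is a frontier point, so D has points near
        it that are still above the lower graph of i. They are not above all graphs and, D being
        open, not on a graph; hence they lie in the lens.\<close>
      have Xq: "\<bar>X q\<bar> < a" using Xin[of k q] x q by simp
      have "q \<in> frontier D" using fr[of q] Xq fb[OF m(1) Xq] q m(1) by auto
      let ?W = "{y. z (Suc k) < X y \<and> X y < z k \<and> f i (X y) < Y y} \<inter> {y. \<bar>Y y\<bar> < b}"
      have "open ?W" using half(2)[OF i(1)] cont by (intro open_Int open_Collect_less continuous_intros) auto
      moreover have "q \<in> ?W" using x q i fb[OF m(1) Xq] by auto
      ultimately have "?W \<inter> D \<noteq> {}"
        using \<open>q \<in> frontier D\<close> open_Int_closure_eq_empty[of ?W D] by (auto simp: frontier_def)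
      then obtain y where y: "y \<in> ?W" "y \<in> D" by blast
      have Xy: "\<bar>X y\<bar> < a" using Xin[of k y] y by simp
      have "y \<notin> frontier D" using y D by (simp add: frontier_def interior_open)
      then have ne: "\<forall>j\<in>J. Y y \<noteq> f j (X y)" using fr[OF Xy] y by auto
      moreover obtain j where "j \<in> J" "\<not> f j (X y) < Y y" using above[OF Xy] y by auto
      ultimately have "Y y < f j (X y)" by force
      then have "y \<in> V k" using y i \<open>j \<in> J\<close> by (auto simp: V_def)
      then show ?thesis using y by blast
    qed
    show "D \<inter> closure (V k) \<subseteq> V k"
    proof
      fix y assume y: "y \<in> D \<inter> closure (V k)"
      \<comment> \<open>A limit point outside the lens lies on a graph: on the sides this is because
        all graphs agree there. Graphs consist of frontier points, which the open set D
        avoids.\<close>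
      let ?S = "{y. z (Suc k) \<le> X y \<and> X y \<le> z k}"
      let ?K = "(\<Union>j\<in>J. ?S \<inter> (\<lambda>y. f j (X y) - Y y) -` {0..}) \<inter> (\<Union>j\<in>J. ?S \<inter> (\<lambda>y. f j (X y) - Y y) -` {..0})"
      have Sc: "closed ?S" using cont by (intro closed_Collect_conj closed_Collect_le continuous_on_const)
      have "closed ?K"
        using J Xin by (intro closed_Int closed_UN ballI continuous_closed_preimage[OF cfX Sc]) auto
      moreover have "V k \<subseteq> ?K" unfolding V_def by (force intro: less_imp_le)
      ultimately have "closure (V k) \<subseteq> ?K" by (intro closure_minimal)
      then have "y \<in> ?K" using y by (intro subsetD[of "closure (V k)" ?K]) simp_all
      then have "(\<exists>i\<in>J. Y y \<le> f i (X y)) \<and> (\<exists>j\<in>J. f j (X y) \<le> Y y) \<and> z (Suc k) \<le> X y \<and> X y \<le> z k" by auto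
      then obtain i j where ij: "i \<in> J" "j \<in> J" "Y y \<le> f i (X y)" "f j (X y) \<le> Y y" and S: "z (Suc k) \<le> X y" "X y \<le> z k" by auto
      have Xy: "\<bar>X y\<bar> < a" using Xin S by blast
      have "y \<notin> frontier D" using y D by (simp add: frontier_def interior_open)
      then have "\<forall>j\<in>J. Y y \<noteq> f j (X y)" using fr[OF Xy bound[OF ij(1,2) Xy ij(3,4)]] by auto
      then have str: "Y y < f i (X y)" "f j (X y) < Y y" using ij by force+
      have "f i (X y) \<noteq> f j (X y)" using str by linarith
      then have "\<not> E (X y)" using ij(1,2) unfolding E_def by blast
      then have "X y \<noteq> z (Suc k)" "X y \<noteq> z k" using z(3)[of "Suc k"] z(3)[of k] by auto
      then have "z (Suc k) < X y" "X y < z k" using S by auto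
      then show "y \<in> V k" using str ij(1,2) unfolding V_def by blast
    qed
  next
    fix i j :: nat assume "i \<noteq> j"
    have *: "V i \<inter> V j = {}" if "i < j" for i j
    proof -
      have "z j \<le> z (Suc i)" using dec that by (auto simp: decseq_def)
      then show ?thesis unfolding V_def by auto
    qed
    show "V i \<inter> V j = {}" using *[of i j] *[of j i] \<open>i \<noteq> j\<close> by (metis Int_commute linorder_neqE_nat)
  qed
qed

text \<open>Near t the coordinate along \<tau> has nonzero derivative, so by Rolle it is injective
  and the arc is a graph over it. The other coordinate has derivative 0 at t, whence f x = o(x). The
  remaining part of the arc is compact and misses g t, so it does not return nearby.\<close>

lemma arc_local_graph:
  fixes g :: "real \<Rightarrow> pt"
  assumes g: "arc g" "g C1_differentiable_on {0..1}" and t: "0 < t" "t < 1" and \<tau>: "\<tau> \<noteq> 0"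
    and d: "vector_derivative g (at t) \<noteq> 0" "cr \<tau> (vector_derivative g (at t)) = 0"
  defines "X \<equiv> cX (g t) \<tau>" and "Y \<equiv> cY (g t) \<tau>"
  shows "\<exists>x0>0. \<exists>f. continuous_on {-x0..x0} f \<and> (\<forall>\<epsilon>>0. eventually (\<lambda>x. \<bar>f x\<bar> \<le> \<epsilon> * \<bar>x\<bar>) (nhds 0)) \<and>
     eventually (\<lambda>y. \<bar>X y\<bar> \<le> x0 \<and> (y \<in> path_image g \<longleftrightarrow> Y y = f (X y))) (nhds (g t))"
proof -
  define g' where "g' r = vector_derivative g (at r)" for r
  have gd: "(g has_vector_derivative g' r) (at r)" if "r \<in> {0..1}" for r
    unfolding g'_def using C1_has_vector_derivative[OF g(2) that] .
  have g'c: "continuous_on {0..1} g'"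
    using g(2) unfolding C1_differentiable_on_eq g'_def by blast
  have gc: "continuous_on {0..1} g" using g(1) by (simp add: arc_def path_def)
  have ginj: "inj_on g {0..1}" using g(1) by (simp add: arc_def)
  define \<psi> where "\<psi> r = X (g r)" for r
  define \<upsilon> where "\<upsilon> r = Y (g r)" for r
  define \<psi>' where "\<psi>' r = (g' r \<bullet> \<tau>) / (\<tau> \<bullet> \<tau>)" for r
  have \<psi>d: "(\<psi> has_real_derivative \<psi>' r) (at r)" if "r \<in> {0..1}" for r
  proof -
    have "((\<lambda>r. ((g r $ 1 - g t $ 1) * \<tau> $ 1 + (g r $ 2 - g t $ 2) * \<tau> $ 2) / (\<tau> \<bullet> \<tau>)) has_real_derivative
      ((g' r $ 1 - 0) * \<tau> $ 1 + (g' r $ 2 - 0) * \<tau> $ 2) / (\<tau> \<bullet> \<tau>)) (at r)"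
      by (intro DERIV_cdivide DERIV_add DERIV_cmult_right DERIV_diff DERIV_const has_real_derivative_nth gd that)
    then show ?thesis by (simp add: \<psi>_def[abs_def] X_def cX_def \<psi>'_def inner2)
  qed
  have \<upsilon>d: "(\<upsilon> has_real_derivative cr \<tau> (g' r) / (\<tau> \<bullet> \<tau>)) (at r)" if "r \<in> {0..1}" for r
  proof -
    have "((\<lambda>r. (\<tau> $ 1 * (g r $ 2 - g t $ 2) - \<tau> $ 2 * (g r $ 1 - g t $ 1)) / (\<tau> \<bullet> \<tau>)) has_real_derivative
      (\<tau> $ 1 * (g' r $ 2 - 0) - \<tau> $ 2 * (g' r $ 1 - 0)) / (\<tau> \<bullet> \<tau>)) (at r)"
      by (intro DERIV_cdivide DERIV_diff DERIV_cmult DERIV_const has_real_derivative_nth gd that)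
    then show ?thesis by (simp add: \<upsilon>_def[abs_def] Y_def cY_def cr_def)
  qed
  obtain k where k: "k \<noteq> 0" "g' t = k *\<^sub>R \<tau>" using parallel_scale[OF d(2) \<tau> d(1)] by (auto simp: g'_def)
  have \<psi>'t: "\<psi>' t \<noteq> 0" using k \<tau> by (simp add: \<psi>'_def)
  have \<psi>'c: "continuous_on {0..1} \<psi>'" unfolding \<psi>'_def divide_inverse by (intro continuous_intros g'c)
  obtain \<delta>0 where \<delta>0: "\<delta>0 > 0" "\<And>r. r \<in> {0..1} \<Longrightarrow> dist r t < \<delta>0 \<Longrightarrow> \<psi>' r \<noteq> 0"
  proof -
    obtain \<delta> where "\<delta> > 0" "\<And>r. r \<in> {0..1} \<Longrightarrow> dist r t < \<delta> \<Longrightarrow> dist (\<psi>' r) (\<psi>' t) < \<bar>\<psi>' t\<bar>"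
      using \<psi>'c \<psi>'t t unfolding continuous_on_iff by (metis atLeastAtMost_iff less_imp_le zero_less_abs_iff)
    then show ?thesis by (intro that[of \<delta>]) (force simp: dist_real_def)+
  qed
  define \<delta> where "\<delta> = min (\<delta>0/2) (min (t/2) ((1-t)/2))"
  have \<delta>: "\<delta> > 0" "\<delta> < \<delta>0" "\<delta> < t" "\<delta> < 1 - t" using \<delta>0 t by (auto simp: \<delta>_def min_def)
  define I where "I = {t-\<delta>..t+\<delta>}"
  have I01: "I \<subseteq> {0..1}" using \<delta> t by (auto simp: I_def)
  have tI: "t \<in> I" using \<delta> by (simp add: I_def)
  have \<psi>nz: "\<psi>' r \<noteq> 0" if "r \<in> I" for r using \<delta>0(2)[of r] that I01 \<delta> by (force simp: I_def dist_real_def)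
  have \<psi>c: "continuous_on I \<psi>"
    by (rule DERIV_continuous_on, rule has_field_derivative_at_within, rule \<psi>d) (use I01 in auto)
  have \<upsilon>c: "continuous_on I \<upsilon>"
    by (rule DERIV_continuous_on, rule has_field_derivative_at_within, rule \<upsilon>d) (use I01 in auto)
  have noteq: "\<psi> r1 \<noteq> \<psi> r2" if r: "r1 \<in> I" "r2 \<in> I" "r1 < r2" for r1 r2
  proof
    assume eq: "\<psi> r1 = \<psi> r2"
    have sub: "{r1..r2} \<subseteq> I" using r by (auto simp: I_def)
    have "\<exists>\<xi>>r1. \<xi> < r2 \<and> DERIV \<psi> \<xi> :> 0"
    proof (rule Rolle[OF r(3) eq])
      show "continuous_on {r1..r2} \<psi>" using \<psi>c sub by (rule continuous_on_subset)
      show "\<psi> differentiable at x" if "r1 < x" "x < r2" for x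
      proof -
        have "x \<in> {r1..r2}" using that by simp
        then have "x \<in> {0..1}" using sub I01 by blast
        from \<psi>d[OF this] show ?thesis by (auto simp: real_differentiable_def)
      qed
    qed
    then obtain \<xi> where \<xi>: "r1 < \<xi>" "\<xi> < r2" "DERIV \<psi> \<xi> :> 0" by blast
    then have "\<xi> \<in> I" using sub by auto
    then show False using \<psi>nz[of \<xi>] DERIV_unique[OF \<psi>d[of \<xi>] \<xi>(3)] I01 by auto
  qed
  have \<psi>inj: "inj_on \<psi> I" by (rule inj_onI) (metis linorder_neqE_linordered_idom noteq)
  have Iseg: "I = closed_segment (t-\<delta>) (t+\<delta>)" using \<delta> by (simp add: I_def closed_segment_eq_real_ivl)
  have img: "\<psi> ` I = closed_segment (\<psi> (t-\<delta>)) (\<psi> (t+\<delta>))"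
    unfolding Iseg by (rule continuous_injective_image_segment_1) (use \<psi>c \<psi>inj in \<open>simp_all add: Iseg\<close>)
  have \<psi>t: "\<psi> t = 0" and \<upsilon>t: "\<upsilon> t = 0" by (simp_all add: \<psi>_def \<upsilon>_def X_def Y_def)
  \<comment> \<open>The value 0 lies strictly between the two end values, so the smaller absolute
    value bounds a symmetric interval inside the image.\<close>
  define x0 where "x0 = min \<bar>\<psi> (t-\<delta>)\<bar> \<bar>\<psi> (t+\<delta>)\<bar>"
  have nz: "\<psi> (t-\<delta>) \<noteq> 0" "\<psi> (t+\<delta>) \<noteq> 0"
    using noteq[of "t-\<delta>" t] noteq[of t "t+\<delta>"] \<delta> tI \<psi>t by (auto simp: I_def)
  have x0: "x0 > 0" using nz by (simp add: x0_def)
  have "0 \<in> \<psi> ` I" using tI \<psi>t by force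
  then have x0I: "{-x0..x0} \<subseteq> \<psi> ` I"
    unfolding img closed_segment_eq_real_ivl x0_def using nz by (auto split: if_splits)
  define \<iota> where "\<iota> = inv_into I \<psi>"
  have \<iota>c: "continuous_on (\<psi> ` I) \<iota>" unfolding \<iota>_def
    by (rule continuous_on_inv[OF \<psi>c]) (use \<psi>inj in \<open>auto simp: I_def\<close>)
  have \<iota>\<psi>: "\<iota> (\<psi> r) = r" if "r \<in> I" for r using that \<psi>inj by (simp add: \<iota>_def)
  have \<psi>\<iota>: "\<psi> (\<iota> x) = x" "\<iota> x \<in> I" if "\<bar>x\<bar> \<le> x0" for x
  proof -
    have "x \<in> {-x0..x0}" using that by auto
    then have "x \<in> \<psi> ` I" using x0I by blast
    then show "\<psi> (\<iota> x) = x" "\<iota> x \<in> I" by (simp_all add: \<iota>_def f_inv_into_f inv_into_into)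
  qed
  define f where "f x = \<upsilon> (\<iota> x)" for x
  have "continuous_on {-x0..x0} f" unfolding f_def
    by (rule continuous_on_compose2[OF \<upsilon>c]) (use \<psi>\<iota>(2) in \<open>auto intro: continuous_on_subset[OF \<iota>c x0I]\<close>)
  moreover have "\<forall>\<epsilon>>0. eventually (\<lambda>x. \<bar>f x\<bar> \<le> \<epsilon> * \<bar>x\<bar>) (nhds 0)"
  proof (intro allI impI)
    fix \<epsilon> :: real assume \<epsilon>: "\<epsilon> > 0"
    have t01: "t \<in> {0..1}" using t by auto
    have "((\<lambda>r. (\<upsilon> r / (r - t)) / (\<psi> r / (r - t))) \<longlongrightarrow> 0 / \<psi>' t) (at t)"
      using \<upsilon>d[OF t01] \<psi>d[OF t01] d(2) \<psi>'t
      by (intro tendsto_divide) (simp_all add: has_field_derivative_iff \<psi>t \<upsilon>t g'_def)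
    from tendstoD[OF this \<epsilon>] have "eventually (\<lambda>r. dist ((\<upsilon> r / (r - t)) / (\<psi> r / (r - t))) 0 < \<epsilon>) (at t)"
      by (simp only: div_0)
    then obtain \<eta> where \<eta>: "\<eta> > 0" "\<And>r. r \<noteq> t \<Longrightarrow> dist r t < \<eta> \<Longrightarrow> \<bar>(\<upsilon> r / (r - t)) / (\<psi> r / (r - t))\<bar> < \<epsilon>"
      unfolding eventually_at by auto
    have est: "\<bar>\<upsilon> r\<bar> \<le> \<epsilon> * \<bar>\<psi> r\<bar>" if "r \<in> I" "dist r t < \<eta>" for r
    proof (cases "r = t")
      case False
      then have "\<psi> r \<noteq> 0" using noteq[of r t] noteq[of t r] tI that(1) \<psi>t by (cases "r < t") auto
      moreover have "\<bar>\<upsilon> r / \<psi> r\<bar> < \<epsilon>" using \<eta>(2)[OF False that(2)] False by simp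
      ultimately show ?thesis by (simp add: abs_divide divide_less_eq less_imp_le)
    qed (simp add: \<upsilon>t \<psi>t)
    have "continuous (at 0 within {-x0..x0}) \<iota>"
      using continuous_on_subset[OF \<iota>c x0I] x0 by (simp add: continuous_on_eq_continuous_within)
    then obtain \<zeta> where \<zeta>: "\<zeta> > 0" "\<And>x. x \<in> {-x0..x0} \<Longrightarrow> dist x 0 < \<zeta> \<Longrightarrow> dist (\<iota> x) (\<iota> 0) < \<eta>"
      using \<eta>(1) unfolding continuous_within_eps_delta by blast
    have \<iota>0: "\<iota> 0 = t" using \<iota>\<psi>[OF tI] \<psi>t by simp
    show "eventually (\<lambda>x. \<bar>f x\<bar> \<le> \<epsilon> * \<bar>x\<bar>) (nhds 0)"
      unfolding eventually_nhds_metric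
    proof (intro exI[of _ "min \<zeta> x0"] conjI allI impI)
      show "min \<zeta> x0 > 0" using \<zeta> x0 by simp
      fix x :: real assume "dist x 0 < min \<zeta> x0"
      then have x: "\<bar>x\<bar> \<le> x0" "dist x 0 < \<zeta>" "x \<in> {-x0..x0}" by (auto simp: dist_real_def)
      show "\<bar>f x\<bar> \<le> \<epsilon> * \<bar>x\<bar>" using est[of "\<iota> x"] \<psi>\<iota>[OF x(1)] \<zeta>(2)[OF x(3,2)] by (simp add: f_def \<iota>0)
    qed
  qed
  moreover have "eventually (\<lambda>y. \<bar>X y\<bar> \<le> x0 \<and> (y \<in> path_image g \<longleftrightarrow> Y y = f (X y))) (nhds (g t))"
  proof -
    have "isCont X (g t)" using continuous_on_cX[OF continuous_on_id, of UNIV "g t" \<tau>] unfolding X_def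
      by (simp add: continuous_on_eq_continuous_at)
    then have "(X \<longlongrightarrow> X (g t)) (nhds (g t))" by (simp add: isCont_def tendsto_at_iff_tendsto_nhds)
    then have "eventually (\<lambda>y. dist (X y) (X (g t)) < x0) (nhds (g t))" using x0 by (rule tendstoD)
    moreover have "eventually (\<lambda>y. y \<notin> g ` ({0..1} - {t-\<delta><..<t+\<delta>})) (nhds (g t))"
    proof -
      have "compact (g ` ({0..1} - {t-\<delta><..<t+\<delta>}))"
        by (intro compact_continuous_image continuous_on_subset[OF gc] compact_diff) auto
      then have "open (- g ` ({0..1} - {t-\<delta><..<t+\<delta>}))" by (intro open_Compl compact_imp_closed)
      moreover have "g t \<in> - g ` ({0..1} - {t-\<delta><..<t+\<delta>})"
        using ginj t \<delta> by (auto dest!: inj_onD)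
      ultimately show ?thesis by (metis (no_types, lifting) Compl_iff eventually_nhds)
    qed
    ultimately show ?thesis
    proof eventually_elim
      case (elim y)
      have Xy: "\<bar>X y\<bar> \<le> x0" using elim(1) by (simp add: X_def dist_real_def)
      have "y \<in> path_image g \<longleftrightarrow> Y y = f (X y)"
      proof
        assume "y \<in> path_image g"
        then obtain r where r: "r \<in> {0..1}" "y = g r" by (auto simp: path_image_def)
        then have "r \<in> I" using elim(2) by (auto simp: I_def)
        then show "Y y = f (X y)" using \<iota>\<psi>[of r] r by (simp add: f_def \<psi>_def \<upsilon>_def)
      next
        assume "Y y = f (X y)"
        then have "X (g (\<iota> (X y))) = X y" "Y (g (\<iota> (X y))) = Y y" using \<psi>\<iota>[OF Xy] by (simp_all add: f_def \<psi>_def \<upsilon>_def)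
        then have "g (\<iota> (X y)) = y" unfolding X_def Y_def using cP_cX_cY[OF \<tau>] by metis
        then show "y \<in> path_image g" using \<psi>\<iota>(2)[OF Xy] I01 by (force simp: path_image_def)
      qed
      then show ?case using Xy by simp
    qed
  qed
  ultimately show ?thesis using x0 by blast
qed

lemma segment_not_in:
  fixes D :: "pt set"
  assumes "closed_segment y z \<inter> frontier D = {}" "y \<notin> D" shows "z \<notin> D"
proof
  assume "z \<in> D"
  then have "closed_segment y z \<inter> frontier D \<noteq> {}"
    using assms(2) by (intro connected_Int_frontier convex_connected convex_closed_segment) auto
  then show False using assms(1) by simp
qed

lemma eventually_notin: "open (- K) \<Longrightarrow> p \<in> - K \<Longrightarrow> eventually (\<lambda>y. y \<notin> K) (nhds p)"
  using eventually_nhds_in_open[of "- K" p] by simp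

text \<open>At an accessible boundary point where all arcs through it meet again on both sides, they are tangent,
  hence graphs over the common tangent; the region above all of them lies outside D, so by
  \<open>graphs_agree_right\<close> they coincide near the point.\<close>

lemma regular_boundary_point:
  fixes D :: "pt set" and \<Gamma> :: "(real \<Rightarrow> pt) set" and \<gamma> :: "real \<Rightarrow> pt"
  assumes D: "open D" "finite (components D)"
    and \<Gamma>: "finite \<Gamma>" "\<And>g. g \<in> \<Gamma> \<Longrightarrow> arc g \<and> g C1_differentiable_on {0..1} \<and> (\<forall>t\<in>{0..1}. vector_derivative g (at t) \<noteq> 0)"
    and fr: "frontier D = (\<Union>g\<in>\<Gamma>. path_image g)"
    and \<gamma>: "\<gamma> \<in> \<Gamma>" and s0: "0 < s0" "s0 < 1"
  defines "p \<equiv> \<gamma> s0" and "\<tau> \<equiv> vector_derivative \<gamma> (at s0)"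
  defines "J \<equiv> {g \<in> \<Gamma>. p \<in> path_image g}"
  assumes ends: "\<And>g. g \<in> J \<Longrightarrow> p \<noteq> g 0 \<and> p \<noteq> g 1"
    and accR: "\<And>e. e > 0 \<Longrightarrow> \<exists>s. s0 < s \<and> s < s0 + e \<and> (\<forall>g\<in>J. \<gamma> s \<in> path_image g)"
    and accL: "\<And>e. e > 0 \<Longrightarrow> \<exists>s. s0 - e < s \<and> s < s0 \<and> (\<forall>g\<in>J. \<gamma> s \<in> path_image g)"
    and u: "cr \<tau> u \<noteq> 0" "\<exists>\<epsilon>>0. \<forall>t\<in>{0<..<\<epsilon>}. p + t *\<^sub>R u \<notin> closure D"
  shows "\<exists>k. k \<noteq> 0 \<and> boundary_tangent D p (k *\<^sub>R \<tau>)"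
    and "\<And>w. cr \<tau> w * cr \<tau> u > 0 \<Longrightarrow> \<exists>\<epsilon>>0. \<forall>t\<in>{0<..<\<epsilon>}. p + t *\<^sub>R w \<notin> closure D"
proof -
  have \<gamma>J: "\<gamma> \<in> J" using \<gamma> s0 by (auto simp: J_def p_def path_image_def)
  have J: "finite J" "J \<subseteq> \<Gamma>" using \<Gamma>(1) by (auto simp: J_def)
  have arcJ: "arc g" "g C1_differentiable_on {0..1}" "\<And>t. t \<in> {0..1} \<Longrightarrow> vector_derivative g (at t) \<noteq> 0" if "g \<in> \<Gamma>" for g
    using \<Gamma>(2)[OF that] by auto
  have \<tau>: "\<tau> \<noteq> 0" using arcJ(3)[OF \<gamma>] s0 by (auto simp: \<tau>_def)
  have s01: "s0 \<in> {0..1}" using s0 by auto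
  have \<gamma>d: "(\<gamma> has_vector_derivative \<tau>) (at s0)"
    unfolding \<tau>_def by (rule C1_has_vector_derivative[OF arcJ(2)[OF \<gamma>] s01])
  have \<gamma>cont: "isCont \<gamma> s0" using \<gamma>d by (rule has_vector_derivative_continuous)
  have tangent: "\<exists>t. 0 < t \<and> t < 1 \<and> g t = p \<and> cr \<tau> (vector_derivative g (at t)) = 0" if g: "g \<in> J" for g
  proof -
    have g\<Gamma>: "g \<in> \<Gamma>" using g J by auto
    have ga: "continuous_on {0..1} g" "inj_on g {0..1}" using arcJ(1)[OF g\<Gamma>] by (auto simp: arc_def path_def)
    obtain t where t: "t \<in> {0..1}" "g t = p" using g by (auto simp: J_def path_image_def)
    have t01: "0 < t" "t < 1" using ends[OF g] t by (auto simp: less_le)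
    \<comment> \<open>Common points of both arcs tending to p; continuity of the inverse of g makes
      their parameters on g converge as well, and \<open>parallel_limit\<close> applies.\<close>
    have "\<forall>n. \<exists>s. s0 < s \<and> s < s0 + min (1 / real (Suc n)) (1 - s0) \<and> \<gamma> s \<in> path_image g"
    proof
      fix n
      have "min (1 / real (Suc n)) (1 - s0) > 0" using s0 by simp
      from accR[OF this] g show "\<exists>s. s0 < s \<and> s < s0 + min (1 / real (Suc n)) (1 - s0) \<and> \<gamma> s \<in> path_image g" by blast
    qed
    from choice[OF this] obtain s where ss: "\<And>n. s0 < s n \<and> s n < s0 + min (1 / real (Suc n)) (1 - s0) \<and> \<gamma> (s n) \<in> path_image g" by blast
    have s: "s0 < s n" "s n < s0 + 1 / real (Suc n)" "\<gamma> (s n) \<in> path_image g" "s n < 1" for n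
      using ss[of n] by auto
    have slim: "s \<longlonglongrightarrow> s0"
    proof (rule tendsto_sandwich)
      show "(\<lambda>n. s0) \<longlonglongrightarrow> s0" by simp
      show "(\<lambda>n. s0 + 1 / real (Suc n)) \<longlonglongrightarrow> s0"
        using tendsto_add[OF tendsto_const LIMSEQ_inverse_real_of_nat, of s0] by (simp add: inverse_eq_divide)
    qed (use s(1,2) in \<open>auto intro!: always_eventually less_imp_le\<close>)
    define r where "r n = inv_into {0..1} g (\<gamma> (s n))" for n
    have s3: "\<gamma> (s n) \<in> g ` {0..1}" for n using s(3)[of n] by (simp add: path_image_def)
    have r: "g (r n) = \<gamma> (s n)" "r n \<in> {0..1}" for n
      unfolding r_def using s3[of n] by (auto simp only: f_inv_into_f inv_into_into)
    have ci: "continuous_on (g ` {0..1}) (inv_into {0..1} g)"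
      by (rule continuous_on_inv[OF ga(1)]) (use ga(2) in auto)
    have pin: "p \<in> g ` {0..1}" using t by auto
    have lim: "(\<lambda>n. \<gamma> (s n)) \<longlonglongrightarrow> p" unfolding p_def by (rule isCont_tendsto_compose[OF \<gamma>cont slim])
    have "(\<lambda>n. inv_into {0..1} g (\<gamma> (s n))) \<longlonglongrightarrow> inv_into {0..1} g p"
      by (rule continuous_on_tendsto_compose[OF ci lim pin]) (use s3 in simp)
    moreover have "inv_into {0..1} g p = t" using inv_into_f_f[OF ga(2) t(1)] t(2) by simp
    ultimately have rlim: "r \<longlonglongrightarrow> t" by (simp add: r_def[abs_def])
    have rne: "r n \<noteq> t" for n
    proof
      assume "r n = t"
      then have "\<gamma> (s n) = \<gamma> s0" using r[of n] t by (simp add: p_def)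
      moreover have "inj_on \<gamma> {0..1}" using arcJ(1)[OF \<gamma>] by (simp add: arc_def)
      moreover have "s n \<in> {0..1}" using s(1,4)[of n] s0 by simp
      ultimately have "s n = s0" using s01 by (auto dest: inj_onD)
      then show False using s(1)[of n] by simp
    qed
    have "cr \<tau> (vector_derivative g (at t)) = 0"
    proof (rule parallel_limit[OF \<gamma>d C1_has_vector_derivative[OF arcJ(2)[OF g\<Gamma>] t(1)] slim _ rlim rne])
      show "s n \<noteq> s0" for n using s(1)[of n] by simp
      show "\<gamma> (s n) = g (r n)" for n using r by simp
      show "\<gamma> s0 = g t" using t by (simp add: p_def)
    qed
    then show ?thesis using t t01 by blast
  qed
  \<comment> \<open>The orientation is chosen so that u points upwards: the accessible side becomes
    the one above the graphs.\<close>
  define \<tau>0 where "\<tau>0 = sgn (cr \<tau> u) *\<^sub>R \<tau>"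
  have \<tau>0: "\<tau>0 \<noteq> 0" using \<tau> u by (simp add: \<tau>0_def sgn_zero_iff)
  have cr0: "cr \<tau>0 w = sgn (cr \<tau> u) * cr \<tau> w" for w by (simp add: \<tau>0_def cr_def algebra_simps)
  let ?X = "cX p \<tau>0" and ?Y = "cY p \<tau>0"
  define Q where "Q g q \<longleftrightarrow> snd q > 0 \<and> continuous_on {-snd q..snd q} (fst q) \<and>
     (\<forall>\<epsilon>>0. eventually (\<lambda>x. \<bar>fst q x\<bar> \<le> \<epsilon> * \<bar>x\<bar>) (nhds 0)) \<and>
     eventually (\<lambda>y. \<bar>?X y\<bar> \<le> snd q \<and> (y \<in> path_image g \<longleftrightarrow> ?Y y = fst q (?X y))) (nhds p)"
    for g :: "real \<Rightarrow> pt" and q :: "(real \<Rightarrow> real) \<times> real"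
  have "\<forall>g\<in>J. \<exists>q. Q g q"
  proof
    fix g assume g: "g \<in> J"
    have g\<Gamma>: "g \<in> \<Gamma>" using g J by auto
    obtain t where t: "0 < t" "t < 1" "g t = p" "cr \<tau> (vector_derivative g (at t)) = 0" using tangent[OF g] by blast
    have 1: "vector_derivative g (at t) \<noteq> 0" using arcJ(3)[OF g\<Gamma>] t by auto
    have 2: "cr \<tau>0 (vector_derivative g (at t)) = 0" using t by (simp add: cr0)
    from arc_local_graph[OF arcJ(1,2)[OF g\<Gamma>] t(1,2) \<tau>0 1 2, unfolded t(3)]
    obtain h x1 where "Q g (h, x1)" unfolding Q_def fst_conv snd_conv by blast
    then show "\<exists>q. Q g q" by blast
  qed
  from bchoice[OF this] obtain q where q: "\<And>g. g \<in> J \<Longrightarrow> Q g (q g)" by blast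
  define f where "f g = fst (q g)" for g
  define x0 where "x0 g = snd (q g)" for g
  have f: "x0 g > 0" "continuous_on {-x0 g..x0 g} (f g)"
    "\<epsilon> > 0 \<Longrightarrow> eventually (\<lambda>x. \<bar>f g x\<bar> \<le> \<epsilon> * \<bar>x\<bar>) (nhds 0)"
    "eventually (\<lambda>y. \<bar>?X y\<bar> \<le> x0 g \<and> (y \<in> path_image g \<longleftrightarrow> ?Y y = f g (?X y))) (nhds p)" if "g \<in> J" for g \<epsilon>
    using q[OF that] unfolding Q_def f_def x0_def by auto
  have far: "eventually (\<lambda>y. y \<notin> path_image g) (nhds p)" if "g \<in> \<Gamma> - J" for g
  proof -
    have "open (- path_image g)" using arcJ(1)[of g] that by (intro open_Compl closed_path_image) (auto simp: arc_imp_path)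
    moreover have "p \<in> - path_image g" using that by (auto simp: J_def)
    ultimately show ?thesis by (metis (no_types, lifting) Compl_iff eventually_nhds)
  qed
  have "eventually (\<lambda>y. (\<forall>g\<in>J. \<bar>?X y\<bar> \<le> x0 g \<and> (y \<in> path_image g \<longleftrightarrow> ?Y y = f g (?X y))) \<and> (\<forall>g\<in>\<Gamma>-J. y \<notin> path_image g)) (nhds p)"
    using f(4) far J(1) \<Gamma>(1) by (intro eventually_conj eventually_ball_finite) auto
  then obtain e where e: "e > 0" "\<And>y g. dist y p < e \<Longrightarrow> g \<in> J \<Longrightarrow> \<bar>?X y\<bar> \<le> x0 g"
    "\<And>y g. dist y p < e \<Longrightarrow> g \<in> J \<Longrightarrow> y \<in> path_image g \<longleftrightarrow> ?Y y = f g (?X y)"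
    "\<And>y g. dist y p < e \<Longrightarrow> g \<in> \<Gamma> - J \<Longrightarrow> y \<notin> path_image g"
    unfolding eventually_nhds_metric by blast
  have frontier_iff: "y \<in> frontier D \<longleftrightarrow> (\<exists>g\<in>J. ?Y y = f g (?X y))" if "dist y p < e" for y
    unfolding fr using e(3,4)[OF that] J(2) by blast
  \<comment> \<open>By \<open>dist_cP_le\<close>, the coordinate box of half-width b lies in the
    ball of radius e.\<close>
  define b where "b = e / (2 * norm \<tau>0)"
  have b: "b > 0" using e \<tau>0 by (simp add: b_def)
  have near: "dist y p < e" if "\<bar>?X y\<bar> < b" "\<bar>?Y y\<bar> < b" for y
  proof -
    have "dist y p \<le> (\<bar>?X y\<bar> + \<bar>?Y y\<bar>) * norm \<tau>0" using dist_cP_le[of p \<tau>0 "?X y" "?Y y"] cP_cX_cY[OF \<tau>0] by simp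
    also have "\<dots> < (b + b) * norm \<tau>0" using that \<tau>0 by (intro mult_strict_right_mono) auto
    also have "\<dots> = e" using \<tau>0 by (simp add: b_def)
    finally show ?thesis .
  qed
  have "eventually (\<lambda>x. \<forall>g\<in>J. \<bar>f g x\<bar> \<le> 1 * \<bar>x\<bar>) (nhds 0)"
    using f(3)[OF _ zero_less_one] J(1) by (intro eventually_ball_finite) auto
  then obtain a0 where a0: "a0 > 0" "\<And>x g. \<bar>x\<bar> < a0 \<Longrightarrow> g \<in> J \<Longrightarrow> \<bar>f g x\<bar> \<le> \<bar>x\<bar>"
    unfolding eventually_nhds_metric by (auto simp: dist_real_def)
  \<comment> \<open>With |f g x| <= |x| this keeps all graphs strictly below height b/2, which
    leaves room for a horizontal segment at that height.\<close>
  define a where "a = min a0 (b/2)"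
  have a: "a > 0" "a \<le> a0" "a \<le> b/2" "a < b" using a0 b by (auto simp: a_def)
  have fa: "\<bar>f g x\<bar> < b/2" if "g \<in> J" "\<bar>x\<bar> < a" for g x using a0(2)[of x g] that a by auto
  define Up where "Up = {y. \<bar>?X y\<bar> < a \<and> \<bar>?Y y\<bar> < b \<and> (\<forall>g\<in>J. f g (?X y) < ?Y y)}"
  \<comment> \<open>Graphs that are o(x) fall below every ray with a strictly positive upward
    component.\<close>
  have Up_ray: "\<exists>\<epsilon>>0. \<forall>t\<in>{0<..<\<epsilon>}. p + t *\<^sub>R w \<in> Up" if w: "cr \<tau>0 w > 0" for w
  proof -
    define A where "A = (w \<bullet> \<tau>0) / (\<tau>0 \<bullet> \<tau>0)"
    define B where "B = cr \<tau>0 w / (\<tau>0 \<bullet> \<tau>0)"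
    have B: "B > 0" using w \<tau>0 by (simp add: B_def)
    define \<epsilon> where "\<epsilon> = B / (2 * (\<bar>A\<bar> + 1))"
    have \<epsilon>: "\<epsilon> > 0" "\<epsilon> * \<bar>A\<bar> < B"
    proof -
      show "\<epsilon> > 0" using B by (simp add: \<epsilon>_def)
      have "B * \<bar>A\<bar> < B * (2 * (\<bar>A\<bar> + 1))" using B by (intro mult_strict_left_mono) auto
      moreover have "2 * (\<bar>A\<bar> + 1) > 0" by simp
      ultimately have "B * \<bar>A\<bar> / (2 * (\<bar>A\<bar> + 1)) < B" by (simp only: pos_divide_less_eq)
      then show "\<epsilon> * \<bar>A\<bar> < B" unfolding \<epsilon>_def by simp
    qed
    have "eventually (\<lambda>x. \<forall>g\<in>J. \<bar>f g x\<bar> \<le> \<epsilon> * \<bar>x\<bar>) (nhds 0)"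
      using f(3) J(1) \<epsilon> by (intro eventually_ball_finite) auto
    then obtain d where d: "d > 0" "\<And>x g. \<bar>x\<bar> < d \<Longrightarrow> g \<in> J \<Longrightarrow> \<bar>f g x\<bar> \<le> \<epsilon> * \<bar>x\<bar>"
      unfolding eventually_nhds_metric by (auto simp: dist_real_def)
    define \<eta> where "\<eta> = min (min d a / (\<bar>A\<bar> + 1)) (b / (B + 1))"
    have \<eta>: "\<eta> > 0" using d a b B by (simp add: \<eta>_def)
    show ?thesis
    proof (intro exI[of _ \<eta>] conjI ballI \<eta>)
      fix t assume t: "t \<in> {0<..<\<eta>}"
      have X: "?X (p + t *\<^sub>R w) = t * A" and Y: "?Y (p + t *\<^sub>R w) = t * B"
        by (simp_all add: cX_ray cY_ray A_def B_def)
      have "t < min d a / (\<bar>A\<bar> + 1)" using t by (simp add: \<eta>_def)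
      then have "t * (\<bar>A\<bar> + 1) < min d a" by (simp add: pos_less_divide_eq)
      moreover have "\<bar>t * A\<bar> \<le> t * (\<bar>A\<bar> + 1)" using t by (simp add: abs_mult)
      ultimately have tA: "\<bar>t * A\<bar> < min d a" by linarith
      have "t < b / (B + 1)" using t by (simp add: \<eta>_def)
      then have "t * (B + 1) < b" using B by (simp add: pos_less_divide_eq)
      then have tB: "\<bar>t * B\<bar> < b" using t B by (simp add: abs_mult distrib_left)
      have "f g (t * A) < t * B" if "g \<in> J" for g
      proof -
        have "\<bar>f g (t * A)\<bar> \<le> t * (\<epsilon> * \<bar>A\<bar>)" using d(2)[of "t * A" g] tA that t by (simp add: abs_mult mult_ac)
        also have "\<dots> < t * B" using t \<epsilon> by (intro mult_strict_left_mono) auto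
        finally show ?thesis by simp
      qed
      then show "p + t *\<^sub>R w \<in> Up" using tA tB by (simp add: Up_def X Y)
    qed
  qed
  have Up_front: "y \<notin> frontier D" if "y \<in> Up" for y
    using frontier_iff[OF near, of y] that a by (force simp: Up_def)
  \<comment> \<open>Any two points of \<open>Up\<close> are joined inside it by going up to height
    b/2, across and down again. No frontier point is met, so membership in D cannot change.\<close>
  have Up_conn: "z \<notin> D" if y: "y \<in> Up" "y \<notin> D" and z: "z \<in> Up" for y z
  proof -
    define h where "h = b/2"
    define y1 where "y1 = cP p \<tau>0 (?X y) h"
    define z1 where "z1 = cP p \<tau>0 (?X z) h"
    have h: "\<bar>h\<bar> < b" using b by (simp add: h_def)
    have conv: "closed_segment q q' \<subseteq> Up"
      if "q \<in> Up" "q' \<in> Up" "?X q = ?X q' \<or> (?Y q = h \<and> ?Y q' = h)" for q q'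
    proof
      fix y assume "y \<in> closed_segment q q'"
      then obtain l where l: "0 \<le> l" "l \<le> 1" "y = (1 - l) *\<^sub>R q + l *\<^sub>R q'" by (auto simp: in_segment)
      have X: "?X y = (1 - l) * ?X q + l * ?X q'" and Y: "?Y y = (1 - l) * ?Y q + l * ?Y q'"
        unfolding l(3) by (rule cX_affine, rule cY_affine)
      have cmb: "(1 - l) * x1 + l * x2 < m" if "x1 < m" "x2 < m" for x1 x2 m :: real
        using convex_bound_lt[OF that, of "1-l" l] l by simp
      have bX: "\<bar>?X y\<bar> < a"
        using cmb[of "?X q" a "?X q'"] cmb[of "- ?X q" a "- ?X q'"] that(1,2) unfolding X Up_def by (auto simp: abs_less_iff)
      have bY: "\<bar>?Y y\<bar> < b"
        using cmb[of "?Y q" b "?Y q'"] cmb[of "- ?Y q" b "- ?Y q'"] that(1,2) unfolding Y Up_def by (auto simp: abs_less_iff)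
      have "f g (?X y) < ?Y y" if g: "g \<in> J" for g
      proof (cases "?X q = ?X q'")
        case True
        then have "?X y = ?X q" unfolding X by (simp add: algebra_simps)
        then show ?thesis using cmb[of "- ?Y q" "- f g (?X q)" "- ?Y q'"] that(1) \<open>q \<in> Up\<close> \<open>q' \<in> Up\<close> True unfolding Y Up_def by auto
      next
        case False
        then have "?Y y = h" unfolding Y using that \<open>?X q = ?X q' \<or> _\<close> by (simp add: algebra_simps)
        then show ?thesis using fa[OF g bX] by (simp add: h_def)
      qed
      then show "y \<in> Up" using bX bY by (simp add: Up_def)
    qed
    have y1: "y1 \<in> Up" "?X y1 = ?X y" "?Y y1 = h" and z1: "z1 \<in> Up" "?X z1 = ?X z" "?Y z1 = h"
      using y z fa h \<tau>0 by (force simp: Up_def y1_def z1_def h_def)+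
    have seg: "q' \<notin> D" if "q \<in> Up" "q' \<in> Up" "?X q = ?X q' \<or> (?Y q = h \<and> ?Y q' = h)" "q \<notin> D" for q q'
      by (rule segment_not_in[OF _ that(4)]) (use conv[OF that(1-3)] Up_front in blast)
    have "y1 \<notin> D" using seg[of y y1] y y1 by simp
    then have "z1 \<notin> D" using seg[of y1 z1] y1 z1 by simp
    then show "z \<notin> D" using seg[of z1 z] z z1 by simp
  qed
  have Up_ext: "y \<notin> D" if "y \<in> Up" for y
  proof -
    have "cr \<tau>0 u > 0" using u by (simp add: cr0 sgn_mult_self_eq flip: abs_sgn)
      (simp add: sgn_if)
    then obtain \<epsilon>1 where 1: "\<epsilon>1 > 0" "\<And>t. t \<in> {0<..<\<epsilon>1} \<Longrightarrow> p + t *\<^sub>R u \<in> Up" using Up_ray by blast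
    obtain \<epsilon>2 where 2: "\<epsilon>2 > 0" "\<And>t. t \<in> {0<..<\<epsilon>2} \<Longrightarrow> p + t *\<^sub>R u \<notin> closure D" using u(2) by blast
    define t where "t = min \<epsilon>1 \<epsilon>2 / 2"
    have t: "t \<in> {0<..<\<epsilon>1}" "t \<in> {0<..<\<epsilon>2}" using 1(1) 2(1) by (auto simp: t_def)
    have "p + t *\<^sub>R u \<notin> D" using 2(2)[OF t(2)] closure_subset by blast
    then show ?thesis using Up_conn 1(2)[OF t(1)] that by blast
  qed
  show "\<exists>\<epsilon>>0. \<forall>t\<in>{0<..<\<epsilon>}. p + t *\<^sub>R w \<notin> closure D" if "cr \<tau> w * cr \<tau> u > 0" for w
  proof -
    have "cr \<tau>0 w > 0" using that by (auto simp: cr0 sgn_if zero_less_mult_iff)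
    then obtain \<epsilon> where "\<epsilon> > 0" "\<And>t. t \<in> {0<..<\<epsilon>} \<Longrightarrow> p + t *\<^sub>R w \<in> Up" using Up_ray by blast
    moreover have "y \<notin> closure D" if "y \<in> Up" for y
      using Up_ext[OF that] Up_front[OF that] D(1) by (simp add: frontier_def interior_open)
    ultimately show ?thesis by blast
  qed
  have cfa: "continuous_on {-a<..<a} (f g)" if "g \<in> J" for g
  proof (rule continuous_on_subset[OF f(2)[OF that]])
    show "{-a<..<a} \<subseteq> {-x0 g..x0 g}"
    proof
      fix x assume "x \<in> {-a<..<a}"
      then have "dist (cP p \<tau>0 x 0) p < e" using a b \<tau>0 by (intro near) auto
      from e(2)[OF this that] show "x \<in> {-x0 g..x0 g}" using \<tau>0 by auto
    qed
  qed
  have onto: "\<exists>y. ?X y = x \<and> ?Y y = \<eta>" for x \<eta> using \<tau>0 by (intro exI[of _ "cP p \<tau>0 x \<eta>"]) simp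
  have cX: "continuous_on UNIV ?X" and cY: "continuous_on UNIV ?Y" by (intro continuous_intros)+
  define \<psi> where "\<psi> s = ?X (\<gamma> s)" for s
  define E where "E x \<longleftrightarrow> (\<forall>i\<in>J. \<forall>j\<in>J. f i x = f j x)" for x
  \<comment> \<open>The sign \<sigma> selects the side of 0. As \<gamma> may run against the chosen
    orientation, the derivative \<kappa> of its abscissa at s0 is 1 or -1 and decides whether
    \<open>accR\<close> or \<open>accL\<close> supplies the point.\<close>
  have acc: "\<exists>x. 0 < \<sigma> * x \<and> \<sigma> * x < \<delta> \<and> E x" if "\<delta> > 0" "\<sigma> = 1 \<or> \<sigma> = -1" for \<delta> \<sigma>
  proof -
    define \<kappa> where "\<kappa> = sgn (cr \<tau> u)"
    have \<kappa>: "\<kappa> = 1 \<or> \<kappa> = -1" using u(1) by (simp add: \<kappa>_def sgn_if)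
    have \<psi>lim: "((\<lambda>s. \<psi> s / (s - s0)) \<longlongrightarrow> \<kappa>) (at s0)"
    proof -
      have "((\<lambda>s. ((\<gamma> s $ 1 - p $ 1) * \<tau>0 $ 1 + (\<gamma> s $ 2 - p $ 2) * \<tau>0 $ 2) / (\<tau>0 \<bullet> \<tau>0)) has_real_derivative
        ((\<tau> $ 1 - 0) * \<tau>0 $ 1 + (\<tau> $ 2 - 0) * \<tau>0 $ 2) / (\<tau>0 \<bullet> \<tau>0)) (at s0)"
        by (intro DERIV_cdivide DERIV_add DERIV_cmult_right DERIV_diff DERIV_const has_real_derivative_nth \<gamma>d)
      moreover have "(\<tau> \<bullet> \<tau>0) / (\<tau>0 \<bullet> \<tau>0) = \<kappa>" using \<kappa> \<tau> by (auto simp: \<tau>0_def \<kappa>_def[symmetric])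
      ultimately have "(\<psi> has_real_derivative \<kappa>) (at s0)"
        by (simp add: \<psi>_def[abs_def] cX_def inner2)
      moreover have "\<psi> s0 = 0" by (simp add: \<psi>_def p_def)
      ultimately show ?thesis by (simp add: has_field_derivative_iff)
    qed
    have "((\<lambda>s. \<kappa> * (\<psi> s / (s - s0))) \<longlongrightarrow> \<kappa> * \<kappa>) (at s0)" by (intro tendsto_intros \<psi>lim)
    moreover have "\<kappa> * \<kappa> > 0" using \<kappa> by auto
    ultimately have ev1: "eventually (\<lambda>s. 0 < \<kappa> * (\<psi> s / (s - s0))) (at s0)" by (rule order_tendstoD(1))
    have \<gamma>lim: "(\<gamma> \<longlongrightarrow> p) (at s0)" using \<gamma>cont by (simp add: isCont_def p_def)
    have ev2: "eventually (\<lambda>s. dist (\<gamma> s) p < e) (at s0)" by (rule tendstoD[OF \<gamma>lim e(1)])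
    have "isCont ?X p" using cX by (simp add: continuous_on_eq_continuous_at)
    then have "((\<lambda>s. ?X (\<gamma> s)) \<longlongrightarrow> ?X p) (at s0)" using \<gamma>lim by (rule isCont_tendsto_compose)
    then have ev3: "eventually (\<lambda>s. \<bar>\<psi> s\<bar> < \<delta>) (at s0)" using tendstoD[OF _ that(1)] by (force simp: \<psi>_def)
    from ev1 ev2 ev3 have "eventually (\<lambda>s. 0 < \<kappa> * (\<psi> s / (s - s0)) \<and> dist (\<gamma> s) p < e \<and> \<bar>\<psi> s\<bar> < \<delta>) (at s0)"
      by eventually_elim simp
    then obtain d where d: "d > 0" "\<And>s. s \<noteq> s0 \<Longrightarrow> dist s s0 < d \<Longrightarrow> 0 < \<kappa> * (\<psi> s / (s - s0)) \<and> dist (\<gamma> s) p < e \<and> \<bar>\<psi> s\<bar> < \<delta>"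
      unfolding eventually_at by auto
    obtain s where s: "s \<noteq> s0" "dist s s0 < d" "\<sigma> * \<kappa> * (s - s0) > 0" "\<forall>g\<in>J. \<gamma> s \<in> path_image g"
    proof (cases "\<sigma> * \<kappa> = 1")
      case True
      obtain s where "s0 < s \<and> s < s0 + d \<and> (\<forall>g\<in>J. \<gamma> s \<in> path_image g)" using accR[OF d(1)] by blast
      then show ?thesis using True by (intro that[of s]) (auto simp: dist_real_def)
    next
      case False
      then have F: "\<sigma> * \<kappa> = -1" using \<kappa> \<open>\<sigma> = 1 \<or> \<sigma> = -1\<close> by auto
      obtain s where "s0 - d < s \<and> s < s0 \<and> (\<forall>g\<in>J. \<gamma> s \<in> path_image g)" using accL[OF d(1)] by blast
      then show ?thesis using F by (intro that[of s]) (auto simp: dist_real_def)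
    qed
    have ds: "0 < \<kappa> * (\<psi> s / (s - s0))" "dist (\<gamma> s) p < e" "\<bar>\<psi> s\<bar> < \<delta>" using d(2)[OF s(1,2)] by auto
    have "E (\<psi> s)" unfolding E_def \<psi>_def using e(3)[OF ds(2)] s(4) by metis
    moreover have "0 < \<sigma> * \<psi> s"
    proof -
      have "0 < (\<sigma> * \<kappa> * (s - s0)) * (\<kappa> * (\<psi> s / (s - s0)))" using s(3) ds(1) by (rule mult_pos_pos)
      also have "\<dots> = \<sigma> * (\<kappa> * \<kappa>) * \<psi> s" using s(1) by (simp add: mult_ac)
      also have "\<kappa> * \<kappa> = 1" using \<kappa> by auto
      finally show ?thesis by simp
    qed
    moreover have "\<sigma> * \<psi> s < \<delta>" using ds(3) that(2) by auto
    ultimately show ?thesis by blast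
  qed
  have right: "\<exists>\<delta>>0. \<forall>x. 0 < x \<and> x < \<delta> \<longrightarrow> (\<forall>i\<in>J. \<forall>j\<in>J. f i x = f j x)"
  proof (rule graphs_agree_right[OF D J(1) cX cY onto a(1) cfa])
    show "\<And>j x. j \<in> J \<Longrightarrow> \<bar>x\<bar> < a \<Longrightarrow> \<bar>f j x\<bar> < b" using fa b by force
    show "\<And>y. \<bar>?X y\<bar> < a \<Longrightarrow> \<bar>?Y y\<bar> < b \<Longrightarrow> y \<in> frontier D \<longleftrightarrow> (\<exists>j\<in>J. ?Y y = f j (?X y))"
      using frontier_iff[OF near] a by force
    show "\<And>y. \<bar>?X y\<bar> < a \<Longrightarrow> \<bar>?Y y\<bar> < b \<Longrightarrow> \<forall>j\<in>J. f j (?X y) < ?Y y \<Longrightarrow> y \<notin> D"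
      using Up_ext by (simp add: Up_def)
    show "\<exists>x>0. x < \<delta> \<and> (\<forall>i\<in>J. \<forall>j\<in>J. f i x = f j x)" if "\<delta> > 0" for \<delta>
      using acc[OF that, of 1] by (auto simp: E_def)
  qed
  \<comment> \<open>The mirror image X to -X reduces this side to the same lemma.\<close>
  have left: "\<exists>\<delta>>0. \<forall>x. 0 < x \<and> x < \<delta> \<longrightarrow> (\<forall>i\<in>J. \<forall>j\<in>J. f i (-x) = f j (-x))"
  proof (rule graphs_agree_right[OF D J(1), where X="\<lambda>y. - ?X y" and Y="?Y" and a=a and b=b])
    show "continuous_on UNIV (\<lambda>y. - ?X y)" using cX by (intro continuous_intros)
    show "\<exists>y. - ?X y = x \<and> ?Y y = \<eta>" for x \<eta> using \<tau>0 by (intro exI[of _ "cP p \<tau>0 (-x) \<eta>"]) simp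
    show "continuous_on {-a<..<a} (\<lambda>x. f j (-x))" if "j \<in> J" for j
      by (rule continuous_on_compose2[OF cfa[OF that]]) (auto intro!: continuous_intros)
    show "\<bar>f j (-x)\<bar> < b" if "j \<in> J" "\<bar>x\<bar> < a" for j x using fa[OF that(1), of "-x"] that b by simp
    show "y \<in> frontier D \<longleftrightarrow> (\<exists>j\<in>J. ?Y y = f j (- (- ?X y)))" if "\<bar>- ?X y\<bar> < a" "\<bar>?Y y\<bar> < b" for y
      using frontier_iff[OF near, of y] a that by simp
    show "\<And>y. \<bar>- ?X y\<bar> < a \<Longrightarrow> \<bar>?Y y\<bar> < b \<Longrightarrow> \<forall>j\<in>J. f j (- (- ?X y)) < ?Y y \<Longrightarrow> y \<notin> D"
      using Up_ext by (simp add: Up_def)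
    show "\<exists>x>0. x < \<delta> \<and> (\<forall>i\<in>J. \<forall>j\<in>J. f i (-x) = f j (-x))" if \<delta>: "\<delta> > 0" for \<delta>
    proof -
      obtain x where x: "0 < -1 * x" "-1 * x < \<delta>" "E x" using acc[OF \<delta>, of "-1"] by auto
      have "\<forall>i\<in>J. \<forall>j\<in>J. f i (-(-x)) = f j (-(-x))" using x(3) unfolding E_def minus_minus .
      moreover have "0 < -x" "-x < \<delta>" using x(1,2) by auto
      ultimately show ?thesis by blast
    qed
  qed (use cY a in auto)
  obtain \<delta>1 where d1: "\<delta>1 > 0" "\<forall>x. 0 < x \<and> x < \<delta>1 \<longrightarrow> E x" using right unfolding E_def[symmetric] by (elim exE conjE)
  obtain \<delta>2 where d2: "\<delta>2 > 0" "\<forall>x. 0 < x \<and> x < \<delta>2 \<longrightarrow> E (-x)" using left unfolding E_def[symmetric] by (elim exE conjE)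
  note \<delta> = d1(1) d2(1)
  have E1: "E x" if "0 < x" "x < \<delta>1" for x using d1(2) that by blast
  have E2: "E (-x)" if "0 < x" "x < \<delta>2" for x using d2(2) that by blast
  have E: "E x" if "\<bar>x\<bar> < min \<delta>1 \<delta>2" for x
  proof -
    have "f g 0 = 0" if "g \<in> J" for g using a0(2)[of 0 g] that a0(1) by simp
    then have "E 0" unfolding E_def by metis
    then show ?thesis using E1[of x] E2[of "-x"] that by (cases "x = 0") (auto simp: abs_if split: if_splits)
  qed
  \<comment> \<open>Rescales a neighbourhood of s0 inside (0, 1) to the interval [-1, 1].\<close>
  define \<kappa> where "\<kappa> = min s0 (1 - s0) / 2"
  have \<kappa>: "\<kappa> > 0" "\<kappa> < s0" "\<kappa> < 1 - s0" using s0 by (auto simp: \<kappa>_def min_def)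
  define \<gamma>1 where "\<gamma>1 t = \<gamma> (s0 + \<kappa> * t)" for t
  have in01: "s0 + \<kappa> * t \<in> {0..1}" if "t \<in> {-1..1}" for t
  proof -
    have "\<bar>\<kappa> * t\<bar> \<le> \<kappa> * 1" unfolding abs_mult using that \<kappa> by (intro mult_mono) auto
    then show ?thesis using \<kappa> by auto
  qed
  have d1: "(\<gamma>1 has_vector_derivative \<kappa> *\<^sub>R vector_derivative \<gamma> (at (s0 + \<kappa> * t))) (at t)" if "t \<in> {-1..1}" for t
  proof -
    have "((\<lambda>t. s0 + \<kappa> * t) has_vector_derivative \<kappa>) (at t)"
      unfolding has_real_derivative_iff_has_vector_derivative[symmetric] by (auto intro!: derivative_eq_intros)
    from vector_diff_chain_at[OF this C1_has_vector_derivative[OF arcJ(2)[OF \<gamma>] in01[OF that]]]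
    show ?thesis by (simp add: \<gamma>1_def[abs_def] comp_def)
  qed
  have \<gamma>1C1: "\<gamma>1 C1_differentiable_on {-1..1}"
    unfolding C1_differentiable_on_def
  proof (intro exI conjI ballI)
    show "(\<gamma>1 has_vector_derivative \<kappa> *\<^sub>R vector_derivative \<gamma> (at (s0 + \<kappa> * t))) (at t)" if "t \<in> {-1..1}" for t
      by (rule d1[OF that])
    have "continuous_on {0..1} (\<lambda>r. vector_derivative \<gamma> (at r))"
      using arcJ(2)[OF \<gamma>] unfolding C1_differentiable_on_eq by blast
    then have "continuous_on {-1..1} (\<lambda>t. vector_derivative \<gamma> (at (s0 + \<kappa> * t)))"
      by (rule continuous_on_compose2) (use in01 in \<open>auto intro!: continuous_intros\<close>)
    then show "continuous_on {-1..1} (\<lambda>t. \<kappa> *\<^sub>R vector_derivative \<gamma> (at (s0 + \<kappa> * t)))" by (intro continuous_intros)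
  qed
  have \<gamma>inj: "inj_on \<gamma> {0..1}" using arcJ(1)[OF \<gamma>] by (simp add: arc_def)
  have \<gamma>1inj: "inj_on \<gamma>1 {-1..1}"
  proof (rule inj_onI)
    fix t t' :: real assume t: "t \<in> {-1..1}" "t' \<in> {-1..1}" and "\<gamma>1 t = \<gamma>1 t'"
    then have "s0 + \<kappa> * t = s0 + \<kappa> * t'" using \<gamma>inj in01[OF t(1)] in01[OF t(2)] unfolding \<gamma>1_def by (blast dest: inj_onD)
    then show "t = t'" using \<kappa> by simp
  qed
  have vd: "vector_derivative \<gamma>1 (at 0) = \<kappa> *\<^sub>R \<tau>"
    using vector_derivative_at[OF d1[of 0]] by (simp add: \<tau>_def)
  have evX: "eventually (\<lambda>y. \<bar>?X y\<bar> < min \<delta>1 \<delta>2) (nhds p)"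
  proof -
    have "isCont ?X p" using cX by (simp add: continuous_on_eq_continuous_at)
    then have "(?X \<longlongrightarrow> ?X p) (nhds p)" by (simp only: isCont_def tendsto_at_iff_tendsto_nhds)
    then show ?thesis using tendstoD[of ?X "?X p" "nhds p" "min \<delta>1 \<delta>2"] \<delta> by (simp add: dist_real_def)
  qed
  have evG: "eventually (\<lambda>y. y \<notin> \<gamma> ` ({0..1} - {s0-\<kappa><..<s0+\<kappa>})) (nhds p)"
  proof -
    have "continuous_on {0..1} \<gamma>" using arcJ(1)[OF \<gamma>] by (simp add: arc_def path_def)
    then have "compact (\<gamma> ` ({0..1} - {s0-\<kappa><..<s0+\<kappa>}))"
      by (intro compact_continuous_image compact_diff) (auto intro: continuous_on_subset)
    then have "open (- \<gamma> ` ({0..1} - {s0-\<kappa><..<s0+\<kappa>}))" by (intro open_Compl compact_imp_closed)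
    moreover have "p \<in> - \<gamma> ` ({0..1} - {s0-\<kappa><..<s0+\<kappa>})"
    proof
      assume "p \<in> \<gamma> ` ({0..1} - {s0-\<kappa><..<s0+\<kappa>})"
      then obtain r where "r \<in> {0..1}" "r \<notin> {s0-\<kappa><..<s0+\<kappa>}" "\<gamma> s0 = \<gamma> r" by (auto simp: p_def)
      moreover then have "r = s0" using \<gamma>inj s01 by (metis inj_onD)
      ultimately show False using \<kappa> by simp
    qed
    ultimately show ?thesis by (rule eventually_notin)
  qed
  have "eventually (\<lambda>y. dist y p < e) (nhds p)" using e(1) by (auto simp: eventually_nhds_metric)
  with evX evG have "eventually (\<lambda>y. \<bar>?X y\<bar> < min \<delta>1 \<delta>2 \<and> y \<notin> \<gamma> ` ({0..1} - {s0-\<kappa><..<s0+\<kappa>}) \<and> dist y p < e) (nhds p)"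
    by eventually_elim simp
  then obtain e3 where e3: "e3 > 0" "\<And>y. dist y p < e3 \<Longrightarrow> \<bar>?X y\<bar> < min \<delta>1 \<delta>2 \<and> y \<notin> \<gamma> ` ({0..1} - {s0-\<kappa><..<s0+\<kappa>}) \<and> dist y p < e"
    unfolding eventually_nhds_metric by blast
  have "y \<in> frontier D \<longleftrightarrow> y \<in> \<gamma>1 ` {-1..1}" if y: "dist y p < e3" for y
  proof
    note y3 = conjunct1[OF e3(2)[OF y]] conjunct1[OF conjunct2[OF e3(2)[OF y]]] conjunct2[OF conjunct2[OF e3(2)[OF y]]]
    assume "y \<in> frontier D"
    then obtain g where g: "g \<in> J" "?Y y = f g (?X y)" using frontier_iff[OF y3(3)] by blast
    have "E (?X y)" by (rule E[OF y3(1)])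
    then have "?Y y = f \<gamma> (?X y)" using g \<gamma>J unfolding E_def by metis
    then have "y \<in> path_image \<gamma>" using e(3)[OF y3(3) \<gamma>J] by blast
    then obtain r where r: "r \<in> {0..1}" "y = \<gamma> r" by (auto simp: path_image_def)
    then have "r \<in> {s0-\<kappa><..<s0+\<kappa>}" using y3(2) by blast
    then have "(r - s0) / \<kappa> \<in> {-1..1}" "s0 + \<kappa> * ((r - s0) / \<kappa>) = r" using \<kappa>(1) by (auto simp: field_simps)
    then have "y = \<gamma>1 ((r - s0) / \<kappa>)" "(r - s0) / \<kappa> \<in> {-1..1}" unfolding r(2) \<gamma>1_def by simp_all
    then show "y \<in> \<gamma>1 ` {-1..1}" by (rule image_eqI)
  next
    assume "y \<in> \<gamma>1 ` {-1..1}"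
    then obtain t where "t \<in> {-1..1}" "y = \<gamma>1 t" by blast
    then have "y \<in> path_image \<gamma>" using in01 by (auto simp: \<gamma>1_def path_image_def)
    then show "y \<in> frontier D" unfolding fr using \<gamma> by blast
  qed
  then have "frontier D \<inter> ball p e3 = \<gamma>1 ` {-1..1} \<inter> ball p e3" by (auto simp: dist_commute)
  then have "boundary_tangent D p (\<kappa> *\<^sub>R \<tau>)"
    unfolding boundary_tangent_def using \<kappa> \<tau> e3(1) \<gamma>1C1 \<gamma>1inj vd
    by (intro conjI exI[of _ \<gamma>1] exI[of _ e3]) (auto simp: \<gamma>1_def p_def)
  then show "\<exists>k. k \<noteq> 0 \<and> boundary_tangent D p (k *\<^sub>R \<tau>)" using \<kappa>(1) by (intro exI[of _ \<kappa>]) simp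
qed

section \<open>Parametrization of the boundary and conclusion\<close>

text \<open>Gluing pieces by a sum of indicators makes the glued function measurable when each piece
  is continuous on a Borel set.\<close>

lemma sum_indicator_disjoint:
  fixes h :: "nat \<Rightarrow> 'b \<Rightarrow> 'a::real_vector"
  assumes "i < n" "s \<in> B i" "\<And>j. j < n \<Longrightarrow> s \<in> B j \<Longrightarrow> j = i"
  shows "(\<Sum>j<n. indicator (B j) s *\<^sub>R h j s) = h i s"
proof -
  have "(\<Sum>j<n. indicator (B j) s *\<^sub>R h j s) = (\<Sum>j<n. if j = i then h i s else 0)"
  proof (rule sum.cong)
    fix j assume j: "j \<in> {..<n}"
    show "indicator (B j) s *\<^sub>R h j s = (if j = i then h i s else 0)"
    proof (cases "j = i")
      case False
      then have "s \<notin> B j" using assms(3)[of j] j by blast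
      then show ?thesis using False by simp
    qed (simp add: assms(2))
  qed simp
  then show ?thesis using assms(1) by simp
qed

text \<open>The arcs are laid out on disjoint intervals, and from each one the points covered by
  earlier arcs are removed, which makes G injective. The tangent has to be a function of the
  boundary point, so the parameter is recovered by inverting the arc that owns the point.\<close>

lemma boundary_parametrization:
  fixes \<Gamma> :: "(real \<Rightarrow> pt) set"
  assumes fin: "finite \<Gamma>" and arcs: "\<And>g. g \<in> \<Gamma> \<Longrightarrow> arc g \<and> g C1_differentiable_on {0..1} \<and> (\<forall>t\<in>{0..1}. vector_derivative g (at t) \<noteq> 0)"
  obtains A G tn M where "A \<in> sets borel" "\<forall>s\<in>A. \<bar>s\<bar> \<le> M" "G \<in> borel_measurable borel"
    "\<forall>s\<in>A. (G has_vector_derivative tn (G s)) (at s within A)" "tn \<in> borel_measurable borel"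
    "\<forall>s\<in>A. norm (tn (G s)) \<le> M" "inj_on G A" "G ` A = (\<Union>g\<in>\<Gamma>. path_image g)"
    "\<forall>x\<in>G ` A. \<exists>g\<in>\<Gamma>. \<exists>t\<in>{0..1}. x = g t \<and> tn x = vector_derivative g (at t)"
proof -
  obtain n g where \<Gamma>: "\<Gamma> = g ` {i::nat. i < n}" using finite_imp_nat_seg_image_inj_on[OF fin] by blast
  have g: "arc (g i)" "g i C1_differentiable_on {0..1}" if "i < n" for i using arcs[of "g i"] \<Gamma> that by auto
  have gc: "continuous_on {0..1} (g i)" and gi: "inj_on (g i) {0..1}" if "i < n" for i
    using g(1)[OF that] by (auto simp: arc_def path_def)
  define g' where "g' i r = vector_derivative (g i) (at r)" for i r
  have g'c: "continuous_on {0..1} (g' i)" if "i < n" for i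
    using g(2)[OF that] unfolding C1_differentiable_on_eq g'_def by blast
  \<comment> \<open>Unit intervals with gaps of length 1: parameters closer than 1/2 belong to the
    same arc, so G agrees locally with a single \<open>h i\<close>.\<close>
  define d where "d i = 2 * real i + 1/2" for i
  define h where "h i s = g i (s - d i)" for i s
  define I where "I i = {d i..d i + 1}" for i
  have sI: "s - d i \<in> {0..1}" if "s \<in> I i" for s i using that by (auto simp: I_def)
  have hc: "continuous_on (I i) (h i)" if "i < n" for i
    unfolding h_def by (rule continuous_on_compose2[OF gc[OF that]]) (auto intro!: continuous_intros simp: I_def)
  have hderiv: "(h i has_vector_derivative g' i (s - d i)) (at s)" if "i < n" "s \<in> I i" for i s
  proof -
    have "((\<lambda>s. s - d i) has_vector_derivative 1) (at s)"
      unfolding has_real_derivative_iff_has_vector_derivative[symmetric] by (auto intro!: derivative_eq_intros)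
    from vector_diff_chain_at[OF this C1_has_vector_derivative[OF g(2)[OF that(1)] sI[OF that(2)]]]
    show ?thesis by (simp add: h_def[abs_def] comp_def g'_def)
  qed
  have sep: "i = j" if "s \<in> I i" "s' \<in> I j" "\<bar>s - s'\<bar> < 1/2" for s s' i j
  proof (rule ccontr)
    assume "i \<noteq> j"
    then have "real i + 1 \<le> real j \<or> real j + 1 \<le> real i" by linarith
    then show False using that by (auto simp: I_def d_def)
  qed
  define P where "P i = (\<Union>j<i. path_image (g j))" for i
  have Pclosed: "closed (P i)" if "i \<le> n" for i
    unfolding P_def using that g(1) by (intro closed_UN ballI closed_path_image arc_imp_path) auto
  define A where "A i = I i - (I i \<inter> h i -` P i)" for i
  have Ab: "A i \<in> sets borel" if "i < n" for i
  proof -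
    have "closed (I i \<inter> h i -` P i)" using hc[OF that] Pclosed[of i] that by (intro continuous_closed_preimage) (auto simp: I_def)
    moreover have "closed (I i)" by (simp add: I_def)
    ultimately show ?thesis unfolding A_def by (intro sets.Diff borel_closed)
  qed
  define K where "K i = path_image (g i) - P i" for i
  have Kb: "K i \<in> sets borel" if "i < n" for i
    unfolding K_def using Pclosed[of i] that g(1)[OF that] by (intro sets.Diff borel_closed closed_path_image arc_imp_path) auto
  have Kdisj: "j = i" if "x \<in> K i" "x \<in> K j" for i j x
    using that by (cases i j rule: linorder_cases) (auto simp: K_def P_def)
  define \<sigma> where "\<sigma> i = inv_into {0..1} (g i)" for i
  define G where "G s = (\<Sum>i<n. indicator (A i) s *\<^sub>R h i s)" for s
  define tn where "tn x = (\<Sum>i<n. indicator (K i) x *\<^sub>R g' i (\<sigma> i x))" for x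
  define AA where "AA = (\<Union>i<n. A i)"
  have AI: "A i \<subseteq> I i" for i by (auto simp: A_def)
  have G_eq: "G s = h i s" if "i < n" "s \<in> A i" for i s
    unfolding G_def using that AI by (intro sum_indicator_disjoint) (auto intro!: sep[of s _ s])
  have hK: "h i s \<in> K i" "\<sigma> i (h i s) = s - d i" if "i < n" "s \<in> A i" for i s
  proof -
    have sI': "s \<in> I i" using that AI by auto
    then show "h i s \<in> K i" using that sI[OF sI'] by (auto simp: K_def A_def h_def path_image_def)
    show "\<sigma> i (h i s) = s - d i" unfolding \<sigma>_def h_def by (rule inv_into_f_f[OF gi[OF that(1)] sI[OF sI']])
  qed
  have tn_eq: "tn x = g' i (\<sigma> i x)" if "i < n" "x \<in> K i" for i x
    unfolding tn_def using that Kdisj by (intro sum_indicator_disjoint) auto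
  have tnG: "tn (G s) = g' i (s - d i)" if "i < n" "s \<in> A i" for i s
    using tn_eq[OF that(1) hK(1)[OF that]] hK(2)[OF that] G_eq[OF that] by simp
  have AAb: "AA \<in> sets borel" unfolding AA_def using Ab by (intro sets.finite_UN) auto
  have Gm: "G \<in> borel_measurable borel"
    unfolding G_def[abs_def]
    by (intro borel_measurable_sum borel_measurable_continuous_on_indicator Ab) (auto intro: continuous_on_subset[OF hc AI])
  have tnm: "tn \<in> borel_measurable borel"
    unfolding tn_def[abs_def]
  proof (intro borel_measurable_sum borel_measurable_continuous_on_indicator)
    fix i assume "i \<in> {..<n}"
    then have i: "i < n" by simp
    show "K i \<in> sets borel" by (rule Kb[OF i])
    have "continuous_on (g i ` {0..1}) (\<sigma> i)" unfolding \<sigma>_def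
      by (rule continuous_on_inv[OF gc[OF i]]) (use gi[OF i] in auto)
    then have "continuous_on (K i) (\<sigma> i)" by (rule continuous_on_subset) (auto simp: K_def path_image_def)
    moreover have "\<sigma> i ` K i \<subseteq> {0..1}" unfolding \<sigma>_def K_def path_image_def using inv_into_into[of _ "g i" "{0..1}"] by blast
    ultimately show "continuous_on (K i) (\<lambda>x. g' i (\<sigma> i x))" by (rule continuous_on_compose2[OF g'c[OF i]])
  qed
  have "\<exists>B. \<forall>i<n. \<forall>r\<in>{0..1}. norm (g' i r) \<le> B"
  proof -
    have "\<exists>B. \<forall>r\<in>{0..1}. norm (g' i r) \<le> B" if "i < n" for i
    proof -
      have "bounded (g' i ` {0..1})" using g'c[OF that] by (intro compact_imp_bounded compact_continuous_image) auto
      then show ?thesis by (auto simp: bounded_iff)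
    qed
    then obtain B where B: "\<And>i r. i < n \<Longrightarrow> r \<in> {0..1} \<Longrightarrow> norm (g' i r) \<le> B i" by metis
    have "B i \<le> Max (insert 0 (B ` {..<n}))" if "i < n" for i using that by (intro Max_ge) auto
    then show ?thesis using B by (intro exI[of _ "Max (insert 0 (B ` {..<n}))"]) (meson order_trans)
  qed
  then obtain B where B: "\<And>i r. i < n \<Longrightarrow> r \<in> {0..1} \<Longrightarrow> norm (g' i r) \<le> B" by blast
  define M where "M = max B (2 * real n + 2)"
  have AAD: "\<exists>i<n. s \<in> A i" if "s \<in> AA" for s using that by (auto simp: AA_def)
  have "\<bar>s\<bar> \<le> M" if sA: "s \<in> AA" for s
  proof -
    obtain i where i: "i < n" "s \<in> A i" using AAD[OF sA] by blast
    then have "s \<in> I i" using AI by auto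
    moreover have "real i \<le> real n" using i by simp
    ultimately have "\<bar>s\<bar> \<le> 2 * real n + 2" unfolding I_def d_def by auto
    then show ?thesis by (simp add: M_def)
  qed
  moreover have "(G has_vector_derivative tn (G s)) (at s within AA)" if sA: "s \<in> AA" for s
  proof -
    obtain i where i: "i < n" "s \<in> A i" using AAD[OF sA] by blast
    have sI': "s \<in> I i" using i AI by auto
    show ?thesis
    proof (rule has_vector_derivative_transform_within)
      show "(h i has_vector_derivative tn (G s)) (at s within AA)"
        unfolding tnG[OF i] using hderiv[OF i(1) sI'] by (rule has_vector_derivative_at_within)
      show "(0::real) < 1/2" by simp
      show "s \<in> AA" by (rule sA)
      show "h i s' = G s'" if s': "s' \<in> AA" "dist s' s < 1/2" for s'
      proof -
        obtain j where j: "j < n" "s' \<in> A j" using AAD[OF s'(1)] by blast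
        have "i = j" using sep[OF sI', of s' j] j AI s'(2) by (auto simp: dist_real_def abs_minus_commute)
        then show ?thesis using G_eq[OF j] by simp
      qed
    qed
  qed
  moreover have "norm (tn (G s)) \<le> M" if sA: "s \<in> AA" for s
  proof -
    obtain i where i: "i < n" "s \<in> A i" using AAD[OF sA] by blast
    then have "s \<in> I i" using AI by auto
    have "norm (g' i (s - d i)) \<le> B" by (rule B[OF i(1) sI]) fact
    then show ?thesis using tnG[OF i] by (simp add: M_def)
  qed
  moreover have "inj_on G AA"
  proof (rule inj_onI)
    fix s s' assume s: "s \<in> AA" "s' \<in> AA" and eq: "G s = G s'"
    obtain i where i: "i < n" "s \<in> A i" using AAD[OF s(1)] by blast
    obtain j where j: "j < n" "s' \<in> A j" using AAD[OF s(2)] by blast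
    have eq': "h i s = h j s'" using eq G_eq[OF i] G_eq[OF j] by simp
    then have "i = j" using Kdisj[of "h i s" j i] hK(1)[OF i] hK(1)[OF j] by simp
    then have "\<sigma> i (h i s) = \<sigma> j (h j s')" using eq' by (simp only:)
    then show "s = s'" unfolding hK(2)[OF i] hK(2)[OF j] using \<open>i = j\<close> by simp
  qed
  moreover have "G ` AA = (\<Union>g\<in>\<Gamma>. path_image g)"
  proof (intro equalityI subsetI)
    fix x assume "x \<in> G ` AA"
    then obtain s where s: "s \<in> AA" "x = G s" by blast
    obtain i where i: "i < n" "s \<in> A i" using AAD[OF s(1)] by blast
    then have "x \<in> path_image (g i)" using hK(1)[OF i] G_eq[OF i] s by (auto simp: K_def)
    then show "x \<in> (\<Union>g\<in>\<Gamma>. path_image g)" using \<Gamma> i by auto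
  next
    fix x assume "x \<in> (\<Union>g\<in>\<Gamma>. path_image g)"
    then have ex: "\<exists>i. i < n \<and> x \<in> path_image (g i)" using \<Gamma> by auto
    define i where "i = (LEAST i. i < n \<and> x \<in> path_image (g i))"
    have i: "i < n" "x \<in> path_image (g i)" using LeastI_ex[OF ex] by (auto simp: i_def)
    have "x \<notin> P i" using not_less_Least[of _ "\<lambda>i. i < n \<and> x \<in> path_image (g i)", folded i_def] i(1) by (auto simp: P_def)
    obtain r where r: "r \<in> {0..1}" "x = g i r" using i(2) by (auto simp: path_image_def)
    have "r + d i \<in> A i" using r \<open>x \<notin> P i\<close> by (auto simp: A_def I_def h_def)
    then have "r + d i \<in> AA" "G (r + d i) = x" using i(1) G_eq[OF i(1)] r by (auto simp: AA_def h_def)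
    then show "x \<in> G ` AA" by (metis imageI)
  qed
  moreover have "\<exists>g\<in>\<Gamma>. \<exists>t\<in>{0..1}. x = g t \<and> tn x = vector_derivative g (at t)" if "x \<in> G ` AA" for x
  proof -
    obtain s where s: "s \<in> AA" "x = G s" using \<open>x \<in> G ` AA\<close> by blast
    obtain i where i: "i < n" "s \<in> A i" using AAD[OF s(1)] by blast
    have "s - d i \<in> {0..1}" using i AI by (intro sI) auto
    moreover have "x = g i (s - d i)" using s G_eq[OF i] by (simp add: h_def)
    moreover have "tn x = vector_derivative (g i) (at (s - d i))" using tnG[OF i] s by (simp add: g'_def)
    moreover have "g i \<in> \<Gamma>" using \<Gamma> i by auto
    ultimately show ?thesis by blast
  qed
  ultimately show thesis using AAb Gm tnm by (intro that[of AA M G tn] ballI)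
qed

section \<open>One-sided isolated parameters\<close>

text \<open>Each such point is followed by a gap of Z; rational numbers chosen in these gaps are
  distinct.\<close>

lemma countable_right_isolated: "countable {s \<in> Z. \<exists>e>0. \<forall>s'\<in>Z. \<not> (s < s' \<and> s' < s + e)}" for Z :: "real set"
proof -
  let ?S = "{s \<in> Z. \<exists>e>0. \<forall>s'\<in>Z. \<not> (s < s' \<and> s' < s + e)}"
  have "\<exists>q. s < of_rat q \<and> (\<forall>s'\<in>Z. s < s' \<longrightarrow> of_rat q < s')" if sS: "s \<in> ?S" for s
  proof -
    from sS have "\<exists>e>0. \<forall>s'\<in>Z. \<not> (s < s' \<and> s' < s + e)" by simp
    then obtain e where e: "e > 0" "\<forall>s'\<in>Z. \<not> (s < s' \<and> s' < s + e)" by blast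
    obtain q where "s < of_rat q" "of_rat q < s + e" using of_rat_dense[of s "s+e"] e by auto
    then have "\<forall>s'\<in>Z. s < s' \<longrightarrow> of_rat q < s'" using e(2) by force
    then show ?thesis using \<open>s < of_rat q\<close> by blast
  qed
  then have "\<forall>s\<in>?S. \<exists>q. s < of_rat q \<and> (\<forall>s'\<in>Z. s < s' \<longrightarrow> of_rat q < s')" by blast
  from bchoice[OF this] obtain q where q: "\<forall>s\<in>?S. s < of_rat (q s) \<and> (\<forall>s'\<in>Z. s < s' \<longrightarrow> of_rat (q s) < s')" by blast
  have lt: "q s \<noteq> q s'" if "s \<in> ?S" "s' \<in> ?S" "s < s'" for s s'
  proof -
    have "of_rat (q s) < s'" using bspec[OF q that(1)] that(2,3) by blast
    also have "s' < of_rat (q s')" using bspec[OF q that(2)] by blast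
    finally show ?thesis by auto
  qed
  have "inj_on q ?S"
  proof (rule inj_onI)
    fix s s' assume "s \<in> ?S" "s' \<in> ?S" "q s = q s'"
    then show "s = s'" using lt[of s s'] lt[of s' s] by (cases s s' rule: linorder_cases) simp_all
  qed
  then show ?thesis by (rule countable_image_inj_on[rotated]) (rule countableI_type)
qed

lemma countable_left_isolated: "countable {s \<in> Z. \<exists>e>0. \<forall>s'\<in>Z. \<not> (s - e < s' \<and> s' < s)}" for Z :: "real set"
proof (rule countable_subset)
  let ?S = "{s \<in> uminus ` Z. \<exists>e>0. \<forall>s'\<in>uminus ` Z. \<not> (s < s' \<and> s' < s + e)}"
  show "countable (uminus ` ?S)" by (intro countable_image countable_right_isolated)
  show "{s \<in> Z. \<exists>e>0. \<forall>s'\<in>Z. \<not> (s - e < s' \<and> s' < s)} \<subseteq> uminus ` ?S"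
  proof
    fix s assume "s \<in> {s \<in> Z. \<exists>e>0. \<forall>s'\<in>Z. \<not> (s - e < s' \<and> s' < s)}"
    then obtain e where s: "s \<in> Z" and e: "e > 0" "\<forall>s'\<in>Z. \<not> (s - e < s' \<and> s' < s)" by blast
    have "\<forall>s'\<in>uminus ` Z. \<not> (- s < s' \<and> s' < - s + e)"
    proof
      fix s' assume "s' \<in> uminus ` Z"
      then have "- s' \<in> Z" by auto
      then show "\<not> (- s < s' \<and> s' < - s + e)" using bspec[OF e(2), of "- s'"] by linarith
    qed
    then have "- s \<in> ?S" using s e(1) by blast
    then show "s \<in> uminus ` ?S" by (rule rev_image_eqI) simp
  qed
qed

lemma mean_resistance_ge:
  fixes D :: "pt set" and c :: pt and R :: real
  assumes pd: "planar_domain D" and R: "R > 0" and DR: "D \<subseteq> cball c R" and pos: "measure lebesgue (closure D) > 0"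
  shows "pi / 2 * (measure lebesgue (closure D))\<^sup>2 / R^3 \<le> mean_resistance D"
proof -
  have D: "open D" "bounded D" "finite (components D)" using pd by (auto simp: planar_domain_def)
  obtain \<Gamma> where \<Gamma>: "finite \<Gamma>" "\<And>g. g \<in> \<Gamma> \<Longrightarrow> arc g \<and> g C1_differentiable_on {0..1} \<and> (\<forall>t\<in>{0..1}. vector_derivative g (at t) \<noteq> 0)"
    and fr: "frontier D = (\<Union>g\<in>\<Gamma>. path_image g)"
    using pd unfolding planar_domain_def piecewise_smooth_boundary_def by blast
  obtain A G tn M where
    A: "A \<in> sets borel" "\<forall>s\<in>A. \<bar>s\<bar> \<le> M" and G: "G \<in> borel_measurable borel"
    "\<forall>s\<in>A. (G has_vector_derivative tn (G s)) (at s within A)" and tn: "tn \<in> borel_measurable borel"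
    "\<forall>s\<in>A. norm (tn (G s)) \<le> M" and inj: "inj_on G A" and img: "G ` A = (\<Union>g\<in>\<Gamma>. path_image g)" and
    tng: "\<forall>x\<in>G ` A. \<exists>g\<in>\<Gamma>. \<exists>t\<in>{0..1}. x = g t \<and> tn x = vector_derivative g (at t)"
    by (rule boundary_parametrization[OF \<Gamma>])
  \<comment> \<open>The parameters at which g meets every arc of J. Discarding endpoints and the
    points isolated on one side, for each of the finitely many J, costs countably many points and
    leaves those where \<open>accR\<close> and \<open>accL\<close> hold.\<close>
  define Z where "Z g J = {s\<in>{0..1::real}. \<forall>g'\<in>J. g s \<in> path_image g'}" for g :: "real \<Rightarrow> pt" and J :: "(real \<Rightarrow> pt) set"
  define ZR where "ZR g J = {s \<in> Z g J. \<exists>e>0. \<forall>s'\<in>Z g J. \<not> (s < s' \<and> s' < s + e)}" for g J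
  define ZL where "ZL g J = {s \<in> Z g J. \<exists>e>0. \<forall>s'\<in>Z g J. \<not> (s - e < s' \<and> s' < s)}" for g J
  define N0 where "N0 = (\<Union>g\<in>\<Gamma>. g ` ({0, 1} \<union> (\<Union>J\<in>Pow \<Gamma>. ZR g J \<union> ZL g J)))"
  have N0: "countable N0"
    unfolding N0_def ZR_def ZL_def using \<Gamma>(1)
    by (intro countable_UN countable_image countable_Un countable_right_isolated countable_left_isolated) (auto intro: countable_finite)
  have local: "(\<exists>k. k \<noteq> 0 \<and> boundary_tangent D x (k *\<^sub>R tn x)) \<and>
      (\<forall>w. cr (tn x) w * cr (tn x) u > 0 \<longrightarrow> (\<exists>\<epsilon>>0. \<forall>t\<in>{0<..<\<epsilon>}. x + t *\<^sub>R w \<notin> closure D))"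
    if x: "x \<in> G ` A" "x \<notin> N0" and u: "cr (tn x) u \<noteq> 0" "\<exists>\<epsilon>>0. \<forall>t\<in>{0<..<\<epsilon>}. x + t *\<^sub>R u \<notin> closure D" for x u
  proof -
    obtain g t where g: "g \<in> \<Gamma>" "t \<in> {0..1}" "x = g t" and tx: "tn x = vector_derivative g (at t)" using tng x(1) by blast
    have ends: "x \<noteq> g' 0 \<and> x \<noteq> g' 1" if "g' \<in> \<Gamma>" for g'
      using x(2) that unfolding N0_def by blast
    have t: "0 < t" "t < 1" using ends[OF g(1)] g(2,3) by (auto simp: less_le)
    let ?J = "{g' \<in> \<Gamma>. g t \<in> path_image g'}"
    have "t \<in> Z g ?J" using g by (auto simp: Z_def)
    moreover have "t \<notin> ZR g ?J" "t \<notin> ZL g ?J"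
    proof -
      have "?J \<in> Pow \<Gamma>" by blast
      moreover have "x \<notin> g ` (\<Union>J\<in>Pow \<Gamma>. ZR g J \<union> ZL g J)" using x(2) g(1) unfolding N0_def by blast
      ultimately show "t \<notin> ZR g ?J" "t \<notin> ZL g ?J" using g(3) by blast+
    qed
    ultimately have R: "\<exists>s'\<in>Z g ?J. t < s' \<and> s' < t + e" and L: "\<exists>s'\<in>Z g ?J. t - e < s' \<and> s' < t" if "e > 0" for e
      using that unfolding ZR_def ZL_def by blast+
    have accR: "\<exists>s. t < s \<and> s < t + e \<and> (\<forall>g'\<in>?J. g s \<in> path_image g')" if "e > 0" for e
      using R[OF that] unfolding Z_def by blast
    have accL: "\<exists>s. t - e < s \<and> s < t \<and> (\<forall>g'\<in>?J. g s \<in> path_image g')" if "e > 0" for e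
      using L[OF that] unfolding Z_def by blast
    have e: "g t \<noteq> g' 0 \<and> g t \<noteq> g' 1" if "g' \<in> ?J" for g' using ends[of g'] that g(3) by blast
    have u': "cr (vector_derivative g (at t)) u \<noteq> 0" "\<exists>\<epsilon>>0. \<forall>s\<in>{0<..<\<epsilon>}. g t + s *\<^sub>R u \<notin> closure D"
      using u[unfolded tx, unfolded g(3)] .
    have "\<exists>k. k \<noteq> 0 \<and> boundary_tangent D (g t) (k *\<^sub>R vector_derivative g (at t))"
      by (rule regular_boundary_point(1)[where \<Gamma>=\<Gamma> and u=u]; fact D \<Gamma> fr g(1) t e accR accL u')
    moreover have "\<exists>\<epsilon>>0. \<forall>s\<in>{0<..<\<epsilon>}. g t + s *\<^sub>R w \<notin> closure D"
      if w: "cr (vector_derivative g (at t)) w * cr (vector_derivative g (at t)) u > 0" for w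
      by (rule regular_boundary_point(2)[where \<Gamma>=\<Gamma> and u=u]; fact D \<Gamma> fr g(1) t e accR accL u' w)
    ultimately show ?thesis unfolding tx unfolding g(3) by blast
  qed
  interpret domain_billiard D A G tn N0 c R M
  proof unfold_locales
    show "compact (closure D)" using D by (simp add: compact_closure)
    show "closure D \<subseteq> cball c R" using DR by (rule closure_minimal) simp
    \<comment> \<open>The inclusion may be strict: cracks of D lie in the interior of its
      closure.\<close>
    show "frontier (closure D) \<subseteq> G ` A" 
      using interior_mono[OF closure_subset[of D]] unfolding img fr[symmetric] frontier_def by auto
    show "G ` A \<subseteq> closure D" using fr img by (auto simp: frontier_def)
    show "G ` A = frontier D" using fr img by simp
    show "tn (G s) \<noteq> 0" if "s \<in> A" for s
    proof -
      obtain g t where "g \<in> \<Gamma>" "t \<in> {0..1}" "tn (G s) = vector_derivative g (at t)" using tng \<open>s \<in> A\<close> by blast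
      then show ?thesis using \<Gamma>(2)[of g] by auto
    qed
    show "\<exists>\<epsilon>>0. \<forall>t\<in>{0<..<\<epsilon>}. x + t *\<^sub>R w \<notin> closure D"
      if "x \<in> G ` A" "x \<notin> N0" "\<exists>\<epsilon>>0. \<forall>t\<in>{0<..<\<epsilon>}. x + t *\<^sub>R u \<notin> closure D" "0 < cr (tn x) w * cr (tn x) u" for x u w
    proof -
      have "cr (tn x) u \<noteq> 0" using that(4) by auto
      then show ?thesis using local[OF that(1,2) _ that(3)] that(4) by blast
    qed
    show "\<exists>k. k \<noteq> 0 \<and> boundary_tangent D x (k *\<^sub>R tn x)"
      if "x \<in> G ` A" "x \<notin> N0" "cr (tn x) u \<noteq> 0" "\<exists>\<epsilon>>0. \<forall>t\<in>{0<..<\<epsilon>}. x + t *\<^sub>R u \<notin> closure D" for x u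
      using local[OF that] by blast
  qed (use R A G tn inj N0 in auto)
  \<comment> \<open>The ball is chosen by \<open>SOME\<close>. The estimate holds for every
    admissible ball, so it suffices that one exists.\<close>
  define cR where "cR = (SOME cR. snd cR > 0 \<and> closure D \<subseteq> ball (fst cR) (snd cR))"
  have "closure D \<subseteq> cball c R" using DR by (rule closure_minimal) simp
  also have "cball c R \<subseteq> ball c (R + 1)" by auto
  finally have "snd (c, R+1) > 0 \<and> closure D \<subseteq> ball (fst (c, R+1)) (snd (c, R+1))" using R by simp
  then have "snd cR > 0 \<and> closure D \<subseteq> ball (fst cR) (snd cR)" unfolding cR_def by (rule someI)
  then show ?thesis using resistance_wrt_ge[of "fst cR" "snd cR"] pos
    unfolding mean_resistance_def cR_def[symmetric] Let_def by blast
qed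

text \<open>Comparison with the circumscribed square.\<close>

lemma measure_le_of_cball:
  fixes D :: "pt set"
  assumes "D \<in> lmeasurable" "D \<subseteq> cball c R" "R > 0"
  shows "measure lebesgue D \<le> 4 * R\<^sup>2"
proof -
  have sub: "D \<subseteq> cbox (c - vector [R,R]) (c + vector [R,R])"
  proof
    fix y assume "y \<in> D"
    then have "norm (y - c) \<le> R" using assms(2) by (auto simp: dist_norm norm_minus_commute)
    then have "\<bar>(y - c) $ i\<bar> \<le> R" for i using component_le_norm_cart[of "y - c" i] by linarith
    from this[of 1] this[of 2] show "y \<in> cbox (c - vector [R,R]) (c + vector [R,R])"
      by (auto simp: mem_box_cart forall_2 vector_2 abs_le_iff)
  qed
  have "measure lebesgue D \<le> measure lebesgue (cbox (c - vector [R,R]) (c + vector [R,R]))"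
    using sub assms(1) by (intro measure_mono_fmeasurable) (auto simp: fmeasurableD)
  also have "\<dots> = (2 * R)\<^sup>2"
  proof -
    have "c \<in> cbox (c - vector [R,R]) (c + vector [R,R])"
      using assms(3) by (auto simp: mem_box_cart forall_2 vector_2)
    then have "cbox (c - vector [R,R]) (c + vector [R,R]) \<noteq> {}" by blast
    from content_cbox_cart[OF this] show ?thesis by (simp add: UNIV_2 vector_2 power2_eq_square)
  qed
  finally show ?thesis by (simp add: power2_eq_square)
qed

theorem theorem2:
  fixes D :: "(real^2) set" and c :: "real^2" and R :: real
  assumes "planar_domain D"
    and "R > 0"
    and "D \<subseteq> cball c R"
  shows "mean_resistance D / R \<ge> pi / 54 * (measure lebesgue D / R^2) ^ 3"
proof (cases "measure lebesgue D = 0")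
  case True
  \<comment> \<open>The left side is 0, and the resistance is nonnegative as a value of
    \<open>enn2real\<close>.\<close>
  then show ?thesis using assms(2) by (simp add: mean_resistance_def resistance_wrt_def Let_def)
next
  case False
  define y where "y = measure lebesgue D / R^2"
  have D: "open D" "bounded D" using assms(1) by (auto simp: planar_domain_def)
  have lm: "D \<in> lmeasurable" "closure D \<in> lmeasurable"
    using D by (auto intro: lmeasurable_open lmeasurable_compact simp: compact_closure)
  have le: "measure lebesgue D \<le> measure lebesgue (closure D)"
    using lm closure_subset by (intro measure_mono_fmeasurable) (auto simp: fmeasurableD)
  have pos: "measure lebesgue D > 0" using False by (simp add: zero_less_measure_iff)
  have y: "0 \<le> y" "y \<le> 4"
    using measure_le_of_cball[OF lm(1) assms(3,2)] assms(2) by (auto simp: y_def divide_le_eq)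
  have "pi / 54 * y ^ 3 = pi / 54 * y\<^sup>2 * y" by (simp add: power3_eq_cube power2_eq_square)
  \<comment> \<open>The factor 27 turns pi/54 into the constant pi/2 of the quadratic bound; y <= 4
    is more than enough.\<close>
  also have "\<dots> \<le> pi / 54 * y\<^sup>2 * 27" using y by (intro mult_left_mono) auto
  also have "\<dots> = pi / 2 * (measure lebesgue D)\<^sup>2 / R^3 / R"
    using assms(2) by (simp add: y_def power_divide power2_eq_square power3_eq_cube)
  also have "\<dots> \<le> pi / 2 * (measure lebesgue (closure D))\<^sup>2 / R^3 / R"
    using le assms(2) by (intro divide_right_mono mult_left_mono power_mono) auto
  also have "\<dots> \<le> mean_resistance D / R"
    using mean_resistance_ge[OF assms] le pos assms(2) by (intro divide_right_mono) auto
  finally show ?thesis by (simp add: y_def)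
qed

end
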